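(* Consider the random walk in random environment on the coloured rooted regular tree $\mathbb{V}$ of order $d$ described in the context, with associated random matrix $(\eta_{ij})_{i,j=1,\dots,d}$, chaos process $(Y_n)_{n\ge0}$ and sum process $(Z_n)_{n\ge0}$. For $x\in[0,1]$ let $\boldsymbol{m}(x)$ be the $d\times d$ matrix with entries $m_{ij}(x)=\mathbb{E}(\eta_{ij}^x)$. Assume that $\boldsymbol{m}(x)$ is regular, i.e. there exists an integer $N$ such that for every $x\in[0,1]$, $(\boldsymbol{m}(x)^N)_{ij}>0$ for all $i,j$. Denote by $\rho(x)$ the largest eigenvalue of $\boldsymbol{m}(x)$ for $x\in[0,1]$ and let $\lambda=\inf_{x\in[0,1]}\rho(x)$. 1. If $\lambda<1$, then for almost every realisation of the environment the random walk is ergodic, and $Z_\infty<\infty$ almost surely. 2. If $\lambda>1$, then for almost every realisation of the environment the random walk is transient, and $Y_\infty=\infty$ almost surely.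
   Context: Tree and colours. Let $d\ge 1$ be an integer. The vertex set is $\mathbb{V}=\bigcup_{n\ge 0}\mathbb{V}_n$ with $\mathbb{V}_0=\{\emptyset\}$ (the root) and $\mathbb{V}_n=\{1,\dots,d\}^n$. For $v=(v_1,\dots,v_n)\in\mathbb{V}_n$ put $|v|=n$ and, for $k\le n$, $v|_k=(v_1,\dots,v_k)$. Write $vj=(v_1,\dots,v_n,j)$. The parent of $v\ne\emptyset$ is $v|_{|v|-1}$, and the edge joining $v\ne\emptyset$ to its parent is denoted $a(v)$. Put $\mathring{\mathbb{V}}=\mathbb{V}\setminus\{\emptyset\}$. A vertex $v\in\mathring{\mathbb{V}}$ has colour $v_{|v|}\in\{1,\dots,d\}$; the root is assigned an arbitrary fixed colour $\alpha\in\{1,\dots,d\}$. Environment. To each $v\in\mathring{\mathbb{V}}$ is attached a random vector $(p_{v,0},\dots,p_{v,d})$ with positive components and $\sum_{j=0}^d p_{v,j}=1$, whose distribution depends only on the colour of $v$; to the root is attached a random vector $(p_{\emptyset,1},\dots,p_{\emptyset,d})$ with positive components and $\sum_{j=1}^d p_{\emptyset,j}=1$. These vectors are independent for different vertices. It is assumed that $\mathbb{E}(1/p_{v,0})<\infty$ for every $v\in\mathring{\mathbb V}$. Random walk. Given the environment, $(X_n)$ is the Markov chain on $\mathbb{V}$ with $\mathbb{P}(X_{n+1}=uj\mid X_n=u)=p_{u,j}$ for $u\in\mathbb{V}$, $j=1,\dots,d$, and $\mathbb{P}(X_{n+1}=u|_{|u|-1}\mid X_n=u)=p_{u,0}$ for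 $u\in\mathring{\mathbb{V}}$; all other transition probabilities are $0$. "Ergodic" means positive recurrent (i.e. admitting a stationary probability distribution; the chain has period 2). Matrix $\eta$. $(\eta_{ij})_{i,j=1,\dots,d}$ is a random matrix whose $i$-th row has the law of $(p_{v,1}/p_{v,0},\dots,p_{v,d}/p_{v,0})$ for a vertex $v\in\mathring{\mathbb{V}}$ of colour $i$. It is assumed that $\mathbb{E}\,\eta_{ij}<\infty$ and $\mathbb{E}\,\eta_{ij}\log^+\eta_{ij}<\infty$ for all $i,j$, where $\log^+z=\max(0,\log z)$, and that the laws of the $\eta_{ij}$ have no atom at $0$. The entries of the matrix need not be independent or identically distributed. Chaos processes. Edge variables: $\xi_{a(v)}=p_{v|_{|v|-1},v_{|v|}}/p_{v|_{|v|-1},0}$ if $|v|\ge 2$, and $\xi_{a(v)}=p_{\emptyset,v_1}$ if $|v|=1$. For $v\in\mathbb{V}$, $\xi[v]=\prod_{k=1}^{|v|}\xi_{a(v|_k)}$ (with $\xi[\emptyset]=1$). $Y_n=\sum_{v\in\mathbb{V}_n}\xi[v]$, $Z_n=\sum_{k=0}^n Y_k$, $Y_\infty=\lim_{n\to\infty} Y_n$ (existence of the limit being part of the assertion) and $Z_\infty=\lim_{n\to\infty} Z_n=\sum_{v\in\mathbb{V}}\xi[v]$. *)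

theory Defs
  imports "HOL-Probability.Probability"
begin

section \<open>Markov chains with a discrete state space\<close>

definition chain_kernel :: "('a \<Rightarrow> 'a pmf) \<Rightarrow> 'a \<Rightarrow> nat \<Rightarrow> (nat \<Rightarrow> 'a) \<Rightarrow> 'a measure" where
  "chain_kernel K u n \<omega> =
     (case n of 0 \<Rightarrow> measure_pmf (return_pmf u) | Suc k \<Rightarrow> measure_pmf (K (\<omega> k)))"

text \<open>
  The law, on the space of trajectories, of the Markov chain with transition probabilities
  \<open>pmf (K x) y\<close> started at \<open>u\<close>; see \<open>chain_law_cylinder\<close> below.
\<close>

definition chain_law :: "('a \<Rightarrow> 'a pmf) \<Rightarrow> 'a \<Rightarrow> (nat \<Rightarrow> 'a) measure" where
  "chain_law K u =
     projective_family.lim UNIV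
       (Ionescu_Tulcea.CI (chain_kernel K u) (\<lambda>_. count_space UNIV)) (\<lambda>_. count_space UNIV)"

definition transient_chain :: "('a \<Rightarrow> 'a pmf) \<Rightarrow> bool" where
  "transient_chain K \<longleftrightarrow>
     (\<forall>u. measure (chain_law K u) {X \<in> space (chain_law K u). \<exists>n\<ge>1. X n = u} < 1)"

text \<open>
  Positive recurrence, expressed by a stationary probability distribution. This is meant for
  irreducible chains only; the random walks below are irreducible. No aperiodicity is required.
\<close>

definition ergodic_chain :: "('a \<Rightarrow> 'a pmf) \<Rightarrow> bool" where
  "ergodic_chain K \<longleftrightarrow> (\<exists>\<pi>. bind_pmf \<pi> K = \<pi>)"

lemma Ionescu_Tulcea_chain:
  fixes K :: "'a \<Rightarrow> 'a pmf"
  shows "Ionescu_Tulcea (chain_kernel K u) (\<lambda>_. count_space UNIV)"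
proof (rule Ionescu_Tulcea.intro)
  fix i :: nat
  show "chain_kernel K u i \<in>
      measurable (PiM {0..<i} (\<lambda>_. count_space UNIV)) (subprob_algebra (count_space UNIV))"
  proof (cases i)
    case 0
    have "measure_pmf (return_pmf u) \<in> space (subprob_algebra (count_space UNIV))"
      by (simp add: space_subprob_algebra measure_pmf.subprob_space_axioms)
    moreover have "chain_kernel K u i = (\<lambda>\<omega>. measure_pmf (return_pmf u))"
      using 0 by (simp add: chain_kernel_def[abs_def])
    ultimately show ?thesis by (simp only: measurable_const)
  next
    case (Suc k)
    have 1: "(\<lambda>\<omega>. \<omega> k) \<in> measurable (PiM {0..<i} (\<lambda>_. count_space UNIV)) (count_space UNIV)"
      using Suc by (intro measurable_component_singleton) simp
    have 2: "(\<lambda>x. measure_pmf (K x)) \<in> measurable (count_space UNIV) (subprob_algebra (count_space UNIV))"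
      by (auto simp: space_subprob_algebra measure_pmf.subprob_space_axioms)
    have "chain_kernel K u i = (\<lambda>\<omega>. measure_pmf (K (\<omega> k)))"
      using Suc by (simp add: chain_kernel_def[abs_def])
    then show ?thesis using measurable_compose[OF 1 2] by (simp only:)
  qed
next
  fix i :: nat and x :: "nat \<Rightarrow> 'a"
  show "prob_space (chain_kernel K u i x)"
    by (auto simp: chain_kernel_def measure_pmf.prob_space_axioms split: nat.split)
qed

lemma chain_law_cylinder:
  fixes K :: "'a \<Rightarrow> 'a pmf"
  shows "measure (chain_law K u) {X \<in> space (chain_law K u). \<forall>i\<le>n. X i = x i} =
     (if x 0 = u then \<Prod>i<n. pmf (K (x i)) (x (Suc i)) else 0)"
proof -
  interpret IT: Ionescu_Tulcea "chain_kernel K u" "\<lambda>_. count_space UNIV"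
    by (rule Ionescu_Tulcea_chain)
  let ?M = "\<lambda>_::nat. count_space (UNIV :: 'a set)"
  let ?A = "\<lambda>n. PiE {0..<Suc n} (\<lambda>i. {x i})"
  have A: "?A n \<in> sets (PiM {0..<Suc n} ?M)" for n
    by (intro sets_PiM_I_finite) auto
  have C: "emeasure (IT.C 0 (Suc n) (\<lambda>x. undefined)) (?A n) =
     (if x 0 = u then \<Prod>i<n. pmf (K (x i)) (x (Suc i)) else 0)" for n
  proof (induction n)
    case 0
    have "emeasure (IT.C 0 (Suc 0) (\<lambda>x. undefined)) (?A 0) =
        emeasure (IT.eP 0 (\<lambda>x. undefined)) (?A 0)"
      using bind_return[OF IT.measurable_eP[of 0], of "\<lambda>x. undefined"] by (simp add: space_PiM)
    also have "\<dots> = emeasure (chain_kernel K u 0 (\<lambda>x. undefined))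
        ((\<lambda>y. (\<lambda>x. undefined)(0 := y)) -` ?A 0 \<inter> space (count_space UNIV))"
      using A[of 0] by (intro IT.emeasure_eP) (auto simp: space_PiM)
    also have "(\<lambda>y. (\<lambda>x. undefined)(0 := y)) -` ?A 0 \<inter> space (count_space UNIV) = {x 0}"
      by (auto simp: PiE_def Pi_def extensional_def)
    finally show ?case
      by (simp add: chain_kernel_def emeasure_pmf_single)
  next
    case (Suc n)
    let ?C = "IT.C 0 (Suc n) (\<lambda>x. undefined)"
    have sC: "sets ?C = sets (PiM {0..<Suc n} ?M)"
      using IT.sets_C[of "\<lambda>x. undefined" 0 "Suc n"] by (simp add: space_PiM)
    have spC: "space ?C = space (PiM {0..<Suc n} ?M)"
      using sC by (rule sets_eq_imp_space_eq)
    have eP: "IT.eP (Suc n) \<in> measurable ?C (subprob_algebra (PiM {0..<Suc (Suc n)} ?M))"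
      using IT.measurable_eP[of "Suc n"] by (simp only: measurable_cong_sets[OF sC refl])
    have "emeasure (IT.C 0 (Suc (Suc n)) (\<lambda>x. undefined)) (?A (Suc n)) =
        (\<integral>\<^sup>+\<omega>. emeasure (IT.eP (Suc n) \<omega>) (?A (Suc n)) \<partial>?C)"
      using A[of "Suc n"] eP spC
      by (subst IT.C.simps(2), subst emeasure_bind[where N="PiM {0..<Suc (Suc n)} ?M"])
         (auto simp: space_PiM PiE_eq_empty_iff simp del: IT.C.simps)
    also have "\<dots> = (\<integral>\<^sup>+\<omega>. ennreal (pmf (K (x n)) (x (Suc n))) * indicator (?A n) \<omega> \<partial>?C)"
    proof (rule nn_integral_cong)
      fix \<omega> assume "\<omega> \<in> space ?C"
      then have \<omega>: "\<omega> \<in> space (PiM {0..<Suc n} ?M)" by (simp only: spC)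
      have "emeasure (IT.eP (Suc n) \<omega>) (?A (Suc n)) = emeasure (chain_kernel K u (Suc n) \<omega>)
        (fun_upd \<omega> (Suc n) -` ?A (Suc n) \<inter> space (count_space UNIV))"
        using A[of "Suc n"] \<omega> by (intro IT.emeasure_eP) auto
      also have "fun_upd \<omega> (Suc n) -` ?A (Suc n) \<inter> space (count_space UNIV) =
          (if \<omega> \<in> ?A n then {x (Suc n)} else {})"
        using \<omega> by (auto simp: PiE_def Pi_def extensional_def space_PiM less_Suc_eq)
      finally show "emeasure (IT.eP (Suc n) \<omega>) (?A (Suc n)) =
          ennreal (pmf (K (x n)) (x (Suc n))) * indicator (?A n) \<omega>"
      proof (rule trans)
        have K: "chain_kernel K u (Suc n) \<omega> = measure_pmf (K (\<omega> n))"
          by (simp add: chain_kernel_def)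
        show "emeasure (chain_kernel K u (Suc n) \<omega>) (if \<omega> \<in> ?A n then {x (Suc n)} else {}) =
            ennreal (pmf (K (x n)) (x (Suc n))) * indicator (?A n) \<omega>"
          unfolding K by (auto simp: emeasure_pmf_single PiE_iff)
      qed
    qed
    also have "\<dots> = pmf (K (x n)) (x (Suc n)) * emeasure ?C (?A n)"
      using A[of n] sC by (intro nn_integral_cmult_indicator) (simp only:)
    also note Suc.IH
    finally show ?case
      by (simp add: ennreal_mult' mult.commute prod_nonneg del: IT.C.simps split: if_splits)
  qed
  have eq: "{X \<in> space (chain_law K u). \<forall>i\<le>n. X i = x i} =
      prod_emb UNIV ?M {0..<Suc n} (?A n)"
    by (auto simp: chain_law_def prod_emb_def space_PiM PiE_iff less_Suc_eq_le)
  have "emeasure (chain_law K u) (prod_emb UNIV ?M {0..<Suc n} (?A n)) =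
      emeasure (IT.CI {0..<Suc n}) (?A n)"
    unfolding chain_law_def by (rule IT.lim[OF _ A]) simp
  also have "\<dots> = emeasure (IT.C 0 (Suc n) (\<lambda>x. undefined))
      (prod_emb {0..<Suc n} ?M {0..<Suc n} (?A n))"
    by (rule IT.emeasure_CI[OF subset_refl A])
  also have "prod_emb {0..<Suc n} ?M {0..<Suc n} (?A n) = ?A n"
    using sets.sets_into_space[OF A[of n]] by (intro prod_emb_id) (simp only: space_PiM)
  also note C
  finally show ?thesis
    unfolding eq by (auto simp: measure_def prod_nonneg)
qed

section \<open>The walk on the coloured tree\<close>

text \<open>
  The colours are the elements of a finite type \<open>'c\<close> with \<open>d = CARD('c)\<close>, and the vertices of the
  tree are all the lists over \<open>'c\<close>: the root is \<open>[]\<close>, the child \<open>vj\<close> of \<open>v\<close> is \<open>v @ [j]\<close>, the parent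
  of \<open>v\<close> is \<open>butlast v\<close>.

  A realised environment maps a vertex \<open>v\<close> to a vector indexed by \<open>'c option\<close>: the component
  \<open>Some j\<close> is \<open>p\<^sub>v\<^sub>,\<^sub>j\<close> and the component \<open>None\<close> is \<open>p\<^sub>v\<^sub>,\<^sub>0\<close>, the probability of a step to the parent.
  At the root, which has no parent, the component \<open>None\<close> is \<open>0\<close>.
\<close>

type_synonym 'c environment = "'c list \<Rightarrow> real ^ ('c option)"

definition colour :: "'c \<Rightarrow> 'c list \<Rightarrow> 'c" where
  "colour \<alpha> v = (if v = [] then \<alpha> else last v)"

definition tree_move :: "'c list \<Rightarrow> 'c option \<Rightarrow> 'c list" where
  "tree_move u s = (case s of None \<Rightarrow> butlast u | Some j \<Rightarrow> u @ [j])"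

text \<open>
  Only meaningful if the components of \<open>e u\<close> are nonnegative with sum \<open>1\<close>; see \<open>walk_step_child\<close>
  and the lemmas following it.
\<close>

definition walk_step :: "('c::finite) environment \<Rightarrow> 'c list \<Rightarrow> 'c list pmf" where
  "walk_step e u = map_pmf (tree_move u) (embed_pmf (\<lambda>s. e u $ s))"

lemma pmf_env:
  fixes e :: "('c::finite) environment"
  assumes "\<And>s. e u $ s \<ge> 0" "(\<Sum>s\<in>UNIV. e u $ s) = 1"
  shows "pmf (embed_pmf (\<lambda>s. e u $ s)) s = e u $ s"
  using assms
  by (intro pmf_embed_pmf) (auto simp: nn_integral_count_space_finite sum_nonneg)

lemma tree_move_child: "tree_move u s = u @ [j] \<longleftrightarrow> s = Some j"
proof (cases s)
  case None
  have "butlast u \<noteq> u @ [j]"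
    by (metis Suc_n_not_le_n diff_le_self length_append_singleton length_butlast)
  then show ?thesis using None by (simp add: tree_move_def)
qed (auto simp: tree_move_def)

lemma tree_move_parent: "u \<noteq> [] \<Longrightarrow> tree_move u s = butlast u \<longleftrightarrow> s = None"
  using tree_move_child[of u None]
  by (cases s) (auto simp: tree_move_def dest: sym)

lemma walk_step_child:
  assumes "\<And>s. e u $ s \<ge> 0" "(\<Sum>s\<in>UNIV. e u $ s) = 1"
  shows "pmf (walk_step e u) (u @ [j]) = e u $ Some j"
proof -
  have "tree_move u -` {u @ [j]} = {Some j}" by (auto simp: tree_move_child)
  then show ?thesis
    using pmf_env[of e u, OF assms] by (simp add: walk_step_def pmf_map measure_pmf_single)
qed

lemma walk_step_parent:
  assumes "\<And>s. e u $ s \<ge> 0" "(\<Sum>s\<in>UNIV. e u $ s) = 1" "u \<noteq> []"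
  shows "pmf (walk_step e u) (butlast u) = e u $ None"
proof -
  have "tree_move u -` {butlast u} = {None}" using assms(3) by (auto simp: tree_move_parent)
  then show ?thesis
    using pmf_env[of e u, OF assms(1,2)] by (simp add: walk_step_def pmf_map measure_pmf_single)
qed

section \<open>Chaos processes\<close>

text \<open>The variable attached to the edge joining \<open>v \<noteq> []\<close> to its parent.\<close>

definition edge_var :: "('c::finite) environment \<Rightarrow> 'c list \<Rightarrow> real" where
  "edge_var e v =
     (if length v \<ge> 2 then e (butlast v) $ Some (last v) / e (butlast v) $ None
      else e [] $ Some (last v))"

definition path_weight :: "('c::finite) environment \<Rightarrow> 'c list \<Rightarrow> real" where
  "path_weight e v = (\<Prod>k = 1..length v. edge_var e (take k v))"

definition chaos_Y :: "('c::finite) environment \<Rightarrow> nat \<Rightarrow> real" where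
  "chaos_Y e n = (\<Sum>v | length v = n. path_weight e v)"

definition chaos_Z :: "('c::finite) environment \<Rightarrow> nat \<Rightarrow> real" where
  "chaos_Z e n = (\<Sum>k\<le>n. chaos_Y e k)"

section \<open>Moment matrices and their largest eigenvalue\<close>

definition moment_matrix :: "'b measure \<Rightarrow> ('b \<Rightarrow> real ^ 'c ^ 'c) \<Rightarrow> real \<Rightarrow> real ^ 'c ^ 'c" where
  "moment_matrix Q \<eta> x = (\<chi> i j. \<integral>\<omega>. (\<eta> \<omega> $ i $ j) powr x \<partial>Q)"

text \<open>The operation \<open>^\<close> on this type would be the componentwise power.\<close>

definition mat_pow :: "real ^ 'c ^ 'c \<Rightarrow> nat \<Rightarrow> real ^ 'c ^ 'c" where
  "mat_pow A N = (((**) A) ^^ N) (mat 1)"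

definition regular_family :: "(real \<Rightarrow> real ^ 'c ^ 'c) \<Rightarrow> bool" where
  "regular_family m \<longleftrightarrow> (\<exists>N. \<forall>x\<in>{0..1}. \<forall>i j. mat_pow (m x) N $ i $ j > 0)"

definition mat_eigenvalue :: "real ^ 'c ^ 'c \<Rightarrow> real \<Rightarrow> bool" where
  "mat_eigenvalue A k \<longleftrightarrow> (\<exists>v. v \<noteq> 0 \<and> A *v v = k *s v)"

text \<open>
  The largest real eigenvalue. For the regular nonnegative matrices considered here it exists and,
  by the Perron-Frobenius theorem, equals the largest modulus of a complex eigenvalue.
\<close>

definition largest_eigenvalue :: "real ^ 'c ^ 'c \<Rightarrow> real" where
  "largest_eigenvalue A = Max {k. mat_eigenvalue A k}"

end

theory Submission
  imports Defs
begin

text \<open>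
  Given the environment, the walk is reversible, with conductance \<open>\<xi>[v]\<close> on the edge above \<open>v\<close>.

  If \<open>\<rho>(x) < 1\<close> for some \<open>x\<close>, a positive eigenvector of \<open>m(x)\<close> shows that the expectation of
  \<open>\<Sum>|v|=n. \<xi>[v]^x\<close> decays geometrically. Hence these sums are summable almost surely, and since
  \<open>\<xi> \<le> \<xi>^x\<close> for \<open>\<xi> \<le> 1\<close>, so are the \<open>Y\<^sub>n\<close>: the total conductance is finite and, normalised, gives a
  stationary distribution.

  If \<open>\<rho> > 1\<close> on the unit interval, a Cramer-type lower bound, at the minimum point of the moment
  function of paths that return to a fixed colour, yields \<open>n\<close> and \<open>a \<le> 1\<close> such that the expected number
  \<open>m\<close> of descendants at distance \<open>n\<close> with relative weight at least \<open>a\<close> satisfies \<open>a m > 1\<close>. These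
  descendants form a branching process; by the second moment method, a vertex has with
  positive probability more than \<open>2 a^-k\<close> descendants in its \<open>k\<close>-th generation that have the same
  property, and so on indefinitely. Below such a vertex \<open>Y\<^sub>n\<close> grows exponentially and the effective
  conductance to infinity is positive. By independence there are such vertices below every vertex.
\<close>

section \<open>Positive matrices\<close>

text \<open>The obstacle in the supercritical case is that the moments are under control only for
  exponents in the unit interval, whereas a Cramer bound needs a derivative at the minimum point,
  which may be an end point. All ratios are therefore restricted to a window [\<delta>, 1/\<delta>].
  This makes the moments finite and differentiable for every real exponent. The same truncation
  bounds the sums in the recursion \<open>s / (1 + s)\<close> of the escape probabilities, so that
  it can be linearised with a fixed loss. Returning to one colour at fixed times replaces products
  of matrices by powers of one number and makes the embedded process single-type. The condition a
  \<le> 1, together with a m > 1, also yields m > 1, which keeps the second moments of the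
  generation sizes comparable with the squared means. One inequality, a truncated sum of at least 2
  over a block of generations, drives both conclusions: it doubles the total weight and it
  compensates the loss in the escape probability.\<close>

lemma mat_eigenvalue_alt:
  fixes A :: "real ^ 'c ^ 'c"
  shows "mat_eigenvalue A k \<longleftrightarrow> det (A - mat k) = 0"
proof -
  have "(A - mat k) *v v = A *v v - k *s v" for v :: "real ^ 'c"
    by (simp add: vec_eq_iff matrix_vector_mult_def mat_def left_diff_distrib sum_subtractf
        if_distrib [where f = "\<lambda>x. x * _"] cong: if_cong)
  then have "mat_eigenvalue A k \<longleftrightarrow> (\<exists>v. v \<noteq> 0 \<and> (A - mat k) *v v = 0)"
    by (simp add: mat_eigenvalue_def)
  also have "\<dots> \<longleftrightarrow> det (A - mat k) = 0"
    using matrix_left_invertible_ker [of "A - mat k"] invertible_det_nz [of "A - mat k"]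
    by (auto simp: invertible_left_inverse)
  finally show ?thesis .
qed

lemma vec_abs_max_attained:
  obtains i where "\<And>j. \<bar>(v :: real ^ 'c) $ j\<bar> \<le> \<bar>v $ i\<bar>"
proof -
  have "Max (range (\<lambda>i. \<bar>v $ i\<bar>)) \<in> range (\<lambda>i. \<bar>v $ i\<bar>)"
    by (intro Max_in) auto
  then obtain i where "Max (range (\<lambda>i. \<bar>v $ i\<bar>)) = \<bar>v $ i\<bar>"
    by blast
  then show thesis
    by (intro that[of i]) (metis Max_ge finite_class.finite_UNIV finite_imageI rangeI)
qed

text \<open>Read the eigenvalue equation at a coordinate of maximal modulus. Besides bounding the
  set of eigenvalues, this later forces at least two colours in the supercritical case.\<close>

lemma eigenvalue_le_row_sum:
  fixes A :: "real ^ 'c ^ 'c"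
  assumes "\<And>i j. \<bar>A $ i $ j\<bar> \<le> B" "A *v v = k *s v" "v \<noteq> 0"
  shows "\<bar>k\<bar> \<le> B * CARD('c)"
proof -
  obtain i where i: "\<bar>v $ j\<bar> \<le> \<bar>v $ i\<bar>" for j
    using vec_abs_max_attained[of v] by blast
  have "v $ i \<noteq> 0"
    using i assms(3) by (auto simp: vec_eq_iff)
  have "\<bar>k\<bar> * \<bar>v $ i\<bar> = \<bar>(A *v v) $ i\<bar>"
    by (simp add: assms abs_mult)
  also have "\<dots> \<le> (\<Sum>j\<in>UNIV. \<bar>A $ i $ j * v $ j\<bar>)"
    by (simp add: matrix_vector_mult_def)
  also have "\<dots> \<le> (\<Sum>j\<in>(UNIV :: 'c set). B * \<bar>v $ i\<bar>)"
    unfolding abs_mult by (intro sum_mono mult_mono assms i) (auto intro: order_trans[OF abs_ge_zero assms(1)])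
  also have "\<dots> = B * CARD('c) * \<bar>v $ i\<bar>"
    by simp
  finally show ?thesis
    using \<open>v $ i \<noteq> 0\<close> by simp
qed

text \<open>\<open>largest_eigenvalue\<close> is a \<open>Max\<close>, which is meaningful only on a
  finite set. Eigenvalues are roots of the characteristic polynomial, and this is nonzero because it
  does not vanish beyond the row sum bound.\<close>

lemma finite_eigenvalues: "finite {k. mat_eigenvalue (A :: real ^ 'c ^ 'c) k}"
proof -
  \<comment> \<open>Leibniz expansion of \<open>det (A - mat k)\<close>, with entries that are
    polynomials in \<open>k\<close>.\<close>
  define P where "P = (\<Sum>\<pi> | \<pi> permutes (UNIV :: 'c set).
    [:of_int (sign \<pi>):] * (\<Prod>i\<in>UNIV. [:A $ i $ \<pi> i, if i = \<pi> i then -1 else 0:]))"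
  have P: "poly P k = det (A - mat k)" for k
    unfolding P_def det_def poly_sum poly_mult poly_prod
    by (intro sum.cong prod.cong refl arg_cong2 [where f = "(*)"]) (auto simp: mat_def)
  obtain B where B: "\<And>i j. \<bar>A $ i $ j\<bar> \<le> B"
  proof
    show "\<bar>A $ i $ j\<bar> \<le> Max (range (\<lambda>(i, j). \<bar>A $ i $ j\<bar>))" for i j
      by (intro Max_ge) (auto intro: image_eqI[where x = "(i, j)"])
  qed
  have "\<not> mat_eigenvalue A (\<bar>B * CARD('c)\<bar> + 1)"
  proof
    assume "mat_eigenvalue A (\<bar>B * CARD('c)\<bar> + 1)"
    then obtain v where "A *v v = (\<bar>B * CARD('c)\<bar> + 1) *s v" "v \<noteq> 0"
      by (auto simp: mat_eigenvalue_def)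
    from eigenvalue_le_row_sum [OF B this] show False
      by linarith
  qed
  then have "P \<noteq> 0"
    by (metis P mat_eigenvalue_alt poly_0)
  then show ?thesis
    using poly_roots_finite [of P] by (simp add: P mat_eigenvalue_alt)
qed

text \<open>The eigenvector is a fixed point of the normalised action of \<open>A\<close> on the simplex.\<close>

lemma positive_eigenvector_exists:
  fixes A :: "real ^ 'c ^ 'c"
  assumes A: "\<And>i j. A $ i $ j > 0"
  obtains v r where "A *v v = r *s v" "r > 0" "\<And>i. v $ i > 0"
proof -
  define S :: "(real ^ 'c) set" where "S = {v. (\<forall>i. 0 \<le> v $ i) \<and> (\<Sum>i\<in>UNIV. v $ i) = 1}"
  define s where "s v = (\<Sum>i\<in>UNIV. (A *v v) $ i)" for v
  have Av: "(A *v v) $ i > 0" if "v \<in> S" for v i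
  proof -
    have "\<not> (\<forall>j. v $ j \<le> 0)"
      using that sum_nonpos [of UNIV "\<lambda>j. v $ j"] by (auto simp: S_def)
    then obtain j where "v $ j > 0"
      by (auto simp: not_le)
    then show ?thesis
      using that A unfolding matrix_vector_mult_def
      by (auto simp: S_def less_imp_le intro!: sum_pos2[of UNIV j])
  qed
  have s: "s v > 0" if "v \<in> S" for v
    unfolding s_def using Av[OF that] by (intro sum_pos) auto
  have "compact S"
  proof -
    have "S = (\<Inter>i. {v. 0 \<le> v $ i}) \<inter> {v. (\<Sum>i\<in>UNIV. v $ i) = 1}"
      by (auto simp: S_def)
    moreover have "closed \<dots>"
      by (intro closed_Int closed_INT ballI closed_Collect_le closed_Collect_eq continuous_intros)
    moreover have "bounded S"
    proof (rule boundedI)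
      fix v assume "v \<in> S"
      then show "norm v \<le> 1"
        using norm_le_l1_cart [of v] by (simp add: S_def)
    qed
    ultimately show ?thesis
      by (simp add: compact_eq_bounded_closed)
  qed
  moreover have "convex S"
    by (auto simp: convex_def S_def sum.distrib sum_distrib_left[symmetric])
  moreover have "axis undefined 1 \<in> S"
    by (auto simp: S_def axis_def)
  moreover have "continuous_on S (\<lambda>v. (1 / s v) *s (A *v v))"
  proof -
    have *: "continuous_on S s"
      unfolding s_def matrix_vector_mult_def by (simp add: continuous_intros)
    have **: "continuous_on S (\<lambda>v. A *v v)"
      by (intro linear_continuous_on) (simp add: matrix_vector_mul_bounded_linear)
    have "continuous_on S (\<lambda>v. (1 / s v) *\<^sub>R (A *v v))"
      using s by (intro continuous_intros * **) force
    then show ?thesis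
      by (simp add: scalar_mult_eq_scaleR)
  qed
  moreover have "(\<lambda>v. (1 / s v) *s (A *v v)) \<in> S \<rightarrow> S"
  proof
    fix v assume "v \<in> S"
    then show "(1 / s v) *s (A *v v) \<in> S"
      using s[of v] Av[of v] by (auto simp: S_def s_def sum_divide_distrib[symmetric] less_imp_le)
  qed
  ultimately obtain v where v: "v \<in> S" "(1 / s v) *s (A *v v) = v"
    using brouwer [of S "\<lambda>v. (1 / s v) *s (A *v v)"] by auto
  show ?thesis
  proof (rule that)
    show "s v > 0" using s v by auto
    then show "A *v v = s v *s v"
      by (subst (3) v(2)[symmetric]) (simp add: vec_eq_iff)
    show "v $ i > 0" for i
      using Av[OF v(1), of i] s[OF v(1)] by (subst v(2)[symmetric]) simp
  qed
qed

text \<open>The positive eigenvector shows that the set of eigenvalues is nonempty and contains a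
  positive number. The subcritical case will use its eigenvalue as a number below the largest one;
  the supercritical case takes an eigenvector of the largest eigenvalue, with arbitrary
  signs.\<close>

lemma largest_eigenvalue_positive_matrix:
  fixes A :: "real ^ 'c ^ 'c"
  assumes A: "\<And>i j. A $ i $ j > 0"
  shows "mat_eigenvalue A (largest_eigenvalue A)" "largest_eigenvalue A > 0"
    "mat_eigenvalue A k \<Longrightarrow> k \<le> largest_eigenvalue A"
proof -
  obtain v r where v: "A *v v = r *s v" "r > 0" "\<And>i. v $ i > 0"
    using positive_eigenvector_exists [of A] A by blast
  have "v \<noteq> 0"
    using v(3)[of undefined] by auto
  with v have r: "mat_eigenvalue A r"
    by (auto simp: mat_eigenvalue_def)
  show "mat_eigenvalue A (largest_eigenvalue A)"
    unfolding largest_eigenvalue_def using Max_in [OF finite_eigenvalues] r by auto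
  show le: "mat_eigenvalue A k \<Longrightarrow> k \<le> largest_eigenvalue A" for k
    unfolding largest_eigenvalue_def by (intro Max_ge finite_eigenvalues) auto
  show "largest_eigenvalue A > 0"
    using le[OF r] v(2) by simp
qed

section \<open>Return probabilities of Markov chains\<close>

text \<open>The law of the first \<open>n + 1\<close> states, built from the first step so that
  first-step analysis is an induction on \<open>n\<close>. \<open>distr_chain_law\<close> ties it to
  \<open>chain_law\<close>.\<close>

primrec path_pmf :: "('a \<Rightarrow> 'a pmf) \<Rightarrow> nat \<Rightarrow> 'a \<Rightarrow> 'a list pmf" where
  "path_pmf K 0 x = return_pmf [x]"
| "path_pmf K (Suc n) x = bind_pmf (K x) (\<lambda>y. map_pmf ((#) x) (path_pmf K n y))"

lemma pmf_path_pmf: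
  "pmf (path_pmf K n x) l =
     (if length l = Suc n \<and> l ! 0 = x then \<Prod>i<n. pmf (K (l ! i)) (l ! Suc i) else 0)"
proof (induction n arbitrary: x l)
  case 0
  show ?case by (cases l) (auto simp: indicator_def)
next
  case (Suc n)
  show ?case
  proof (cases l)
    case Nil
    then show ?thesis
      by (auto simp: pmf_eq_0_set_pmf)
  next
    case (Cons a l')
    have 1: "pmf (map_pmf ((#) x) (path_pmf K n y)) (a # l') =
        (if a = x then pmf (path_pmf K n y) l' else 0)" for y
    proof (cases "a = x")
      case True
      then show ?thesis using pmf_map_inj'[of "(#) x"] by simp
    qed (auto simp: pmf_eq_0_set_pmf)
    define c where "c = pmf (path_pmf K n (l' ! 0)) l'"
    \<comment> \<open>A path started at \<open>y\<close> begins with \<open>y\<close>, so the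
      integral over the first step reduces to one point.\<close>
    have 2: "pmf (path_pmf K n y) l' = indicator {l' ! 0} y * c" for y
      by (simp add: Suc.IH c_def indicator_def)
    have "pmf (path_pmf K (Suc n) x) l = (if a = x then pmf (K x) (l' ! 0) * c else 0)"
      by (simp add: Cons pmf_bind 1 2 measure_pmf_single)
    moreover have "c = (if length l' = Suc n then \<Prod>i<n. pmf (K (l' ! i)) (l' ! Suc i) else 0)"
      by (simp add: c_def Suc.IH)
    ultimately show ?thesis
      by (auto simp: Cons prod.lessThan_Suc_shift simp del: prod.lessThan_Suc)
  qed
qed

text \<open>The trajectory space is the cylinder over the empty index set, whose mass is given by a
  probability measure of the projective family.\<close>

lemma prob_space_chain_law: "prob_space (chain_law K u)"
proof -
  interpret IT: Ionescu_Tulcea "chain_kernel K u" "\<lambda>_. count_space UNIV"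
    by (rule Ionescu_Tulcea_chain)
  let ?M = "\<lambda>_::nat. count_space (UNIV :: 'a set)"
  interpret P: prob_space "IT.CI {}"
    by (rule IT.PF.prob_space_P) auto
  have "emeasure (chain_law K u) (prod_emb UNIV ?M {} (space (PiM {} ?M))) =
      emeasure (IT.CI {}) (space (PiM {} ?M))"
    unfolding chain_law_def by (rule IT.lim) auto
  also have "space (PiM {} ?M) = space (IT.CI {})"
    by (rule IT.PF.space_P[symmetric]) auto
  also have "emeasure (IT.CI {}) \<dots> = 1"
    by (rule P.emeasure_space_1)
  also have "prod_emb UNIV ?M {} (space (IT.CI {})) = space (chain_law K u)"
    by (subst IT.PF.space_P) (auto simp: chain_law_def prod_emb_def space_PiM)
  finally show ?thesis
    by (rule prob_spaceI)
qed

lemma measurable_chain_law_component [measurable]: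
  "(\<lambda>X. X i) \<in> chain_law K u \<rightarrow>\<^sub>M count_space UNIV"
proof -
  interpret IT: Ionescu_Tulcea "chain_kernel K u" "\<lambda>_. count_space UNIV"
    by (rule Ionescu_Tulcea_chain)
  have "sets (chain_law K u) = sets (PiM UNIV (\<lambda>_. count_space UNIV))"
    by (simp add: chain_law_def)
  then show ?thesis
    by (subst measurable_cong_sets[OF _ refl]) (auto intro: measurable_component_singleton)
qed

section \<open>Laws of finitely many states\<close>

lemma map_upt_eq_iff: "map X [0..<n] = l \<longleftrightarrow> length l = n \<and> (\<forall>i<n. X i = l ! i)"
  by (auto simp: list_eq_iff_nth_eq)

lemma measurable_chain_law_map [measurable]:
  fixes K :: "'a \<Rightarrow> 'a pmf"
  assumes "countable (UNIV :: 'a set)"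
  shows "(\<lambda>X. map X [0..<n]) \<in> chain_law K u \<rightarrow>\<^sub>M count_space UNIV"
proof -
  have "countable (lists (UNIV :: 'a set))"
    using assms by (rule countable_lists)
  then have c: "countable (UNIV :: 'a list set)"
    by simp
  have "{X \<in> space (chain_law K u). length l = n \<and> (\<forall>i<n. X i = l ! i)} \<in> sets (chain_law K u)" for l
    by measurable
  then show ?thesis
    by (subst measurable_count_space_eq_countable)
       (auto simp: c vimage_def Int_def map_upt_eq_iff conj_commute)
qed

text \<open>On a countable type it suffices to compare singletons, and the preimage of a singleton
  is a cylinder, to which \<open>chain_law_cylinder\<close> applies.\<close>

lemma distr_chain_law:
  fixes K :: "'a \<Rightarrow> 'a pmf"
  assumes "countable (UNIV :: 'a set)"
  shows "distr (chain_law K u) (count_space UNIV) (\<lambda>X. map X [0..<Suc n]) = path_pmf K n u"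
proof (rule measure_eqI_countable[of _ UNIV])
  interpret prob_space "chain_law K u"
    by (rule prob_space_chain_law)
  have "countable (lists (UNIV :: 'a set))"
    using assms by (rule countable_lists)
  then show c: "countable (UNIV :: 'a list set)"
    by simp
  fix l :: "'a list"
  have eq: "(\<lambda>X. map X [0..<Suc n]) -` {l} \<inter> space (chain_law K u) =
      (if length l = Suc n then {X \<in> space (chain_law K u). \<forall>i\<le>n. X i = l ! i} else {})"
    unfolding vimage_def singleton_iff map_upt_eq_iff by (auto simp: less_Suc_eq_le)
  show "emeasure (distr (chain_law K u) (count_space UNIV) (\<lambda>X. map X [0..<Suc n])) {l} =
      emeasure (path_pmf K n u) {l}"
    using chain_law_cylinder[of K u n "\<lambda>i. l ! i"]
    by (subst emeasure_distr[OF measurable_chain_law_map[OF assms]])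
       (auto simp: eq emeasure_pmf_single pmf_path_pmf emeasure_eq_measure simp del: upt_Suc)
qed auto

text \<open>First-step analysis: superharmonicity off \<open>u\<close> carries the bound from
  \<open>n\<close> to \<open>n + 1\<close> steps, and \<open>h u \<ge> 1\<close> covers the start at
  \<open>u\<close>. Values in \<open>ennreal\<close> avoid integrability conditions.\<close>

lemma path_pmf_hit_le:
  fixes h :: "'a \<Rightarrow> ennreal" and K :: "'a \<Rightarrow> 'a pmf"
  assumes "h u \<ge> 1" "\<And>x. x \<noteq> u \<Longrightarrow> (\<integral>\<^sup>+y. h y \<partial>K x) \<le> h x"
  shows "emeasure (path_pmf K n x) {l. u \<in> set l} \<le> h x"
proof (induction n arbitrary: x)
  case 0
  show ?case
    using assms(1) by (cases "x = u") (auto simp: indicator_def)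
next
  case (Suc n)
  show ?case
  proof (cases "x = u")
    case True
    then show ?thesis
      using assms(1) measure_pmf.emeasure_le_1 order_trans by blast
  next
    case False
    have "emeasure (path_pmf K (Suc n) x) {l. u \<in> set l} =
        (\<integral>\<^sup>+y. emeasure (path_pmf K n y) {l. u \<in> set l} \<partial>K x)"
      using False by (simp add: vimage_def)
    also have "\<dots> \<le> (\<integral>\<^sup>+y. h y \<partial>K x)"
      by (intro nn_integral_mono Suc.IH)
    finally show ?thesis
      using assms(2)[OF False] by simp
  qed
qed

text \<open>After the first step from \<open>u\<close> a return is a hit of \<open>u\<close>, so its
  probability is at most the mean of \<open>h\<close> after one step, whatever the time
  horizon.\<close>

lemma transient_chainI:
  fixes K :: "'a \<Rightarrow> 'a pmf"
  assumes count: "countable (UNIV :: 'a set)"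
  assumes h: "\<And>u. \<exists>h :: 'a \<Rightarrow> ennreal. h u \<ge> 1 \<and> (\<forall>x. x \<noteq> u \<longrightarrow> (\<integral>\<^sup>+y. h y \<partial>K x) \<le> h x) \<and>
                (\<integral>\<^sup>+y. h y \<partial>K u) < 1"
  shows "transient_chain K"
  unfolding transient_chain_def
proof
  fix u
  interpret prob_space "chain_law K u"
    by (rule prob_space_chain_law)
  obtain h :: "'a \<Rightarrow> ennreal" where h: "h u \<ge> 1" "\<And>x. x \<noteq> u \<Longrightarrow> (\<integral>\<^sup>+y. h y \<partial>K x) \<le> h x"
    "(\<integral>\<^sup>+y. h y \<partial>K u) < 1"
    using h[of u] by blast
  define E where "E n = {X \<in> space (chain_law K u). \<exists>i\<in>{1..Suc n}. X i = u}" for n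
  have E: "range E \<subseteq> sets (chain_law K u)"
    by (auto simp: E_def)
  have "incseq E"
    by (force simp: E_def incseq_def)
  have le: "emeasure (chain_law K u) (E n) \<le> (\<integral>\<^sup>+y. h y \<partial>K u)" for n
  proof -
    have "E n = (\<lambda>X. map X [0..<Suc (Suc n)]) -` {l. u \<in> set (tl l)} \<inter> space (chain_law K u)"
      by (auto simp: E_def map_tl[symmetric] tl_upt simp del: upt_Suc)
    then have "emeasure (chain_law K u) (E n) =
        emeasure (distr (chain_law K u) (count_space UNIV) (\<lambda>X. map X [0..<Suc (Suc n)])) {l. u \<in> set (tl l)}"
      by (subst emeasure_distr[OF measurable_chain_law_map[OF count]]) auto
    also have "\<dots> = (\<integral>\<^sup>+y. emeasure (path_pmf K n y) {l. u \<in> set l} \<partial>K u)"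
      by (subst distr_chain_law[OF count]) (simp add: vimage_def)
    also have "\<dots> \<le> (\<integral>\<^sup>+y. h y \<partial>K u)"
      by (intro nn_integral_mono path_pmf_hit_le h) auto
    finally show ?thesis .
  qed
  have "(\<Union>n. E n) = {X \<in> space (chain_law K u). \<exists>n\<ge>1. X n = u}"
  proof (intro equalityI subsetI)
    fix X assume "X \<in> (\<Union>n. E n)"
    then show "X \<in> {X \<in> space (chain_law K u). \<exists>n\<ge>1. X n = u}"
      unfolding E_def by auto
  next
    fix X assume "X \<in> {X \<in> space (chain_law K u). \<exists>n\<ge>1. X n = u}"
    then obtain n where "n \<ge> 1" "X n = u" "X \<in> space (chain_law K u)"
      by auto
    then have "X \<in> E n"
      unfolding E_def by auto
    then show "X \<in> (\<Union>n. E n)"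
      by blast
  qed
  moreover have "emeasure (chain_law K u) (\<Union>n. E n) \<le> (\<integral>\<^sup>+y. h y \<partial>K u)"
    using SUP_emeasure_incseq[OF E \<open>incseq E\<close>] le by (metis SUP_least)
  ultimately have "emeasure (chain_law K u) {X \<in> space (chain_law K u). \<exists>n\<ge>1. X n = u} < 1"
    using h(3) by simp
  then show "measure (chain_law K u) {X \<in> space (chain_law K u). \<exists>n\<ge>1. X n = u} < 1"
    by (simp add: emeasure_eq_measure)
qed

section \<open>Weights and escape probabilities\<close>

text \<open>The environment of the subtree at \<open>v\<close>, re-rooted. Its root keeps the
  \<open>None\<close> component of \<open>v\<close>, so for \<open>v \<noteq> []\<close> it is
  treated as an inner vertex.\<close>

definition shift :: "'c list \<Rightarrow> 'c environment \<Rightarrow> 'c environment" where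
  "shift v e = (\<lambda>w. e (v @ w))"

text \<open>If the root of \<open>e\<close> stands for an inner vertex of colour \<open>i\<close>,
  this is a copy of the entry (i, j) of \<eta>.\<close>

definition ratio :: "('c::finite) environment \<Rightarrow> 'c \<Rightarrow> real" where
  "ratio e j = e [] $ Some j / e [] $ None"

text \<open>The \<open>\<phi>\<close>-transformed weight of the path from the root of \<open>e\<close> to \<open>w\<close>, where the root is treated
  as an inner vertex.\<close>

primrec weight :: "(real \<Rightarrow> real) \<Rightarrow> ('c::finite) list \<Rightarrow> 'c environment \<Rightarrow> real" where
  "weight \<phi> [] e = 1"
| "weight \<phi> (j # w) e = \<phi> (ratio e j) * weight \<phi> w (shift [j] e)"

definition words :: "nat \<Rightarrow> 'c list set" where
  "words n = {w. length w = n}"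

lemma shift_Nil [simp]: "shift [] e = e"
  by (simp add: shift_def)

lemma shift_shift [simp]: "shift w (shift v e) = shift (v @ w) e"
  by (simp add: shift_def)

lemma weight_append: "weight \<phi> (v @ w) e = weight \<phi> v e * weight \<phi> w (shift v e)"
  by (induction v arbitrary: e) auto

lemma finite_words [simp]: "finite (words n :: 'c::finite list set)"
  using finite_lists_length_eq[of "UNIV :: 'c set" n] by (simp add: words_def)

lemma card_words: "card (words n :: 'c::finite list set) = CARD('c) ^ n"
  using card_lists_length_eq[of "UNIV :: 'c set" n] by (simp add: words_def)

lemma words_0 [simp]: "words 0 = {[]}"
  by (auto simp: words_def)

lemma sum_words_Suc: "(\<Sum>w\<in>words (Suc n). f w) = (\<Sum>j\<in>UNIV. \<Sum>w\<in>words n. f ((j::'c::finite) # w))"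
proof -
  have "(\<Sum>w\<in>words (Suc n). f w) = (\<Sum>(j, w)\<in>UNIV \<times> words n. f (j # w))"
    by (rule sum.reindex_bij_witness[where i = "\<lambda>(j, w). j # w" and j = "\<lambda>w. (hd w, tl w)"])
       (auto simp: words_def length_Suc_conv)
  then show ?thesis
    by (simp add: sum.cartesian_product)
qed

lemma sum_words_add:
  "(\<Sum>w\<in>words (m + n). f w) = (\<Sum>u\<in>words m. \<Sum>w\<in>words n. f (u @ (w :: 'c::finite list)))"
  by (induction m arbitrary: f) (auto simp: sum_words_Suc)

lemma weight_nonneg: "(\<And>z. \<phi> z \<ge> 0) \<Longrightarrow> weight \<phi> w e \<ge> 0"
  by (induction w arbitrary: e) auto

lemma weight_mult: "weight (\<lambda>z. \<phi> z * \<psi> z) w e = weight \<phi> w e * weight \<psi> w e"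
  by (induction w arbitrary: e) (auto simp: algebra_simps)

definition pos_ratios :: "('c::finite) environment \<Rightarrow> bool" where
  "pos_ratios e \<longleftrightarrow> (\<forall>v j. ratio (shift v e) j > 0)"

lemma pos_ratios_shift: "pos_ratios e \<Longrightarrow> pos_ratios (shift v e)"
  by (simp add: pos_ratios_def)

lemma pos_ratios_pos: "pos_ratios e \<Longrightarrow> ratio e j > 0"
  unfolding pos_ratios_def by (metis shift_Nil)

lemma weight_pos: "pos_ratios e \<Longrightarrow> weight (\<lambda>z. z) w e > 0"
  by (induction w arbitrary: e) (auto simp: pos_ratios_pos pos_ratios_shift)

lemma weight_powr: "pos_ratios e \<Longrightarrow> weight (\<lambda>z. z powr x) w e = weight (\<lambda>z. z) w e powr x"
  by (induction w arbitrary: e)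
     (auto simp: pos_ratios_pos pos_ratios_shift powr_mult less_imp_le weight_pos)

text \<open>The lower end keeps moments with negative exponents finite, the upper end those with
  exponents above 1. As an indicator it can be multiplied along a path.\<close>

abbreviation window :: "real \<Rightarrow> real \<Rightarrow> real" where
  "window \<delta> \<equiv> indicator {\<delta>..1 / \<delta>}"

abbreviation trunc :: "real \<Rightarrow> real \<Rightarrow> real" where
  "trunc \<delta> z \<equiv> z * window \<delta> z"

lemma weight_window: "weight (window \<delta>) w e \<in> {0, 1}"
  by (induction w arbitrary: e) (auto simp: indicator_def)

text \<open>The \<open>l\<close>-th iterate of a linear operator: sum over the children, with the
  truncated ratios as coefficients. \<open>trunc_sum_add\<close> is its semigroup property.\<close>

definition trunc_sum :: "real \<Rightarrow> nat \<Rightarrow> ('c environment \<Rightarrow> real) \<Rightarrow> ('c::finite) environment \<Rightarrow> real" where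
  "trunc_sum \<delta> l F e = (\<Sum>w\<in>words l. weight (trunc \<delta>) w e * F (shift w e))"

lemma trunc_sum_0 [simp]: "trunc_sum \<delta> 0 F e = F e"
  by (simp add: trunc_sum_def)

lemma trunc_sum_add: "trunc_sum \<delta> (m + n) F e = trunc_sum \<delta> m (trunc_sum \<delta> n F) e"
  by (simp add: trunc_sum_def sum_words_add weight_append sum_distrib_left mult_ac)

lemma trunc_sum_Suc:
  "trunc_sum \<delta> (Suc n) F e = (\<Sum>j\<in>UNIV. trunc \<delta> (ratio e j) * trunc_sum \<delta> n F (shift [j] e))"
  by (simp add: trunc_sum_def sum_words_Suc sum_distrib_left mult_ac)

lemma trunc_nonneg: "0 < \<delta> \<Longrightarrow> 0 \<le> trunc \<delta> z"
  by (auto simp: indicator_def)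

lemma trunc_le: "0 < \<delta> \<Longrightarrow> trunc \<delta> z \<le> 1 / \<delta>"
  by (auto simp: indicator_def)

lemma trunc_sum_nonneg: "0 < \<delta> \<Longrightarrow> (\<And>e. 0 \<le> F e) \<Longrightarrow> 0 \<le> trunc_sum \<delta> l F e"
  by (auto simp: trunc_sum_def intro!: sum_nonneg mult_nonneg_nonneg weight_nonneg trunc_nonneg)

lemma trunc_sum_le:
  fixes e :: "('c::finite) environment"
  assumes "0 < \<delta>" "\<And>e. 0 \<le> F e" "\<And>e. F e \<le> 1"
  shows "trunc_sum \<delta> l F e \<le> (CARD('c) / \<delta>) ^ l"
proof (induction l arbitrary: e)
  case (Suc l)
  have "trunc_sum \<delta> (Suc l) F e \<le> (\<Sum>j\<in>(UNIV :: 'c set). 1 / \<delta> * (CARD('c) / \<delta>) ^ l)"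
    unfolding trunc_sum_Suc using assms
    by (intro sum_mono mult_mono Suc.IH trunc_le trunc_sum_nonneg) auto
  then show ?case
    by simp
qed (use assms in auto)

text \<open>\<open>esc n e\<close> is the probability that the walk in the environment \<open>e\<close>, started at the root of \<open>e\<close>
  and treating the root as an inner vertex, reaches depth \<open>n\<close> before it steps to the parent of the
  root.\<close>

primrec esc :: "nat \<Rightarrow> ('c::finite) environment \<Rightarrow> real" where
  "esc 0 e = 1"
| "esc (Suc n) e = (let s = \<Sum>j\<in>UNIV. ratio e j * esc n (shift [j] e) in s / (1 + s))"

section \<open>Bounds for escape probabilities and total weights\<close>

lemma frac_mono: "0 \<le> s \<Longrightarrow> s \<le> t \<Longrightarrow> s / (1 + s) \<le> t / (1 + (t::real))"
  by (simp add: field_simps)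

lemma esc_bounds:
  assumes "pos_ratios e"
  shows "0 \<le> esc n e \<and> esc n e \<le> 1"
  using assms
proof (induction n arbitrary: e)
  case (Suc n)
  then have "(\<Sum>j\<in>UNIV. ratio e j * esc n (shift [j] e)) \<ge> 0"
    by (intro sum_nonneg mult_nonneg_nonneg) (auto simp: pos_ratios_shift pos_ratios_pos less_imp_le)
  then show ?case
    by (simp add: Let_def)
qed auto

lemma esc_sum_nonneg: "pos_ratios e \<Longrightarrow> (\<Sum>j\<in>UNIV. ratio e j * esc n (shift [j] e)) \<ge> 0"
  by (intro sum_nonneg mult_nonneg_nonneg)
     (auto simp: pos_ratios_shift pos_ratios_pos less_imp_le esc_bounds)

lemma esc_Suc_le: "pos_ratios e \<Longrightarrow> esc (Suc n) e \<le> esc n e"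
proof (induction n arbitrary: e)
  case 0
  then show ?case
    using esc_bounds[of e "Suc 0"] by simp
next
  case (Suc n)
  show ?case
    unfolding esc.simps(2)[of "Suc n"] esc.simps(2)[of n e] Let_def
    by (intro frac_mono esc_sum_nonneg sum_mono mult_left_mono Suc.IH)
       (auto simp: Suc.prems pos_ratios_shift pos_ratios_pos less_imp_le)
qed

lemma decseq_esc: "pos_ratios e \<Longrightarrow> decseq (\<lambda>n. esc n e)"
  by (simp add: decseq_Suc_iff esc_Suc_le del: esc.simps)

text \<open>As long as \<open>s \<le> t\<close>, the recursion value \<open>s / (1 + s)\<close> is
  at least \<open>s / (1 + t)\<close>. Truncated sums over at most \<open>L\<close> generations are
  bounded by \<open>(CARD('c) / \<delta>) ^ L\<close>, so the lower bounds propagated here stay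
  below \<open>c\<close> times this number and every level costs the same factor.\<close>

lemma esc_lower:
  fixes e :: "('c::finite) environment"
  assumes "pos_ratios e" "0 < \<delta>" "\<delta> \<le> 1" "0 \<le> c"
    and F: "\<And>e. 0 \<le> F e" "\<And>e. F e \<le> 1" "\<And>v. c * F (shift v e) \<le> esc n (shift v e)"
    and "l \<le> L"
  shows "(1 / (1 + c * (CARD('c) / \<delta>) ^ L)) ^ l * c * trunc_sum \<delta> l F e \<le> esc (n + l) e"
  using assms
proof (induction l arbitrary: e)
  case 0
  then show ?case
    by (metis add_0_right mult_1 power_0 shift_Nil trunc_sum_0)
next
  case (Suc l)
  define D where "D = (CARD('c) / \<delta>) ^ L"
  define \<kappa> where "\<kappa> = 1 / (1 + c * D)"
  have "CARD('c) / \<delta> \<ge> 1"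
    using Suc.prems by (simp add: field_simps) (smt (verit) of_nat_1 of_nat_mono zero_less_card_finite Suc_leI One_nat_def)
  have D: "D \<ge> 0" "0 < \<kappa>" "\<kappa> \<le> 1"
    using Suc.prems by (auto simp: D_def \<kappa>_def add_pos_nonneg)
  \<comment> \<open>What the induction hypothesis provides as a lower bound for the sum in the
    recursion.\<close>
  define \<sigma> where "\<sigma> = \<kappa> ^ l * c * trunc_sum \<delta> (Suc l) F e"
  have "trunc_sum \<delta> (Suc l) F e \<le> (CARD('c) / \<delta>) ^ Suc l"
    using Suc.prems by (intro trunc_sum_le) auto
  also have "\<dots> \<le> D"
    unfolding D_def using \<open>CARD('c) / \<delta> \<ge> 1\<close> Suc.prems by (intro power_increasing) auto
  finally have tD: "trunc_sum \<delta> (Suc l) F e \<le> D" .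
  have t0: "trunc_sum \<delta> (Suc l) F e \<ge> 0"
    using Suc.prems by (intro trunc_sum_nonneg) auto
  have \<sigma>0: "\<sigma> \<ge> 0"
    using t0 D Suc.prems by (simp add: \<sigma>_def)
  have "\<sigma> \<le> 1 * c * D"
    unfolding \<sigma>_def using D Suc.prems t0 tD by (intro mult_mono power_le_one) auto
  then have \<sigma>1: "\<sigma> * \<kappa> \<le> \<sigma> / (1 + \<sigma>)"
    using \<sigma>0 D by (simp add: \<kappa>_def divide_left_mono)
  have IH: "\<kappa> ^ l * c * trunc_sum \<delta> l F (shift [j] e) \<le> esc (n + l) (shift [j] e)" for j
    unfolding \<kappa>_def D_def using Suc.prems
    by (intro Suc.IH) (auto simp: pos_ratios_shift)
  have "\<sigma> = (\<Sum>j\<in>UNIV. trunc \<delta> (ratio e j) * (\<kappa> ^ l * c * trunc_sum \<delta> l F (shift [j] e)))"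
    by (simp add: \<sigma>_def trunc_sum_Suc sum_distrib_left mult_ac)
  also have "\<dots> \<le> (\<Sum>j\<in>UNIV. ratio e j * esc (n + l) (shift [j] e))"
    using Suc.prems D pos_ratios_pos[OF Suc.prems(1)]
    by (intro sum_mono mult_mono IH)
       (auto simp: indicator_def less_imp_le intro!: mult_nonneg_nonneg trunc_sum_nonneg)
  finally have "\<sigma> / (1 + \<sigma>) \<le> esc (n + Suc l) e"
    unfolding add_Suc_right esc.simps Let_def using \<sigma>0 by (intro frac_mono)
  moreover have "\<kappa> ^ Suc l * c * trunc_sum \<delta> (Suc l) F e = \<sigma> * \<kappa>"
    by (simp add: \<sigma>_def)
  ultimately show ?case
    using \<sigma>1 unfolding \<kappa>_def D_def by linarith
qed

text \<open>The constant \<open>c\<close> is so small that passing \<open>L\<close> generations costs at most a factor \<open>1/2\<close>, which the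
  lower bound \<open>2\<close> on the truncated sum compensates.\<close>

lemma esc_ge_of_good:
  fixes Gd :: "nat \<Rightarrow> ('c::finite) environment \<Rightarrow> bool"
  assumes \<delta>: "0 < \<delta>" "\<delta> \<le> 1" and L: "L \<ge> 1"
    and Gd: "\<And>n e. Gd (Suc n) e \<Longrightarrow> 2 \<le> trunc_sum \<delta> L (\<lambda>e. of_bool (Gd n e)) e"
  shows "\<exists>c>0. \<forall>n e. pos_ratios e \<longrightarrow> Gd n e \<longrightarrow> c \<le> esc (n * L) e"
proof -
  define D where "D = (CARD('c) / \<delta>) ^ L"
  have "CARD('c) / \<delta> \<ge> 1"
    using \<delta> by (simp add: field_simps) (smt (verit) of_nat_1 of_nat_mono zero_less_card_finite Suc_leI One_nat_def)
  then have D: "D \<ge> 1"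
    by (simp add: D_def)
  \<comment> \<open>Gives \<open>c * D = 1 / (2 * L)\<close>. The factor kept over \<open>L\<close>
    levels is then at least \<open>(1 - 1 / (2 * L)) ^ L\<close>, which is at least 1/2 by
    Bernoulli's inequality.\<close>
  define c where "c = 1 / (2 * L * D)"
  have c: "c > 0" "c \<le> 1" "c * D = 1 / (2 * real L)"
  proof -
    have "1 * 1 \<le> (2 * real L) * D"
      using D L by (intro mult_mono) auto
    then show "c > 0" "c \<le> 1" "c * D = 1 / (2 * real L)"
      using D L by (auto simp: c_def field_simps)
  qed
  have "1 / 2 = 1 - L * (1 / (2 * real L))"
    using L by simp
  also have "\<dots> \<le> (1 + - (1 / (2 * real L))) ^ L"
    using Bernoulli_inequality[of "- (1 / (2 * real L))" L] L by (simp add: field_simps)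
  also have "\<dots> \<le> (1 / (1 + c * D)) ^ L"
  proof (intro power_mono)
    define y where "y = 1 / (2 * real L)"
    have "0 \<le> y" "y \<le> 1"
      using L by (auto simp: y_def field_simps)
    then show "1 + - (1 / (2 * real L)) \<le> 1 / (1 + c * D)" "0 \<le> 1 + - (1 / (2 * real L))"
      unfolding c(3) y_def[symmetric] by (simp_all add: field_simps)
  qed
  finally have half: "1 / 2 \<le> (1 / (1 + c * D)) ^ L" .
  have "c \<le> esc (n * L) e" if "pos_ratios e" "Gd n e" for n e
    using that
  proof (induction n arbitrary: e)
    case 0
    then show ?case using c by simp
  next
    case (Suc n)
    have "c \<le> 1 / 2 * c * 2"
      by simp
    also have "\<dots> \<le> (1 / (1 + c * D)) ^ L * c * trunc_sum \<delta> L (\<lambda>e. of_bool (Gd n e)) e"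
      using half c Gd[OF Suc.prems(2)] by (intro mult_mono) auto
    also have "\<dots> \<le> esc (n * L + L) e"
      unfolding D_def using \<delta> c Suc.prems
      by (intro esc_lower) (auto simp: Suc.IH pos_ratios_shift esc_bounds)
    finally show ?case
      by (simp add: add.commute)
  qed
  then show ?thesis
    using c by blast
qed

text \<open>Dropping the window factors only increases the weights, so each block of
  \<open>L\<close> generations multiplies the bound by the truncated sum, which is at least
  2.\<close>

lemma weight_sum_ge_of_good:
  fixes Gd :: "nat \<Rightarrow> ('c::finite) environment \<Rightarrow> bool"
  assumes \<delta>: "0 < \<delta>"
    and Gd: "\<And>n e. Gd (Suc n) e \<Longrightarrow> 2 \<le> trunc_sum \<delta> L (\<lambda>e. of_bool (Gd n e)) e"
    and "pos_ratios e" "Gd n e"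
  shows "2 ^ n \<le> (\<Sum>w\<in>words (n * L). weight (\<lambda>z. z) w e)"
  using assms(3,4)
proof (induction n arbitrary: e)
  case (Suc n)
  have "2 ^ Suc n \<le> trunc_sum \<delta> L (\<lambda>e. of_bool (Gd n e)) e * 2 ^ n"
    using Gd[OF Suc.prems(2)] by simp
  also have "\<dots> = (\<Sum>u\<in>words L. weight (\<lambda>z. z) u e * weight (window \<delta>) u e * (of_bool (Gd n (shift u e)) * 2 ^ n))"
    unfolding trunc_sum_def weight_mult sum_distrib_right by (simp only: mult.assoc)
  also have "\<dots> \<le> (\<Sum>u\<in>words L. weight (\<lambda>z. z) u e * 1 * (\<Sum>w\<in>words (n * L). weight (\<lambda>z. z) w (shift u e)))"
  proof (intro sum_mono mult_mono)
    fix u :: "'c list"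
    show "weight (window \<delta>) u e \<le> 1"
      using weight_window[of \<delta> u e] by auto
    show "of_bool (Gd n (shift u e)) * 2 ^ n \<le> (\<Sum>w\<in>words (n * L). weight (\<lambda>z. z) w (shift u e))"
      using Suc by (auto simp: pos_ratios_shift weight_pos less_imp_le intro!: sum_nonneg)
  qed (use Suc.prems weight_pos[OF Suc.prems(1)] in \<open>auto simp: less_imp_le weight_nonneg\<close>)
  also have "\<dots> = (\<Sum>w\<in>words (Suc n * L). weight (\<lambda>z. z) w e)"
    by (simp add: sum_words_add weight_append sum_distrib_left)
  finally show ?case .
qed auto

section \<open>The walk in a fixed environment\<close>

text \<open>The almost sure properties of an environment, collected so that the walk can be studied
  in one fixed environment.\<close>

definition env_ok :: "('c::finite) environment \<Rightarrow> bool" where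
  "env_ok e \<longleftrightarrow> (\<forall>v. (\<Sum>s\<in>UNIV. e v $ s) = 1) \<and> (\<forall>v s. v \<noteq> [] \<longrightarrow> e v $ s > 0) \<and>
     e [] $ None = 0 \<and> (\<forall>j. e [] $ Some j > 0)"

lemma env_ok_nonneg: "env_ok e \<Longrightarrow> e v $ s \<ge> 0"
  unfolding env_ok_def by (cases "v = []"; cases s) (auto simp: less_imp_le)

lemma sum_option: "(\<Sum>s\<in>UNIV. f s) = f None + (\<Sum>j\<in>(UNIV :: 'c::finite set). f (Some j))"
  by (simp add: UNIV_option_conv sum.reindex)

lemma nn_integral_walk_step:
  assumes "env_ok e"
  shows "(\<integral>\<^sup>+v. h v \<partial>walk_step e u) = (\<Sum>s\<in>UNIV. ennreal (e u $ s) * h (tree_move u s))"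
proof -
  have "pmf (embed_pmf (\<lambda>s. e u $ s)) s = e u $ s" for s
    using assms by (intro pmf_env) (auto simp: env_ok_nonneg env_ok_def)
  then show ?thesis
    unfolding walk_step_def nn_integral_map_pmf
    by (subst nn_integral_measure_pmf) (simp add: nn_integral_count_space_finite)
qed

lemma pos_ratios_shift_env: "env_ok e \<Longrightarrow> v \<noteq> [] \<Longrightarrow> pos_ratios (shift v e)"
  by (auto simp: pos_ratios_def env_ok_def ratio_def shift_def)

lemma path_weight_snoc: "path_weight e (v @ [i]) = path_weight e v * edge_var e (v @ [i])"
  by (simp add: path_weight_def prod.nat_ivl_Suc')

lemma path_weight_Nil [simp]: "path_weight e [] = 1"
  by (simp add: path_weight_def)

text \<open>The edge at the root carries a plain probability; from the second edge on the variables
  are ratios at inner vertices, hence a \<open>weight\<close> in a shifted environment.\<close>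

lemma path_weight_Cons: "path_weight e (j # w) = e [] $ Some j * weight (\<lambda>z. z) w (shift [j] e)"
proof (induction w rule: rev_induct)
  case Nil
  show ?case
    using path_weight_snoc[of e "[]" j] by (simp add: edge_var_def)
next
  case (snoc i w)
  have "path_weight e ((j # w) @ [i]) = path_weight e (j # w) * ratio (shift (j # w) e) i"
    by (subst path_weight_snoc) (simp add: edge_var_def ratio_def shift_def butlast_append)
  then show ?case
    using snoc by (simp add: weight_append)
qed

lemma path_weight_append:
  "v \<noteq> [] \<Longrightarrow> path_weight e (v @ w) = path_weight e v * weight (\<lambda>z. z) w (shift v e)"
  by (cases v) (auto simp: path_weight_Cons weight_append)

lemma path_weight_pos: "env_ok e \<Longrightarrow> path_weight e v > 0"
  by (cases v) (auto simp: path_weight_Cons env_ok_def intro!: mult_pos_pos weight_pos pos_ratios_shift_env)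

lemma chaos_Y_words: "chaos_Y e n = (\<Sum>v\<in>words n. path_weight e v)"
  by (simp add: chaos_Y_def words_def)

lemma chaos_Y_nonneg: "env_ok e \<Longrightarrow> chaos_Y e n \<ge> 0"
  by (auto simp: chaos_Y_words path_weight_pos less_imp_le intro!: sum_nonneg)

lemma snoc_neq_butlast: "butlast u \<noteq> u @ [j]"
  by (metis Suc_n_not_le_n diff_le_self length_append_singleton length_butlast)

text \<open>If \<open>b\<close> is the probability of escaping from the subtree of a vertex, the probability \<open>h\<close> of
  hitting \<open>u\<close> from a descendant is the product of \<open>1 - b\<close> along the path to it.\<close>

lemma transient_walk:
  fixes e :: "('c::finite) environment"
  assumes e: "env_ok e"
    and good: "\<And>u. \<exists>w. w \<noteq> [] \<and> (\<exists>c>0. \<forall>n. esc n (shift (u @ w) e) \<ge> c)"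
  shows "transient_chain (walk_step e)"
proof (rule transient_chainI)
  have "countable (lists (UNIV :: 'c set))"
    by (intro countable_lists countable_finite) auto
  then show "countable (UNIV :: 'c list set)"
    by simp
next
  fix u
  define b where "b v = lim (\<lambda>n. esc n (shift v e))" for v
  have lim_b: "(\<lambda>n. esc n (shift v e)) \<longlonglongrightarrow> b v" if "v \<noteq> []" for v
  proof -
    have "pos_ratios (shift v e)"
      using that e by (rule pos_ratios_shift_env[rotated])
    then have "convergent (\<lambda>n. esc n (shift v e))"
      using decseq_convergent[OF decseq_esc] esc_bounds by (metis convergent_def)
    then show ?thesis
      by (simp add: b_def convergent_LIMSEQ_iff)
  qed
  have b: "0 \<le> b v" "b v \<le> 1" if "v \<noteq> []" for v
    using LIMSEQ_le_const[OF lim_b[OF that]] LIMSEQ_le_const2[OF lim_b[OF that]]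
      esc_bounds[OF pos_ratios_shift_env[OF e that]] by auto
  define S where "S v = (\<Sum>j\<in>UNIV. ratio (shift v e) j * b (v @ [j]))" for v
  have S: "S v \<ge> 0" if "v \<noteq> []" for v
    unfolding S_def using pos_ratios_pos[OF pos_ratios_shift_env[OF e that]] b
    by (intro sum_nonneg mult_nonneg_nonneg) (auto simp: less_imp_le)
  have b_eq: "b v = S v / (1 + S v)" if v: "v \<noteq> []" for v
  proof -
    have "(\<lambda>n. \<Sum>j\<in>UNIV. ratio (shift v e) j * esc n (shift (v @ [j]) e)) \<longlonglongrightarrow> S v"
      unfolding S_def by (intro tendsto_intros lim_b) auto
    then have "(\<lambda>n. esc (Suc n) (shift v e)) \<longlonglongrightarrow> S v / (1 + S v)"
      using S[OF v] by (auto simp: Let_def intro!: tendsto_intros)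
    moreover have "(\<lambda>n. esc (Suc n) (shift v e)) \<longlonglongrightarrow> b v"
      using lim_b[OF v] by (rule LIMSEQ_Suc)
    ultimately show ?thesis
      by (rule LIMSEQ_unique[symmetric])
  qed
  \<comment> \<open>Positivity passes from a child to its parent. This carries it from
    \<open>u @ w\<close> up to some child \<open>j0\<close> of \<open>u\<close>.\<close>
  have S_pos: "b v > 0" if "v \<noteq> []" "b (v @ [j]) > 0" for v j
  proof -
    have "S v > 0"
      unfolding S_def using that pos_ratios_pos[OF pos_ratios_shift_env[OF e that(1)]] b
      by (intro sum_pos2[of _ j]) (auto simp: less_imp_le)
    then show ?thesis
      by (simp add: b_eq that)
  qed
  obtain w c where w: "w \<noteq> []" "c > 0" "\<And>n. esc n (shift (u @ w) e) \<ge> c"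
    using good by blast
  have "b (u @ w) > 0"
    using LIMSEQ_le_const[OF lim_b[of "u @ w"], of c] w by fastforce
  then have "\<exists>j. b (u @ [j]) > 0"
    using w(1)
  proof (induction w rule: rev_induct)
    case (snoc i w)
    then show ?case
      using S_pos[of "u @ w" i] by (cases "w = []") auto
  qed auto
  then obtain j0 where j0: "b (u @ [j0]) > 0" ..
  \<comment> \<open>Vertices that are not below \<open>u\<close> get the trivial bound 1: one child
    of \<open>u\<close> with \<open>h < 1\<close> is enough to lower the mean. At \<open>u\<close>
    itself the product is empty.\<close>
  define h where "h v = (if take (length u) v = u then \<Prod>i\<in>{length u<..length v}. 1 - b (take i v) else 1)" for v
  have h01: "0 \<le> h v" "h v \<le> 1" for v
  proof -
    have "0 \<le> 1 - b (take i v) \<and> 1 - b (take i v) \<le> 1" if "i \<in> {length u<..length v}" for i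
    proof -
      have "take i v \<noteq> []"
        using that by (auto simp: take_eq_Nil)
      then show ?thesis
        using b[of "take i v"] by auto
    qed
    then show "0 \<le> h v" "h v \<le> 1"
      unfolding h_def by (auto intro!: prod_nonneg prod_le_1)
  qed
  have h_snoc: "h (v @ [j]) = h v * (1 - b (v @ [j]))" if "take (length u) v = u" for v j
  proof -
    have "length u \<le> length v"
      using arg_cong[OF that, of length] by simp
    then have "{length u<..length (v @ [j])} = insert (Suc (length v)) {length u<..length v}"
      by auto
    then show ?thesis
      using that \<open>length u \<le> length v\<close> by (simp add: h_def mult.commute)
  qed
  have super: "(\<Sum>s\<in>UNIV. e v $ s * h (tree_move v s)) \<le> h v" if "v \<noteq> u" for v
  proof (cases "take (length u) v = u")
    case False
    have "(\<Sum>s\<in>UNIV. e v $ s * h (tree_move v s)) \<le> (\<Sum>s\<in>UNIV. e v $ s * 1)"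
      using e h01 by (intro sum_mono mult_left_mono env_ok_nonneg)
    also have "\<dots> = 1"
      using e by (simp add: env_ok_def)
    finally show ?thesis
      using False by (simp add: h_def)
  next
    case True
    have "length u \<le> length v"
      using arg_cong[OF True, of length] by simp
    moreover have "length u \<noteq> length v"
      using True that by auto
    ultimately have "length u < length v"
      by simp
    then have v: "v \<noteq> []"
      by auto
    define v' k where "v' = butlast v" and "k = last v"
    have vk: "v = v' @ [k]"
      using v by (simp add: v'_def k_def)
    have "take (length u) v' = u"
      using True \<open>length u < length v\<close> vk by simp
    then have hv: "h v = h v' * (1 - b v)"
      using h_snoc vk by simp
    have p0: "e v $ None > 0"
      using e v by (simp add: env_ok_def)
    have rj: "e v $ Some j = e v $ None * ratio (shift v e) j" for j
      using p0 by (simp add: ratio_def shift_def)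
    have sum1: "e v $ None * (1 + (\<Sum>j\<in>UNIV. ratio (shift v e) j)) = 1"
    proof -
      have "e v $ None + (\<Sum>j\<in>UNIV. e v $ Some j) = 1"
        using e unfolding env_ok_def sum_option by blast
      then show ?thesis
        by (simp add: distrib_left sum_distrib_left rj[symmetric])
    qed
    have "(\<Sum>s\<in>UNIV. e v $ s * h (tree_move v s)) =
        e v $ None * h v' + (\<Sum>j\<in>UNIV. e v $ Some j * (h v * (1 - b (v @ [j]))))"
      using h_snoc[OF True] by (simp add: sum_option tree_move_def v'_def)
    also have "(\<Sum>j\<in>UNIV. e v $ Some j * (h v * (1 - b (v @ [j])))) =
        e v $ None * h v * ((\<Sum>j\<in>UNIV. ratio (shift v e) j) - S v)"
      unfolding S_def sum_subtractf[symmetric] sum_distrib_left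
      by (intro sum.cong refl) (simp add: rj algebra_simps)
    also have "e v $ None * h v' + \<dots> =
        e v $ None * h v' * (1 + (1 - b v) * ((\<Sum>j\<in>UNIV. ratio (shift v e) j) - S v))"
      by (simp add: hv algebra_simps)
    \<comment> \<open>The equation \<open>b = S / (1 + S)\<close> means
      \<open>(1 - b) * (1 + S) = 1\<close>; this makes \<open>h\<close> harmonic at the proper
      descendants of \<open>u\<close>.\<close>
    also have "1 + (1 - b v) * ((\<Sum>j\<in>UNIV. ratio (shift v e) j) - S v) =
        (1 - b v) * (1 + (\<Sum>j\<in>UNIV. ratio (shift v e) j))"
    proof -
      have "(1 - b v) * (1 + S v) = 1"
        using S[OF v] by (simp add: b_eq v field_simps)
      then show ?thesis
        by (simp add: algebra_simps)
    qed
    also have "e v $ None * h v' * \<dots> = h v * (e v $ None * (1 + (\<Sum>j\<in>UNIV. ratio (shift v e) j)))"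
      by (simp add: hv)
    finally show ?thesis
      by (simp add: sum1)
  qed
  have hu: "h u = 1"
    by (simp add: h_def)
  have strict: "(\<Sum>s\<in>UNIV. e u $ s * h (tree_move u s)) < 1"
  proof -
    have "h (u @ [j0]) < 1"
      using h_snoc[of u j0] j0 hu by simp
    moreover have "e u $ Some j0 > 0"
      using e by (cases "u = []") (auto simp: env_ok_def)
    ultimately have "(\<Sum>s\<in>UNIV. e u $ s * h (tree_move u s)) < (\<Sum>s\<in>UNIV. e u $ s * 1)"
      using e h01
      by (intro sum_strict_mono_ex1 mult_left_mono env_ok_nonneg ballI bexI[of _ "Some j0"])
         (auto simp: tree_move_def)
    then show ?thesis
      using e by (simp add: env_ok_def)
  qed
  have int: "(\<integral>\<^sup>+v. ennreal (h v) \<partial>walk_step e x) = ennreal (\<Sum>s\<in>UNIV. e x $ s * h (tree_move x s))" for x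
    using e h01
    by (simp add: nn_integral_walk_step env_ok_nonneg ennreal_mult'[symmetric] sum_ennreal)
  show "\<exists>h :: 'c list \<Rightarrow> ennreal. h u \<ge> 1 \<and> (\<forall>x. x \<noteq> u \<longrightarrow> (\<integral>\<^sup>+y. h y \<partial>walk_step e x) \<le> h x) \<and>
            (\<integral>\<^sup>+y. h y \<partial>walk_step e u) < 1"
    by (intro exI[of _ "\<lambda>v. ennreal (h v)"] conjI allI impI)
       (use super strict in \<open>auto simp: int hu h01 ennreal_leI ennreal_less_one_iff\<close>)
qed

section \<open>The stationary distribution\<close>

lemma pmf_walk_step:
  assumes "env_ok e"
  shows "pmf (walk_step e u) v = (\<Sum>s\<in>UNIV. e u $ s * of_bool (tree_move u s = v))"
proof -
  have "ennreal (pmf (walk_step e u) v) = (\<integral>\<^sup>+x. indicator {v} x \<partial>walk_step e u)"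
    by (simp add: emeasure_pmf_single)
  also have "\<dots> = (\<Sum>s\<in>UNIV. ennreal (e u $ s * of_bool (tree_move u s = v)))"
    by (subst nn_integral_walk_step[OF assms], intro sum.cong) (auto simp: indicator_def)
  also have "\<dots> = ennreal (\<Sum>s\<in>UNIV. e u $ s * of_bool (tree_move u s = v))"
    using assms by (intro sum_ennreal) (auto simp: env_ok_nonneg)
  finally show ?thesis
    using assms by (simp add: env_ok_nonneg sum_nonneg)
qed

text \<open>The walk is reversible with conductance \<open>path_weight e v\<close> on the edge above \<open>v\<close>; its invariant
  measure \<open>f\<close> is the sum of the conductances at a vertex.\<close>

lemma ergodic_walk:
  fixes e :: "('c::finite) environment"
  assumes e: "env_ok e" and Z: "summable (chaos_Y e)"
  shows "ergodic_chain (walk_step e)"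
proof -
  \<comment> \<open>Away from the root, the conductance of the upward edge divided by the
    probability of crossing it is the total conductance. At the root the conductances are
    probabilities with sum 1.\<close>
  define f where "f u = (if u = [] then 1 else path_weight e u / e u $ None)" for u
  have e0: "e v $ None > 0" if "v \<noteq> []" for v
    using e that by (simp add: env_ok_def)
  have f_nonneg: "f u \<ge> 0" for u
    using e e0 path_weight_pos[OF e] by (auto simp: f_def less_imp_le)
  have f_down: "f u * e u $ Some j = path_weight e (u @ [j])" for u j
    using e0[of u] by (auto simp: f_def path_weight_append path_weight_Cons ratio_def shift_def)
  have f_up: "f u * e u $ None = path_weight e u" if "u \<noteq> []" for u
    using e0[of u] that by (auto simp: f_def)
  have f_None: "f u * e u $ None \<le> path_weight e u" for u
    using f_up e by (cases "u = []") (auto simp: env_ok_def)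
  have f_sum: "f u = f u * e u $ None + (\<Sum>j\<in>UNIV. path_weight e (u @ [j]))" for u
  proof -
    have "f u = f u * (\<Sum>s\<in>UNIV. e u $ s)"
      using e by (simp add: env_ok_def)
    then show ?thesis
      by (simp add: sum_option distrib_left sum_distrib_left f_down)
  qed
  \<comment> \<open>The edges above generation \<open>n\<close> have total conductance at most
    \<open>chaos_Y e n\<close>, those below it \<open>chaos_Y e (Suc n)\<close>.\<close>
  have Y: "(\<Sum>u\<in>words n. f u) \<le> chaos_Y e n + chaos_Y e (Suc n)" for n
  proof -
    have "(\<Sum>u\<in>words n. f u) \<le> (\<Sum>u\<in>words n. path_weight e u + (\<Sum>j\<in>UNIV. path_weight e (u @ [j])))"
      by (intro sum_mono) (subst f_sum, use f_None in auto)
    also have "\<dots> = chaos_Y e n + chaos_Y e (n + Suc 0)"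
      by (subst (2) chaos_Y_words, subst sum_words_add) (simp add: chaos_Y_words sum.distrib sum_words_Suc)
    finally show ?thesis by simp
  qed
  define B where "B = (\<Sum>n. chaos_Y e n) + (\<Sum>n. chaos_Y e (Suc n))"
  have sum_le: "sum f F \<le> B" if "finite F" for F
  proof -
    define N where "N = Suc (Max (insert 0 (length ` F)))"
    have "F \<subseteq> (\<Union>n<N. words n)"
      using that by (auto simp: words_def N_def less_Suc_eq_le)
    then have "sum f F \<le> sum f (\<Union>n<N. words n)"
      by (intro sum_mono2) (auto simp: f_nonneg)
    also have "\<dots> = (\<Sum>n<N. \<Sum>u\<in>words n. f u)"
      by (rule sum.UNION_disjoint) (simp_all, auto simp: words_def)
    also have "\<dots> \<le> (\<Sum>n<N. chaos_Y e n + chaos_Y e (Suc n))"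
      by (intro sum_mono Y)
    also have "\<dots> \<le> B"
      unfolding sum.distrib B_def using Z e
      by (intro add_mono sum_le_suminf) (auto simp: summable_Suc_iff chaos_Y_nonneg)
    finally show ?thesis .
  qed
  have "f summable_on UNIV"
    using sum_le f_nonneg by (intro nonneg_bounded_partial_sums_imp_summable_on[of _ _ B]) (auto intro!: eventually_finite_subsets_at_top_finite)
  then have "integrable (count_space UNIV) f"
    using summable_on_iff_abs_summable_on_real[of f UNIV]
    by (simp only: abs_summable_equivalent abs_summable_on_def)
  define T where "T = (\<integral>u. f u \<partial>count_space UNIV)"
  have T: "(\<integral>\<^sup>+u. ennreal (f u) \<partial>count_space UNIV) = ennreal T"
    using \<open>integrable (count_space UNIV) f\<close> f_nonneg by (simp add: T_def nn_integral_eq_integral)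
  have "ennreal 1 \<le> (\<integral>\<^sup>+u. ennreal (f u) \<partial>count_space UNIV)"
    using nn_integral_ge_point[of "[]" UNIV "\<lambda>u. ennreal (f u)"] by (simp add: f_def)
  then have T1: "T \<ge> 1"
    unfolding T by (metis ennreal_1 ennreal_le_iff2 not_one_le_zero ennreal_le_iff zero_le_one)
  define \<pi> where "\<pi> = embed_pmf (\<lambda>u. f u / T)"
  have "(\<integral>\<^sup>+u. ennreal (f u / T) \<partial>count_space UNIV) = (\<integral>\<^sup>+u. ennreal (f u) / ennreal T \<partial>count_space UNIV)"
    using f_nonneg T1 by (simp add: divide_ennreal)
  also have "\<dots> = 1"
    using T1 by (simp add: nn_integral_divide T divide_ennreal)
  finally have \<pi>: "pmf \<pi> u = f u / T" for u
    unfolding \<pi>_def using f_nonneg T1 by (intro pmf_embed_pmf) auto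
  have "pmf (bind_pmf \<pi> (walk_step e)) v = pmf \<pi> v" for v
  proof -
    \<comment> \<open>The neighbours of \<open>v\<close>, the only states that lead to
      \<open>v\<close> in one step. Since \<open>butlast [] = []\<close>, the root could seem to
      lead to itself; its component \<open>None\<close> is 0.\<close>
    define A where "A = (if v = [] then {} else {butlast v}) \<union> (\<lambda>j. v @ [j]) ` UNIV"
    have zero: "ennreal (pmf \<pi> u) * ennreal (pmf (walk_step e u) v) = 0" if "u \<notin> A" for u
    proof -
      have "e u $ s * of_bool (tree_move u s = v) = 0" for s
        using that e
      proof (cases s)
        case None
        show ?thesis
        proof (cases "u = []")
          case True
          then show ?thesis
            using None e by (simp add: env_ok_def)
        next
          case False
          then have "butlast u \<noteq> v"
            using that append_butlast_last_id[OF False] by (metis A_def UnCI rangeI)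
          then show ?thesis
            using None by (simp add: tree_move_def)
        qed
      next
        case (Some j)
        have "u @ [j] \<noteq> v"
          using that by (auto simp: A_def split: if_splits)
        then show ?thesis
          using Some by (simp add: tree_move_def)
      qed
      then have "pmf (walk_step e u) v = 0"
        unfolding pmf_walk_step[OF e] by (intro sum.neutral) blast
      then show ?thesis
        by simp
    qed
    have down: "pmf (walk_step e (butlast v)) v = e (butlast v) $ Some (last v)" if "v \<noteq> []"
      using walk_step_child[of e "butlast v" "last v"] e that by (simp add: env_ok_nonneg env_ok_def)
    have up: "pmf (walk_step e (v @ [j])) v = e (v @ [j]) $ None" for j
      using walk_step_parent[of e "v @ [j]"] e by (simp add: env_ok_nonneg env_ok_def)
    have "ennreal (pmf (bind_pmf \<pi> (walk_step e)) v) =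
        (\<integral>\<^sup>+u. ennreal (pmf \<pi> u) * ennreal (pmf (walk_step e u) v) \<partial>count_space UNIV)"
      by (simp add: ennreal_pmf_bind nn_integral_measure_pmf)
    also have "\<dots> = (\<Sum>u\<in>A. ennreal (pmf \<pi> u) * ennreal (pmf (walk_step e u) v))"
      using zero by (intro nn_integral_count_space') (auto simp: A_def simp del: mult_eq_0_iff)
    also have "\<dots> = ennreal (\<Sum>u\<in>A. pmf \<pi> u * pmf (walk_step e u) v)"
      by (simp add: ennreal_mult'[symmetric] sum_ennreal)
    also have "(\<Sum>u\<in>A. pmf \<pi> u * pmf (walk_step e u) v) =
        (if v = [] then 0 else pmf \<pi> (butlast v) * e (butlast v) $ Some (last v)) +
        (\<Sum>j\<in>UNIV. pmf \<pi> (v @ [j]) * e (v @ [j]) $ None)"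
      unfolding A_def using snoc_neq_butlast[of v]
      by (subst sum.union_disjoint) (auto simp: down up sum.reindex inj_on_def)
    \<comment> \<open>By reversibility the flow into \<open>v\<close> is the sum of the conductances
      of its edges, up to normalisation.\<close>
    also have "\<dots> = ((if v = [] then 0 else path_weight e v) + (\<Sum>j\<in>UNIV. path_weight e (v @ [j]))) / T"
      using f_down[of "butlast v" "last v"] by (auto simp: \<pi> f_up add_divide_distrib sum_divide_distrib)
    also have "(if v = [] then 0 else path_weight e v) = f v * e v $ None"
      using f_up e by (auto simp: env_ok_def)
    finally show ?thesis
      by (simp add: f_sum[symmetric] \<pi>[symmetric])
  qed
  then have "bind_pmf \<pi> (walk_step e) = \<pi>"
    by (rule pmf_eqI)
  then show ?thesis
    unfolding ergodic_chain_def ..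
qed

section \<open>Independence in a random environment\<close>

abbreviation env_space :: "(('c::finite) environment) measure" where
  "env_space \<equiv> PiM UNIV (\<lambda>_. borel)"

text \<open>The equation \<open>f (cut n e) = f e\<close> is the form in which dependence on the
  first \<open>n\<close> generations alone is stated.\<close>

definition cut :: "nat \<Rightarrow> ('c::finite) environment \<Rightarrow> 'c environment" where
  "cut n e = (\<lambda>u. if length u < n then e u else 0)"

section \<open>Locality and measurability of weights\<close>

lemma weight_cong:
  "(\<And>u. length u < length w \<Longrightarrow> e u = e' u) \<Longrightarrow> weight \<phi> w e = weight \<phi> w e'"
proof (induction w arbitrary: e e')
  case (Cons j w)
  have "weight \<phi> w (shift [j] e) = weight \<phi> w (shift [j] e')"
    by (rule Cons.IH) (auto simp: shift_def Cons.prems)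
  then show ?case
    using Cons.prems[of "[]"] by (simp add: ratio_def)
qed auto

lemma weight_cut: "length w \<le> n \<Longrightarrow> weight \<phi> w (cut n e) = weight \<phi> w e"
  by (rule weight_cong) (auto simp: cut_def)

lemma measurable_env_component [measurable]: "(\<lambda>e. e v) \<in> env_space \<rightarrow>\<^sub>M borel"
  by (rule measurable_component_singleton) simp

lemma borel_measurable_vec_nth [measurable]: "(\<lambda>x :: real ^ 'n. x $ i) \<in> borel_measurable borel"
  by (intro borel_measurable_continuous_onI continuous_intros)

lemma measurable_shift [measurable]: "shift v \<in> env_space \<rightarrow>\<^sub>M env_space"
  unfolding shift_def by (intro measurable_abs_UNIV) simp

lemma measurable_cut [measurable]: "cut n \<in> env_space \<rightarrow>\<^sub>M env_space"
  unfolding cut_def by (intro measurable_abs_UNIV) simp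

lemma measurable_ratio [measurable]: "(\<lambda>e. ratio e j) \<in> borel_measurable env_space"
  unfolding ratio_def by measurable

lemma measurable_weight [measurable]:
  assumes [measurable]: "\<phi> \<in> borel_measurable borel"
  shows "weight \<phi> w \<in> borel_measurable env_space"
proof (induction w)
  case (Cons j w)
  note [measurable] = Cons
  show ?case by simp
qed simp

text \<open>Summed over the words of length \<open>n\<close> that lead from colour \<open>c\<close>
  to \<open>j\<close>, this is the entry \<open>(c, j)\<close> of the \<open>n\<close>-th power of
  \<open>A\<close>.\<close>

primrec chain_prod :: "('c \<Rightarrow> 'c \<Rightarrow> real) \<Rightarrow> 'c \<Rightarrow> 'c list \<Rightarrow> real" where
  "chain_prod A c [] = 1"
| "chain_prod A c (j # w) = A c j * chain_prod A j w"

lemma colour_Cons [simp]: "colour c (j # w) = colour j w"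
  by (simp add: colour_def)

lemma colour_Nil [simp]: "colour c [] = c"
  by (simp add: colour_def)

lemma colour_snoc [simp]: "colour c (w @ [j]) = j"
  by (simp add: colour_def)

lemma chain_prod_append: "chain_prod A c (u @ w) = chain_prod A c u * chain_prod A (colour c u) w"
  by (induction u arbitrary: c) auto

lemma chain_prod_nonneg: "(\<And>i j. A i j \<ge> 0) \<Longrightarrow> chain_prod A c w \<ge> 0"
  by (induction w arbitrary: c) auto

locale random_env = prob_space M for M :: "'w measure" +
  fixes p :: "'c::finite list \<Rightarrow> 'w \<Rightarrow> real ^ ('c option)"
  assumes indep: "indep_vars (\<lambda>_. borel) p UNIV"
    and law: "\<And>v w. v \<noteq> [] \<Longrightarrow> w \<noteq> [] \<Longrightarrow> last v = last w \<Longrightarrow> distr M borel (p v) = distr M borel (p w)"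
    and env_ok: "AE \<omega> in M. env_ok (\<lambda>v. p v \<omega>)"
begin

definition env :: "'w \<Rightarrow> 'c environment" where
  "env \<omega> = (\<lambda>v. p v \<omega>)"

lemma rv_p [measurable]: "p v \<in> borel_measurable M"
  using indep by (auto simp: indep_vars_def)

lemma measurable_env [measurable]: "env \<in> M \<rightarrow>\<^sub>M env_space"
  unfolding env_def by (intro measurable_abs_UNIV) simp

lemma indep_family:
  assumes K: "disjoint_family_on K L"
    and Y: "\<And>i. i \<in> L \<Longrightarrow> Y i \<in> PiM (K i) (\<lambda>_. borel) \<rightarrow>\<^sub>M N i"
  shows "indep_vars N (\<lambda>i \<omega>. Y i (restrict (env \<omega>) (K i))) L"
  unfolding env_def using indep_vars_compose2[OF indep_vars_restrict[OF indep _ K] Y] by simp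

text \<open>Both sides are product measures over the vertices of the subtree, and the factor at
  \<open>u\<close> is the law for the colour \<open>last (v @ u)\<close>, which depends on
  \<open>v\<close> only through \<open>last v\<close>.\<close>

lemma law_shift:
  assumes "v \<noteq> []" "w \<noteq> []" "last v = last w"
  shows "distr M env_space (\<lambda>\<omega>. shift v (env \<omega>)) = distr M env_space (\<lambda>\<omega>. shift w (env \<omega>))"
proof -
  have *: "distr M env_space (\<lambda>\<omega>. shift v (env \<omega>)) = PiM UNIV (\<lambda>u. distr M borel (p (v @ u)))" for v
  proof -
    have "indep_vars (\<lambda>_. borel) (\<lambda>u \<omega>. (\<lambda>r. r (v @ u)) (restrict (env \<omega>) {v @ u})) UNIV"
      by (rule indep_family) (auto simp: disjoint_family_on_def)
    then have "indep_vars (\<lambda>_. borel) (\<lambda>u. p (v @ u)) UNIV"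
      by (simp add: env_def)
    then show ?thesis
      by (subst (asm) indep_vars_iff_distr_eq_PiM) (auto simp: env_def shift_def restrict_UNIV)
  qed
  have "distr M borel (p (v @ u)) = distr M borel (p (w @ u))" for u
    using assms by (intro law) (auto simp: last_append)
  then show ?thesis
    by (simp add: *)
qed

lemma expectation_shift:
  fixes f :: "'c environment \<Rightarrow> real"
  assumes [measurable]: "f \<in> borel_measurable env_space" and "v \<noteq> []" "w \<noteq> []" "last v = last w"
  shows "expectation (\<lambda>\<omega>. f (shift v (env \<omega>))) = expectation (\<lambda>\<omega>. f (shift w (env \<omega>)))"
    and "integrable M (\<lambda>\<omega>. f (shift v (env \<omega>))) \<longleftrightarrow> integrable M (\<lambda>\<omega>. f (shift w (env \<omega>)))"
proof -
  have "expectation (\<lambda>\<omega>. f (shift v (env \<omega>))) = (\<integral>e. f e \<partial>distr M env_space (\<lambda>\<omega>. shift v (env \<omega>)))" for v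
    by (subst integral_distr) auto
  then show "expectation (\<lambda>\<omega>. f (shift v (env \<omega>))) = expectation (\<lambda>\<omega>. f (shift w (env \<omega>)))"
    using law_shift[OF assms(2-4)] by simp
  have "integrable M (\<lambda>\<omega>. f (shift v (env \<omega>))) \<longleftrightarrow>
      integrable (distr M env_space (\<lambda>\<omega>. shift v (env \<omega>))) f" for v
    by (subst integrable_distr_eq) auto
  then show "integrable M (\<lambda>\<omega>. f (shift v (env \<omega>))) \<longleftrightarrow> integrable M (\<lambda>\<omega>. f (shift w (env \<omega>)))"
    using law_shift[OF assms(2-4)] by simp
qed

text \<open>The index \<open>None\<close> stands for the first \<open>n\<close> generations below \<open>v\<close>.\<close>

lemma indep_blocks:
  "indep_vars (\<lambda>_. env_space)
     (\<lambda>i \<omega>. case i of None \<Rightarrow> cut n (shift v (env \<omega>)) | Some w \<Rightarrow> shift (v @ w) (env \<omega>))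
     (insert None (Some ` words n))"
proof -
  define K where "K i = (case i of None \<Rightarrow> {v @ u | u. length u < n} | Some w \<Rightarrow> {v @ w @ u | u. True})" for i
  define Y where "Y i r = (case i of None \<Rightarrow> (\<lambda>u. if length u < n then r (v @ u) else 0)
      | Some w \<Rightarrow> (\<lambda>u. r (v @ w @ u)))" for i and r :: "'c list \<Rightarrow> real ^ 'c option"
  have "indep_vars (\<lambda>_. env_space) (\<lambda>i \<omega>. Y i (restrict (env \<omega>) (K i))) (insert None (Some ` words n))"
  proof (rule indep_family)
    show "disjoint_family_on K (insert None (Some ` words n))"
      by (auto simp: disjoint_family_on_def K_def words_def)
    show "Y i \<in> PiM (K i) (\<lambda>_. borel) \<rightarrow>\<^sub>M env_space" for i
    proof (cases i)
      case None
      have "(\<lambda>r. if length u < n then r (v @ u) else 0) \<in> PiM (K i) (\<lambda>_. borel) \<rightarrow>\<^sub>M borel" for u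
        by (cases "length u < n") (auto simp: K_def None intro!: measurable_component_singleton)
      then show ?thesis
        unfolding Y_def None option.case by (intro measurable_abs_UNIV)
    next
      case (Some w)
      show ?thesis
        unfolding Y_def Some option.case
        by (intro measurable_abs_UNIV measurable_component_singleton) (auto simp: K_def)
    qed
  qed
  also have "(\<lambda>i \<omega>. Y i (restrict (env \<omega>) (K i))) =
      (\<lambda>i \<omega>. case i of None \<Rightarrow> cut n (shift v (env \<omega>)) | Some w \<Rightarrow> shift (v @ w) (env \<omega>))"
    by (auto simp: fun_eq_iff Y_def K_def cut_def shift_def split: option.split)
  finally show ?thesis .
qed

text \<open>Product form of \<open>indep_blocks\<close>, used with one vertex to peel a factor off a
  path, with two vertices for mixed second moments, and with many for the event that all candidates
  fail.\<close>

lemma expectation_blocks: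
  fixes f :: "'c environment \<Rightarrow> real" and g :: "'c list \<Rightarrow> 'c environment \<Rightarrow> real"
  assumes [measurable]: "f \<in> borel_measurable env_space" "\<And>w. g w \<in> borel_measurable env_space"
    and W: "W \<subseteq> words n" and f: "\<And>e. f (cut n e) = f e"
    and int: "integrable M (\<lambda>\<omega>. f (shift v (env \<omega>)))"
      "\<And>w. w \<in> W \<Longrightarrow> integrable M (\<lambda>\<omega>. g w (shift (v @ w) (env \<omega>)))"
  shows "expectation (\<lambda>\<omega>. f (shift v (env \<omega>)) * (\<Prod>w\<in>W. g w (shift (v @ w) (env \<omega>)))) =
      expectation (\<lambda>\<omega>. f (shift v (env \<omega>))) * (\<Prod>w\<in>W. expectation (\<lambda>\<omega>. g w (shift (v @ w) (env \<omega>))))"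
    and "integrable M (\<lambda>\<omega>. f (shift v (env \<omega>)) * (\<Prod>w\<in>W. g w (shift (v @ w) (env \<omega>))))"
proof -
  define X where "X i \<omega> = (case i of None \<Rightarrow> f (shift v (env \<omega>)) | Some w \<Rightarrow> g w (shift (v @ w) (env \<omega>)))" for i \<omega>
  define I where "I = insert None (Some ` W)"
  have fin: "finite W"
    using finite_subset[OF W] by simp
  have "indep_vars (\<lambda>_. borel)
      (\<lambda>i \<omega>. (case i of None \<Rightarrow> f | Some w \<Rightarrow> g w)
        (case i of None \<Rightarrow> cut n (shift v (env \<omega>)) | Some w \<Rightarrow> shift (v @ w) (env \<omega>))) I"
    by (rule indep_vars_compose2[OF indep_vars_subset[OF indep_blocks]])
       (use W in \<open>auto simp: I_def split: option.split\<close>)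
  also have "(\<lambda>i \<omega>. (case i of None \<Rightarrow> f | Some w \<Rightarrow> g w)
        (case i of None \<Rightarrow> cut n (shift v (env \<omega>)) | Some w \<Rightarrow> shift (v @ w) (env \<omega>))) = X"
    by (auto simp: X_def fun_eq_iff f split: option.split)
  finally have ind: "indep_vars (\<lambda>_. borel) X I" .
  have int': "integrable M (X i)" if "i \<in> I" for i
    using that int by (auto simp: X_def[abs_def] I_def)
  have *: "(\<Prod>i\<in>I. h i) = h None * (\<Prod>w\<in>W. h (Some w))" for h :: "'c list option \<Rightarrow> real"
    unfolding I_def using fin by (simp add: prod.reindex)
  have "finite I"
    using fin by (simp add: I_def)
  from indep_vars_lebesgue_integral[OF this ind int'] indep_vars_integrable[OF this ind int']
  show "expectation (\<lambda>\<omega>. f (shift v (env \<omega>)) * (\<Prod>w\<in>W. g w (shift (v @ w) (env \<omega>)))) =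
      expectation (\<lambda>\<omega>. f (shift v (env \<omega>))) * (\<Prod>w\<in>W. expectation (\<lambda>\<omega>. g w (shift (v @ w) (env \<omega>))))"
    "integrable M (\<lambda>\<omega>. f (shift v (env \<omega>)) * (\<Prod>w\<in>W. g w (shift (v @ w) (env \<omega>))))"
    unfolding * by (simp_all add: X_def[abs_def])
qed

definition moment :: "(real \<Rightarrow> real) \<Rightarrow> 'c \<Rightarrow> 'c \<Rightarrow> real" where
  "moment \<phi> i j = expectation (\<lambda>\<omega>. \<phi> (ratio (shift [i] (env \<omega>)) j))"

text \<open>The first factor depends only on the vector at \<open>v\<close>, the others on the
  subtree of the child \<open>j\<close>; so expectations multiply, and the colour of the child
  selects the next row of moments.\<close>

lemma expectation_weight:
  assumes [measurable]: "\<phi> \<in> borel_measurable borel"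
    and int: "\<And>i j. integrable M (\<lambda>\<omega>. \<phi> (ratio (shift [i] (env \<omega>)) j))"
    and v: "v \<noteq> []"
  shows "integrable M (\<lambda>\<omega>. weight \<phi> w (shift v (env \<omega>))) \<and>
    expectation (\<lambda>\<omega>. weight \<phi> w (shift v (env \<omega>))) = chain_prod (moment \<phi>) (last v) w"
  using v
proof (induction w arbitrary: v)
  case Nil
  then show ?case by (simp add: prob_space)
next
  case (Cons j w)
  have [measurable]: "weight \<phi> w \<in> borel_measurable env_space"
    by simp
  have r: "integrable M (\<lambda>\<omega>. \<phi> (ratio (shift v (env \<omega>)) j))"
    "expectation (\<lambda>\<omega>. \<phi> (ratio (shift v (env \<omega>)) j)) = moment \<phi> (last v) j"
    using expectation_shift[of "\<lambda>e. \<phi> (ratio e j)" v "[last v]"] Cons.prems int[of "last v" j]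
    by (simp_all add: moment_def)
  have IH: "integrable M (\<lambda>\<omega>. weight \<phi> w (shift (v @ [j]) (env \<omega>)))"
    "expectation (\<lambda>\<omega>. weight \<phi> w (shift (v @ [j]) (env \<omega>))) = chain_prod (moment \<phi>) j w"
    using Cons.IH[of "v @ [j]"] by simp_all
  have "ratio (cut 1 e) j = ratio e j" for e :: "'c environment"
    by (simp add: ratio_def cut_def)
  with expectation_blocks[of "\<lambda>e. \<phi> (ratio e j)" "\<lambda>_. weight \<phi> w" "{[j]}" 1 v] r IH
  show ?case
    by (simp add: words_def)
qed

lemma moment_nonneg: "(\<And>z. \<phi> z \<ge> 0) \<Longrightarrow> moment \<phi> i j \<ge> 0"
  by (simp add: moment_def)

lemma pos_ratios_env: "v \<noteq> [] \<Longrightarrow> AE \<omega> in M. pos_ratios (shift v (env \<omega>))"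
  using env_ok by eventually_elim (auto simp: env_def pos_ratios_shift_env)

text \<open>The vector of ones times \<open>vmin\<close> lies below the positive eigenvector, so the
  row sums of the \<open>n\<close>-th power of the moment matrix are bounded by a multiple of
  \<open>r ^ n\<close>.\<close>

lemma AE_summable_chaos_Y:
  assumes x: "0 \<le> x" "x \<le> 1"
    and int: "\<And>i j. integrable M (\<lambda>\<omega>. ratio (shift [i] (env \<omega>)) j powr x)"
    and eig: "\<And>i. (\<Sum>j\<in>UNIV. moment (\<lambda>z. z powr x) i j * v j) = r * v i"
    and v: "\<And>i. v i > 0" and r: "0 < r" "r < 1"
  shows "AE \<omega> in M. summable (chaos_Y (env \<omega>))"
proof -
  let ?m = "moment (\<lambda>z. z powr x)"
  define T where "T n \<omega> = (\<Sum>j\<in>UNIV. \<Sum>w\<in>words n. weight (\<lambda>z. z powr x) w (shift [j] (env \<omega>)))" for n \<omega>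
  have sum_eig: "(\<Sum>w\<in>words n. chain_prod ?m c w * v (colour c w)) = r ^ n * v c" for n c
  proof (induction n arbitrary: c)
    case (Suc n)
    have "(\<Sum>w\<in>words (Suc n). chain_prod ?m c w * v (colour c w)) =
        (\<Sum>j\<in>UNIV. ?m c j * (\<Sum>w\<in>words n. chain_prod ?m j w * v (colour j w)))"
      by (simp add: sum_words_Suc sum_distrib_left mult.assoc)
    also have "\<dots> = r ^ n * (\<Sum>j\<in>UNIV. ?m c j * v j)"
      unfolding Suc.IH sum_distrib_left by (simp add: mult_ac)
    finally show ?case
      by (simp add: eig)
  qed simp
  define vmin where "vmin = Min (range v)"
  have "vmin \<in> range v"
    unfolding vmin_def by (intro Min_in) auto
  then have vmin: "vmin > 0" "vmin \<le> v i" for i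
    using v by (auto simp: vmin_def)
  have sum_le: "(\<Sum>w\<in>words n. chain_prod ?m c w) \<le> r ^ n * (v c / vmin)" for n c
  proof -
    have "vmin * (\<Sum>w\<in>words n. chain_prod ?m c w) \<le> (\<Sum>w\<in>words n. chain_prod ?m c w * v (colour c w))"
      unfolding sum_distrib_left
      by (intro sum_mono, subst mult.commute, intro mult_left_mono vmin chain_prod_nonneg moment_nonneg) auto
    then show ?thesis
      unfolding sum_eig using vmin by (simp add: field_simps)
  qed
  have weight_int: "integrable M (\<lambda>\<omega>. weight (\<lambda>z. z powr x) w (shift [j] (env \<omega>)))"
    "expectation (\<lambda>\<omega>. weight (\<lambda>z. z powr x) w (shift [j] (env \<omega>))) = chain_prod ?m j w" for j w
    using expectation_weight[of "\<lambda>z. z powr x" "[j]" w] int by auto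
  have T_int: "integrable M (T n)" for n
    unfolding T_def by (intro Bochner_Integration.integrable_sum weight_int)
  have T_nonneg: "T n \<omega> \<ge> 0" for n \<omega>
    unfolding T_def by (intro sum_nonneg weight_nonneg) auto
  define C where "C = (\<Sum>j\<in>UNIV. v j / vmin)"
  have T_le: "expectation (T n) \<le> C * r ^ n" for n
  proof -
    have "expectation (T n) = (\<Sum>j\<in>UNIV. \<Sum>w\<in>words n. chain_prod ?m j w)"
      unfolding T_def by (simp add: weight_int)
    also have "\<dots> \<le> (\<Sum>j\<in>UNIV. r ^ n * (v j / vmin))"
      by (intro sum_mono sum_le)
    finally show ?thesis
      by (simp add: C_def sum_distrib_left mult.commute)
  qed
  have [measurable]: "T n \<in> borel_measurable M" for n
    using T_int by auto
  have "C \<ge> 0"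
    unfolding C_def using v vmin(1) by (intro sum_nonneg divide_nonneg_pos) (auto simp: less_imp_le)
  then have fin: "(\<Sum>n. ennreal (C * r ^ n)) \<noteq> \<top>"
    using r by (intro ennreal_suminf_neq_top summable_mult summable_geometric) auto
  have "(\<integral>\<^sup>+\<omega>. (\<Sum>n. ennreal (T n \<omega>)) \<partial>M) = (\<Sum>n. \<integral>\<^sup>+\<omega>. ennreal (T n \<omega>) \<partial>M)"
    by (rule nn_integral_suminf) simp
  also have "\<dots> = (\<Sum>n. ennreal (expectation (T n)))"
    using T_int T_nonneg by (simp add: nn_integral_eq_integral)
  also have "\<dots> \<le> (\<Sum>n. ennreal (C * r ^ n))"
    using T_le by (intro suminf_le ennreal_leI) auto
  also have "\<dots> < \<top>"
    using fin by (simp add: less_top)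
  finally have "(\<integral>\<^sup>+\<omega>. (\<Sum>n. ennreal (T n \<omega>)) \<partial>M) \<noteq> \<infinity>"
    by simp
  then have "AE \<omega> in M. (\<Sum>n. ennreal (T n \<omega>)) \<noteq> \<infinity>"
    by (intro nn_integral_PInf_AE) auto
  moreover have "AE \<omega> in M. env_ok (env \<omega>)"
    using env_ok by (simp add: env_def)
  ultimately show ?thesis
  proof eventually_elim
    fix \<omega> assume fin: "(\<Sum>n. ennreal (T n \<omega>)) \<noteq> \<infinity>" and ok: "env_ok (env \<omega>)"
    have summ: "summable (\<lambda>n. T n \<omega>)"
      using fin T_nonneg by (intro summable_suminf_not_top) auto
    have pos: "weight (\<lambda>z. z) w (shift [j] (env \<omega>)) > 0" for w j
      using ok by (intro weight_pos pos_ratios_shift_env) auto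
    have powr: "weight (\<lambda>z. z powr x) w (shift [j] (env \<omega>)) = weight (\<lambda>z. z) w (shift [j] (env \<omega>)) powr x" for w j
      using ok by (intro weight_powr pos_ratios_shift_env) auto
    \<comment> \<open>Then every summand \<open>z powr x\<close> is below 1, hence
      \<open>z < 1\<close>, and so \<open>z \<le> z powr x\<close> because
      \<open>x \<le> 1\<close>.\<close>
    have "eventually (\<lambda>n. T n \<omega> < 1) sequentially"
      using summable_LIMSEQ_zero[OF summ] by (rule order_tendstoD) simp
    then have "eventually (\<lambda>n. norm (chaos_Y (env \<omega>) (Suc n)) \<le> T n \<omega>) sequentially"
    proof eventually_elim
      fix n assume T1: "T n \<omega> < 1"
      have "chaos_Y (env \<omega>) (Suc n) = (\<Sum>j\<in>UNIV. \<Sum>w\<in>words n. env \<omega> [] $ Some j * weight (\<lambda>z. z) w (shift [j] (env \<omega>)))"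
        by (simp add: chaos_Y_words sum_words_Suc path_weight_Cons)
      also have "\<dots> \<le> T n \<omega>"
        unfolding T_def
      proof (intro sum_mono)
        fix j and w :: "'c list" assume w: "w \<in> words n"
        let ?z = "weight (\<lambda>z. z) w (shift [j] (env \<omega>))"
        have "?z powr x \<le> (\<Sum>w\<in>words n. weight (\<lambda>z. z powr x) w (shift [j] (env \<omega>)))"
          unfolding powr[symmetric] by (rule member_le_sum) (auto simp: w intro!: weight_nonneg)
        also have "\<dots> \<le> T n \<omega>"
          unfolding T_def by (rule member_le_sum) (auto intro!: weight_nonneg sum_nonneg)
        finally have "?z powr x < 1"
          using T1 by simp
        then have z1: "?z < 1"
          using ge_one_powr_ge_zero[of ?z x] x by (auto simp: not_le[symmetric])
        have "env \<omega> [] $ Some j \<le> (\<Sum>s\<in>UNIV. env \<omega> [] $ s)"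
          using ok by (intro member_le_sum) (auto simp: env_ok_nonneg)
        then have "env \<omega> [] $ Some j \<le> 1"
          using ok by (simp add: env_ok_def)
        then have "env \<omega> [] $ Some j * ?z \<le> 1 * ?z powr 1"
          using pos[of w j] by (intro mult_mono) auto
        also have "\<dots> \<le> 1 * ?z powr x"
          using z1 pos[of w j] x by (intro mult_left_mono powr_mono') auto
        finally show "env \<omega> [] $ Some j * ?z \<le> weight (\<lambda>z. z powr x) w (shift [j] (env \<omega>))"
          by (simp add: powr)
      qed
      finally show "norm (chaos_Y (env \<omega>) (Suc n)) \<le> T n \<omega>"
        using chaos_Y_nonneg[OF ok] by simp
    qed
    then have "summable (\<lambda>n. chaos_Y (env \<omega>) (Suc n))"
      using summ by (rule summable_comparison_test_ev)
    then show "summable (chaos_Y (env \<omega>))"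
      by (simp only: summable_Suc_iff)
  qed
qed

end

section \<open>Large deviations\<close>

text \<open>If \<open>ln z\<close> lies above \<open>t\<close> or below \<open>s\<close>, one
  subtracted term alone is at least \<open>z powr x\<close>; otherwise
  \<open>z powr x \<le> exp (t * x)\<close> since \<open>x \<ge> 0\<close>. In expectation this
  bounds the probability of \<open>exp s \<le> z\<close> from below by three moments.\<close>

lemma chernoff_pointwise:
  fixes z x h s t :: real
  assumes z: "z > 0" and "x \<ge> 0" "h > 0"
  shows "z powr x - exp (- (h * t)) * z powr (x + h) - exp (h * s) * z powr (x - h)
    \<le> exp (t * x) * of_bool (exp s \<le> z)"
proof -
  have powr: "z powr y = exp (ln z * y)" for y
    using z by (simp add: powr_def mult.commute)
  have nonneg: "0 \<le> exp (- (h * t)) * z powr (x + h)" "0 \<le> exp (h * s) * z powr (x - h)"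
    "0 \<le> exp (t * x) * of_bool (exp s \<le> z)"
    by simp_all
  consider "ln z > t" | "ln z < s" | "s \<le> ln z" "ln z \<le> t"
    by linarith
  then show ?thesis
  proof cases
    case 1
    then have "z powr x \<le> exp (- (h * t)) * z powr (x + h)"
      using assms by (simp add: powr exp_add[symmetric] algebra_simps)
    then show ?thesis
      using nonneg by linarith
  next
    case 2
    then have "z powr x \<le> exp (h * s) * z powr (x - h)"
      using assms by (simp add: powr exp_add[symmetric] algebra_simps)
    then show ?thesis
      using nonneg by linarith
  next
    case 3
    then have "exp s \<le> z"
      using z by (metis exp_le_cancel_iff exp_ln)
    moreover have "z powr x \<le> exp (t * x)"
      using 3 assms by (simp add: powr mult_right_mono)
    ultimately have "z powr x \<le> exp (t * x) * of_bool (exp s \<le> z)"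
      by simp
    then show ?thesis
      using nonneg by linarith
  qed
qed

text \<open>The exponent \<open>x\<close> is a minimum point of \<open>\<Lambda>\<close> on the unit interval and \<open>\<tau>\<close> is the logarithmic
  derivative there, that is the speed under the measure tilted by \<open>x\<close>. The sign of \<open>\<tau>\<close> at the
  end points makes \<open>\<tau> x \<le> min \<tau> 0\<close>, and this is all that is used.\<close>

lemma chernoff_parameters:
  fixes \<Lambda> :: "real \<Rightarrow> real"
  assumes deriv: "\<And>x. (\<Lambda> has_real_derivative D x) (at x)"
    and gt1: "\<And>x. 0 \<le> x \<Longrightarrow> x \<le> 1 \<Longrightarrow> \<Lambda> x > 1"
    and nonneg: "\<And>x. \<Lambda> x \<ge> 0"
  obtains k :: nat and x h s t a where "k \<ge> 1" "x \<ge> 0" "h > 0" "0 < a" "a \<le> 1" "a \<le> exp s"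
    "\<Lambda> x ^ k - exp (- (h * t)) * \<Lambda> (x + h) ^ k - exp (h * s) * \<Lambda> (x - h) ^ k > exp (t * x) / a"
proof -
  have cont: "continuous_on {0..1} \<Lambda>"
    using deriv by (intro continuous_at_imp_continuous_on) (auto intro: DERIV_isCont)
  obtain x where x: "x \<in> {0..1}" and min: "\<And>y. y \<in> {0..1} \<Longrightarrow> \<Lambda> x \<le> \<Lambda> y"
    using continuous_attains_inf[of "{0..1}", OF _ _ cont] by auto
  define L where "L = \<Lambda> x"
  have L: "L > 1"
    using gt1 x by (simp add: L_def)
  define \<tau> where "\<tau> = D x / L"
  have D: "D x = \<tau> * L"
    using L by (simp add: \<tau>_def)
  have left: "D x \<le> 0" if "x > 0"
  proof (rule ccontr)
    assume "\<not> D x \<le> 0"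
    then obtain d where d: "d > 0" "\<And>h. 0 < h \<Longrightarrow> h < d \<Longrightarrow> \<Lambda> (x - h) < \<Lambda> x"
      using DERIV_pos_inc_left[OF deriv, of x] by (auto simp: not_le)
    define h where "h = min (d / 2) x"
    have "\<Lambda> (x - h) < \<Lambda> x" "x - h \<in> {0..1}"
      using d x that by (auto simp: h_def min_def)
    then show False
      using min[of "x - h"] by simp
  qed
  have right: "D x \<ge> 0" if "x < 1"
  proof (rule ccontr)
    assume "\<not> D x \<ge> 0"
    then obtain d where d: "d > 0" "\<And>h. 0 < h \<Longrightarrow> h < d \<Longrightarrow> \<Lambda> (x + h) < \<Lambda> x"
      using DERIV_neg_dec_right[OF deriv, of x] by (auto simp: not_le)
    define h where "h = min (d / 2) (1 - x)"
    have "\<Lambda> (x + h) < \<Lambda> x" "x + h \<in> {0..1}"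
      using d x that by (auto simp: h_def min_def)
    then show False
      using min[of "x + h"] by simp
  qed
  \<comment> \<open>Exponent of \<open>a\<close>, which must be at most 1 and at most
    \<open>exp s\<close>. The inequality \<open>\<tau> * x \<le> \<tau>'\<close> then keeps
    \<open>exp (t * x) / a\<close> small.\<close>
  define \<tau>' where "\<tau>' = min \<tau> 0"
  have sgn: "\<tau> \<le> 0 \<longleftrightarrow> D x \<le> 0" "0 \<le> \<tau> \<longleftrightarrow> 0 \<le> D x"
    using L by (auto simp: D mult_le_0_iff zero_le_mult_iff)
  have \<tau>': "\<tau> * x \<le> \<tau>'"
  proof -
    consider "x = 0" | "x = 1" | "0 < x" "x < 1"
      using x by fastforce
    then show ?thesis
    proof cases
      case 1
      then show ?thesis using right sgn by (simp add: \<tau>'_def)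
    next
      case 2
      then show ?thesis using left sgn by (simp add: \<tau>'_def)
    next
      case 3
      then have "\<tau> = 0" using left[OF 3(1)] right[OF 3(2)] sgn by linarith
      then show ?thesis by (simp add: \<tau>'_def)
    qed
  qed
  \<comment> \<open>So \<open>L = exp (4 * \<epsilon>)\<close>: half of the exponent pays for
    \<open>exp (t * x) / a\<close>, the other half beats the constants.\<close>
  define \<epsilon> where "\<epsilon> = ln L / 4"
  have \<epsilon>: "\<epsilon> > 0"
    using L by (simp add: \<epsilon>_def)
  \<comment> \<open>Tilting by slightly more than the logarithmic derivative makes the function
    decrease at \<open>x\<close>, so the upper tail term is exponentially smaller than
    \<open>L ^ k\<close>. The mirrored derivative below treats the lower tail.\<close>
  have "((\<lambda>y. \<Lambda> y * exp (- (\<tau> + \<epsilon>) * (y - x))) has_real_derivative - \<epsilon> * L) (at x)"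
    by (rule derivative_eq_intros deriv refl)+ (simp add: D L_def algebra_simps)
  then obtain d1 where d1: "d1 > 0"
    "\<And>h. 0 < h \<Longrightarrow> h < d1 \<Longrightarrow> \<Lambda> (x + h) * exp (- (\<tau> + \<epsilon>) * h) < L"
    using DERIV_neg_dec_right[of "\<lambda>y. \<Lambda> y * exp (- (\<tau> + \<epsilon>) * (y - x))" "- \<epsilon> * L" x] \<epsilon> L
    by (auto simp: L_def)
  have "((\<lambda>y. \<Lambda> y * exp (- (\<tau> - \<epsilon>) * (y - x))) has_real_derivative \<epsilon> * L) (at x)"
    by (rule derivative_eq_intros deriv refl)+ (simp add: D L_def algebra_simps)
  then obtain d2 where d2: "d2 > 0"
    "\<And>h. 0 < h \<Longrightarrow> h < d2 \<Longrightarrow> \<Lambda> (x - h) * exp (- ((\<epsilon> - \<tau>) * h)) < L"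
    using DERIV_pos_inc_left[of "\<lambda>y. \<Lambda> y * exp (- (\<tau> - \<epsilon>) * (y - x))" "\<epsilon> * L" x] \<epsilon> L
    by (auto simp: L_def)
  define h where "h = min d1 d2 / 2"
  have h: "0 < h" "h < d1" "h < d2"
    using d1 d2 by (auto simp: h_def)
  \<comment> \<open>The subtracted terms will be \<open>L ^ k * q1 ^ k\<close> and
    \<open>L ^ k * q2 ^ k\<close>.\<close>
  define q1 where "q1 = \<Lambda> (x + h) * exp (- (\<tau> + \<epsilon>) * h) / L"
  define q2 where "q2 = \<Lambda> (x - h) * exp ((\<tau> - \<epsilon>) * h) / L"
  have q: "0 \<le> q1" "q1 < 1" "0 \<le> q2" "q2 < 1"
    using d1(2)[of h] d2(2)[of h] h L nonneg by (auto simp: q1_def q2_def algebra_simps)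
  have "L * exp (- 2 * \<epsilon>) = exp (2 * \<epsilon>)"
  proof -
    have "L = exp (4 * \<epsilon>)"
      using L by (simp add: \<epsilon>_def)
    then show ?thesis
      by (simp add: exp_add[symmetric])
  qed
  moreover have "exp (2 * \<epsilon>) > 1"
    using \<epsilon> by simp
  ultimately have gt1': "L * exp (- 2 * \<epsilon>) > 1"
    by simp
  then obtain k0 where k0: "(L * exp (- 2 * \<epsilon>)) ^ k0 > 2"
    using real_arch_pow by blast
  have "eventually (\<lambda>k. (L * exp (- 2 * \<epsilon>)) ^ k > 2) sequentially"
    using eventually_ge_at_top[of k0]
    by eventually_elim (use k0 gt1' power_increasing order_less_le_trans less_imp_le in metis)
  moreover have "eventually (\<lambda>k. q1 ^ k < 1 / 4) sequentially" "eventually (\<lambda>k. q2 ^ k < 1 / 4) sequentially"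
    using q order_tendstoD(2)[OF LIMSEQ_power_zero[of q1], of "1 / 4"]
      order_tendstoD(2)[OF LIMSEQ_power_zero[of q2], of "1 / 4"] by auto
  ultimately have "eventually (\<lambda>k. (L * exp (- 2 * \<epsilon>)) ^ k > 2 \<and> q1 ^ k < 1 / 4 \<and> q2 ^ k < 1 / 4 \<and> k \<ge> 1) sequentially"
    using eventually_ge_at_top[of "1 :: nat"] by eventually_elim auto
  then obtain k where k: "(L * exp (- 2 * \<epsilon>)) ^ k > 2" "q1 ^ k < 1 / 4" "q2 ^ k < 1 / 4" "k \<ge> 1"
    using eventually_happens'[OF sequentially_bot] by blast
  define s t a where "s = k * (\<tau> - \<epsilon>)" and "t = k * (\<tau> + \<epsilon>)" and "a = exp (k * (\<tau>' - \<epsilon>))"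
  have "exp (t * x) / a = exp (k * ((\<tau> + \<epsilon>) * x - \<tau>' + \<epsilon>))"
    by (simp add: t_def a_def exp_diff[symmetric] algebra_simps)
  also have "\<dots> \<le> exp (k * (2 * \<epsilon>))"
  proof -
    have "\<epsilon> * x \<le> \<epsilon> * 1"
      using x \<epsilon> by (intro mult_left_mono) auto
    then have "(\<tau> + \<epsilon>) * x - \<tau>' + \<epsilon> \<le> 2 * \<epsilon>"
      using \<tau>' by (simp add: algebra_simps)
    then show ?thesis
      by (simp add: mult_left_mono)
  qed
  also have "\<dots> < exp (k * (2 * \<epsilon>)) * ((L * exp (- 2 * \<epsilon>)) ^ k * (1 - q1 ^ k - q2 ^ k))"
  proof -
    have "2 * (1 / 2) < (L * exp (- 2 * \<epsilon>)) ^ k * (1 - q1 ^ k - q2 ^ k)"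
      using k by (intro mult_strict_mono) auto
    then show ?thesis
      by simp
  qed
  also have "\<dots> = L ^ k * (1 - q1 ^ k - q2 ^ k)"
  proof -
    have "exp (k * (2 * \<epsilon>)) * (L * exp (- 2 * \<epsilon>)) ^ k = (exp (2 * \<epsilon>) * (L * exp (- 2 * \<epsilon>))) ^ k"
      by (simp only: exp_of_nat_mult power_mult_distrib)
    also have "exp (2 * \<epsilon>) * (L * exp (- 2 * \<epsilon>)) = L"
      by (simp add: exp_minus)
    finally show ?thesis
      by (simp only: mult.assoc[symmetric])
  qed
  also have "\<dots> = L ^ k - exp (- (h * t)) * \<Lambda> (x + h) ^ k - exp (h * s) * \<Lambda> (x - h) ^ k"
  proof -
    have "- (h * t) = k * (- (\<tau> + \<epsilon>) * h)" "h * s = k * ((\<tau> - \<epsilon>) * h)"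
      by (simp_all add: t_def s_def algebra_simps)
    then have e: "exp (- (h * t)) = exp (- (\<tau> + \<epsilon>) * h) ^ k" "exp (h * s) = exp ((\<tau> - \<epsilon>) * h) ^ k"
      by (simp_all only: exp_of_nat_mult)
    have "L ^ k * q1 ^ k = exp (- (h * t)) * \<Lambda> (x + h) ^ k"
      unfolding e power_mult_distrib[symmetric] using L by (simp add: q1_def mult.commute)
    moreover have "L ^ k * q2 ^ k = exp (h * s) * \<Lambda> (x - h) ^ k"
      unfolding e power_mult_distrib[symmetric] using L by (simp add: q2_def mult.commute)
    ultimately show ?thesis
      by (simp add: algebra_simps)
  qed
  finally show thesis
    using k x h \<epsilon> by (intro that[of k x h a s t]) (auto simp: L_def a_def s_def \<tau>'_def mult_le_0_iff mult_left_mono)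
qed

section \<open>Differentiability of truncated moments\<close>

lemma DERIV_quadratic:
  fixes f :: "real \<Rightarrow> real"
  assumes "r > 0" and le: "\<And>h. \<bar>h\<bar> \<le> r \<Longrightarrow> \<bar>f (x + h) - f x - h * D\<bar> \<le> C * h\<^sup>2"
  shows "(f has_real_derivative D) (at x)"
proof -
  have "((\<lambda>h. (f (x + h) - f x) / h - D) \<longlongrightarrow> 0) (at 0)"
  proof (rule Lim_null_comparison)
    have "eventually (\<lambda>h. \<bar>h\<bar> \<le> r) (at (0::real))"
      unfolding eventually_at using assms(1) by (auto simp: dist_real_def intro!: exI[of _ r])
    moreover have "eventually (\<lambda>h. h \<noteq> 0) (at (0::real))"
      by (simp add: eventually_at_filter)
    ultimately show "eventually (\<lambda>h. norm ((f (x + h) - f x) / h - D) \<le> C * \<bar>h\<bar>) (at 0)"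
    proof eventually_elim
      fix h :: real assume h: "\<bar>h\<bar> \<le> r" "h \<noteq> 0"
      have "(f (x + h) - f x) / h - D = (f (x + h) - f x - h * D) / h"
        using h by (simp add: diff_divide_distrib)
      then have "\<bar>h\<bar> * norm ((f (x + h) - f x) / h - D) = \<bar>f (x + h) - f x - h * D\<bar>"
        using h by simp
      also have "\<dots> \<le> \<bar>h\<bar> * (C * \<bar>h\<bar>)"
        using le[OF h(1)] by (simp add: power2_eq_square mult_ac abs_mult_self_eq flip: power2_abs)
      finally show "norm ((f (x + h) - f x) / h - D) \<le> C * \<bar>h\<bar>"
        using h by simp
    qed
    show "((\<lambda>h. C * \<bar>h\<bar>) \<longlongrightarrow> 0) (at 0)"
      by (rule tendsto_eq_intros refl)+ simp
  qed
  then have "((\<lambda>h. (f (x + h) - f x) / h) \<longlongrightarrow> D) (at 0)"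
    by (rule LIM_zero_cancel)
  then show ?thesis
    by (simp add: DERIV_def)
qed

lemma abs_exp_minus_linear:
  fixes y :: real
  assumes "\<bar>y\<bar> \<le> 1"
  shows "\<bar>exp y - 1 - y\<bar> \<le> y\<^sup>2"
proof -
  have "exp y \<le> 1 + y + y\<^sup>2"
  proof (cases "y \<ge> 0")
    case True
    then show ?thesis
      using exp_bound[of y] assms by simp
  next
    case False
    define s where "s = - y"
    have s: "s > 0" using False by (simp add: s_def)
    have "exp y = 1 / exp s"
      by (simp add: s_def exp_minus inverse_eq_divide)
    also have "\<dots> \<le> 1 / (1 + s)"
      using s exp_ge_add_one_self[of s] by (intro divide_left_mono) auto
    also have "\<dots> \<le> 1 - s + s\<^sup>2"
    proof -
      have "1 \<le> 1 + s ^ 3" using s by simp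
      also have "\<dots> = (1 - s + s\<^sup>2) * (1 + s)"
        by (simp add: algebra_simps power2_eq_square power3_eq_cube)
      finally show ?thesis using s by (simp add: pos_divide_le_eq)
    qed
    finally show ?thesis by (simp add: s_def)
  qed
  moreover have "1 + y \<le> exp y"
    by (rule exp_ge_add_one_self)
  ultimately show ?thesis
    using zero_le_power2[of y] by linarith
qed

text \<open>On the window \<open>ln z\<close> is bounded by \<open>ln (1 / \<delta>)\<close> in
  modulus, so the second order remainder of \<open>exp (h * ln z)\<close> is uniform in
  \<open>z\<close> and can be integrated.\<close>

lemma DERIV_truncated_moment:
  fixes X :: "'a \<Rightarrow> real"
  assumes "prob_space M" and [measurable]: "X \<in> borel_measurable M" and \<delta>: "0 < \<delta>" "\<delta> < 1"
  shows "((\<lambda>x. \<integral>\<omega>. X \<omega> powr x * window \<delta> (X \<omega>) \<partial>M) has_real_derivative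
    (\<integral>\<omega>. ln (X \<omega>) * (X \<omega> powr x * window \<delta> (X \<omega>)) \<partial>M)) (at x)"
proof -
  interpret prob_space M by fact
  define K where "K = ln (1 / \<delta>)"
  have K: "K > 0"
    using \<delta> by (simp add: K_def)
  have ln_le: "\<bar>ln z\<bar> \<le> K" if "z \<in> {\<delta>..1 / \<delta>}" for z
  proof -
    have "z > 0" using that \<delta> by auto
    then have "ln \<delta> \<le> ln z" "ln z \<le> ln (1 / \<delta>)"
      using that \<delta> by auto
    then show ?thesis
      using \<delta> by (auto simp: K_def ln_div abs_le_iff)
  qed
  define f where "f x z = z powr x * window \<delta> z" for x z
  have f_nonneg: "f x z \<ge> 0" for x z
    by (simp add: f_def)
  have f_le: "f x z \<le> exp (K * \<bar>x\<bar>)" for x z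
  proof (cases "z \<in> {\<delta>..1 / \<delta>}")
    case True
    then have "z > 0" using \<delta> by auto
    have "x * ln z \<le> \<bar>x\<bar> * \<bar>ln z\<bar>"
      by (simp add: abs_mult[symmetric])
    also have "\<dots> \<le> \<bar>x\<bar> * K"
      by (intro mult_left_mono ln_le True) auto
    finally show ?thesis
      using True \<open>z > 0\<close> by (simp add: f_def powr_def mult.commute)
  qed (simp add: f_def)
  have [measurable]: "f x \<in> borel_measurable borel" for x
    unfolding f_def by measurable
  have int: "integrable M (\<lambda>\<omega>. f x (X \<omega>))" for x
    using f_nonneg f_le by (intro integrable_const_bound[of _ "exp (K * \<bar>x\<bar>)"]) auto
  have int2: "integrable M (\<lambda>\<omega>. ln (X \<omega>) * f x (X \<omega>))" for x
  proof (rule integrable_const_bound[of _ "K * exp (K * \<bar>x\<bar>)"])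
    have "\<bar>ln z * f x z\<bar> \<le> K * exp (K * \<bar>x\<bar>)" for z
    proof (cases "z \<in> {\<delta>..1 / \<delta>}")
      case True
      then show ?thesis
        unfolding abs_mult using f_nonneg[of x z] f_le[of x z] ln_le[OF True] K by (intro mult_mono) auto
    next
      case False
      then show ?thesis using K by (simp add: f_def)
    qed
    then show "AE \<omega> in M. norm (ln (X \<omega>) * f x (X \<omega>)) \<le> K * exp (K * \<bar>x\<bar>)"
      by simp
  qed simp
  have "((\<lambda>x. \<integral>\<omega>. f x (X \<omega>) \<partial>M) has_real_derivative (\<integral>\<omega>. ln (X \<omega>) * f x (X \<omega>) \<partial>M)) (at x)"
  proof (rule DERIV_quadratic)
    \<comment> \<open>This radius keeps \<open>h * ln z\<close> in the range of
      \<open>abs_exp_minus_linear\<close>.\<close>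
    show "1 / K > 0" using K by simp
    fix h :: real assume h: "\<bar>h\<bar> \<le> 1 / K"
    have bd: "\<bar>f (x + h) z - f x z - h * (ln z * f x z)\<bar> \<le> exp (K * \<bar>x\<bar>) * K\<^sup>2 * h\<^sup>2" for z
    proof (cases "z \<in> {\<delta>..1 / \<delta>}")
      case True
      then have "z > 0" using \<delta> by auto
      have "\<bar>h * ln z\<bar> \<le> 1 / K * K"
        unfolding abs_mult using h ln_le[OF True] K by (intro mult_mono) auto
      then have "\<bar>h * ln z\<bar> \<le> 1"
        using K by simp
      have "f (x + h) z - f x z - h * (ln z * f x z) = f x z * (exp (h * ln z) - 1 - h * ln z)"
        using True \<open>z > 0\<close> by (simp add: f_def powr_add algebra_simps) (simp add: powr_def)
      then have "\<bar>f (x + h) z - f x z - h * (ln z * f x z)\<bar> = f x z * \<bar>exp (h * ln z) - 1 - h * ln z\<bar>"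
        using f_nonneg by (simp add: abs_mult)
      also have "\<dots> \<le> exp (K * \<bar>x\<bar>) * (h * ln z)\<^sup>2"
        using f_nonneg f_le \<open>\<bar>h * ln z\<bar> \<le> 1\<close> by (intro mult_mono abs_exp_minus_linear) auto
      also have "(h * ln z)\<^sup>2 \<le> K\<^sup>2 * h\<^sup>2"
      proof -
        have "(ln z)\<^sup>2 \<le> K\<^sup>2"
          using ln_le[OF True] K by (simp flip: abs_le_square_iff)
        then show ?thesis
          by (simp add: power_mult_distrib mult.commute[of "h\<^sup>2"] mult_right_mono)
      qed
      finally show ?thesis
        by (simp add: mult.assoc)
    next
      case False
      then show ?thesis by (simp add: f_def)
    qed
    have "\<bar>(\<integral>\<omega>. f (x + h) (X \<omega>) \<partial>M) - (\<integral>\<omega>. f x (X \<omega>) \<partial>M) - h * (\<integral>\<omega>. ln (X \<omega>) * f x (X \<omega>) \<partial>M)\<bar> =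
        \<bar>\<integral>\<omega>. f (x + h) (X \<omega>) - f x (X \<omega>) - h * (ln (X \<omega>) * f x (X \<omega>)) \<partial>M\<bar>"
      by (simp add: int int2)
    also have "\<dots> \<le> (\<integral>\<omega>. \<bar>f (x + h) (X \<omega>) - f x (X \<omega>) - h * (ln (X \<omega>) * f x (X \<omega>))\<bar> \<partial>M)"
      by (rule integral_abs_bound)
    also have "\<dots> \<le> (\<integral>\<omega>. exp (K * \<bar>x\<bar>) * K\<^sup>2 * h\<^sup>2 \<partial>M)"
      by (intro integral_mono bd) (auto simp: int int2)
    finally show "\<bar>(\<integral>\<omega>. f (x + h) (X \<omega>) \<partial>M) - (\<integral>\<omega>. f x (X \<omega>) \<partial>M) - h * (\<integral>\<omega>. ln (X \<omega>) * f x (X \<omega>) \<partial>M)\<bar>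
        \<le> exp (K * \<bar>x\<bar>) * K\<^sup>2 * h\<^sup>2"
      by (simp add: prob_space)
  qed
  then show ?thesis
    by (simp add: f_def)
qed

section \<open>Supercritical blocks\<close>

text \<open>Absolute values in the eigenvalue equation give the componentwise inequality \<rho> |v|
  \<le> A |v|, which iterates. This admits eigenvectors of arbitrary sign.\<close>

lemma chain_prod_eigenvector_lower:
  fixes A :: "'c::finite \<Rightarrow> 'c \<Rightarrow> real"
  assumes A: "\<And>i j. A i j \<ge> 0" and eig: "\<And>i. (\<Sum>j\<in>UNIV. A i j * v j) = \<rho> * v i" and \<rho>: "\<rho> \<ge> 0"
  shows "\<rho> ^ n * \<bar>v c\<bar> \<le> (\<Sum>w\<in>words n. chain_prod A c w * \<bar>v (colour c w)\<bar>)"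
proof (induction n arbitrary: c)
  case (Suc n)
  have "\<rho> ^ Suc n * \<bar>v c\<bar> = \<rho> ^ n * \<bar>\<Sum>j\<in>UNIV. A c j * v j\<bar>"
    using \<rho> by (simp add: eig abs_mult)
  also have "\<dots> \<le> \<rho> ^ n * (\<Sum>j\<in>UNIV. \<bar>A c j * v j\<bar>)"
    using \<rho> by (intro mult_left_mono sum_abs) auto
  also have "\<dots> = (\<Sum>j\<in>UNIV. A c j * (\<rho> ^ n * \<bar>v j\<bar>))"
    using A by (simp add: sum_distrib_left abs_mult mult_ac)
  also have "\<dots> \<le> (\<Sum>j\<in>UNIV. A c j * (\<Sum>w\<in>words n. chain_prod A j w * \<bar>v (colour j w)\<bar>))"
    using A Suc by (intro sum_mono mult_left_mono) auto
  also have "\<dots> = (\<Sum>w\<in>words (Suc n). chain_prod A c w * \<bar>v (colour c w)\<bar>)"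
    by (simp add: sum_words_Suc sum_distrib_left mult.assoc)
  finally show ?case .
qed simp

text \<open>The diagonal entry \<open>(i, i)\<close> of the \<open>n\<close>-th power of
  \<open>A\<close>.\<close>

definition return_sum :: "('c::finite \<Rightarrow> 'c \<Rightarrow> real) \<Rightarrow> nat \<Rightarrow> 'c \<Rightarrow> real" where
  "return_sum A n i = (\<Sum>w\<in>words n. of_bool (colour i w = i) * chain_prod A i w)"

lemma return_sum_nonneg: "(\<And>i j. A i j \<ge> 0) \<Longrightarrow> return_sum A n i \<ge> 0"
  unfolding return_sum_def by (intro sum_nonneg mult_nonneg_nonneg chain_prod_nonneg) auto

text \<open>Take one step from \<open>i\<close> to \<open>i1\<close>, \<open>n\<close> free steps,
  and one step back to \<open>i\<close>. The connecting steps cost a factor \<open>c\<close> each;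
  since |v| is maximal at \<open>i1\<close>, the free part loses nothing.\<close>

lemma return_sum_lower:
  fixes A :: "'c::finite \<Rightarrow> 'c \<Rightarrow> real"
  assumes A: "\<And>i j. A i j \<ge> c" and c: "c > 0"
    and eig: "\<And>i. (\<Sum>j\<in>UNIV. A i j * v j) = \<rho> * v i" and \<rho>: "\<rho> \<ge> 0"
    and v: "v i1 \<noteq> 0" "\<And>j. \<bar>v j\<bar> \<le> \<bar>v i1\<bar>"
  shows "c\<^sup>2 * \<rho> ^ n \<le> return_sum A (Suc (n + 1)) i"
proof -
  have A0: "A i j \<ge> 0" for i j
    using A[of i j] c by simp
  have "\<rho> ^ n * \<bar>v i1\<bar> \<le> (\<Sum>w\<in>words n. chain_prod A i1 w * \<bar>v (colour i1 w)\<bar>)"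
    using A0 eig \<rho> by (rule chain_prod_eigenvector_lower)
  also have "\<dots> \<le> (\<Sum>w\<in>words n. chain_prod A i1 w) * \<bar>v i1\<bar>"
    unfolding sum_distrib_right by (intro sum_mono mult_left_mono v chain_prod_nonneg A0)
  finally have le: "\<rho> ^ n \<le> (\<Sum>w\<in>words n. chain_prod A i1 w)"
    using v by simp
  have "c\<^sup>2 * \<rho> ^ n \<le> c\<^sup>2 * (\<Sum>w\<in>words n. chain_prod A i1 w)"
    by (intro mult_left_mono le) simp
  also have "\<dots> = (\<Sum>w\<in>words n. c * (chain_prod A i1 w * c))"
    by (simp add: sum_distrib_left power2_eq_square mult_ac)
  also have "\<dots> \<le> (\<Sum>w\<in>words n. A i i1 * (chain_prod A i1 w * A (colour i1 w) i))"
    using c A0 A by (intro sum_mono mult_mono chain_prod_nonneg mult_nonneg_nonneg) auto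
  also have "\<dots> = (\<Sum>w\<in>words n. of_bool (colour i (i1 # w @ [i]) = i) * chain_prod A i (i1 # w @ [i]))"
    by (simp add: chain_prod_append)
  also have "\<dots> \<le> (\<Sum>w\<in>words n. \<Sum>j\<in>UNIV. of_bool (colour i (i1 # w @ [j]) = i) * chain_prod A i (i1 # w @ [j]))"
    by (intro sum_mono member_le_sum mult_nonneg_nonneg chain_prod_nonneg A0) auto
  also have "\<dots> = (\<Sum>w\<in>words (n + 1). of_bool (colour i (i1 # w) = i) * chain_prod A i (i1 # w))"
    unfolding One_nat_def sum_words_add by (simp add: sum_words_Suc del: colour_Cons chain_prod.simps sum_of_bool_mult_eq)
  also have "\<dots> \<le> return_sum A (Suc (n + 1)) i"
    unfolding return_sum_def sum_words_Suc[of _ "n + 1"]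
    by (rule member_le_sum[of i1 UNIV]) (auto intro!: sum_nonneg mult_nonneg_nonneg chain_prod_nonneg A0)
  finally show ?thesis .
qed

text \<open>Colour \<open>i\<close> at the first \<open>k\<close> multiples of \<open>N\<close>. The
  sum over such words factorises (\<open>sum_passes\<close>), which turns matrix products into
  powers of a scalar.\<close>

primrec passes :: "'c \<Rightarrow> nat \<Rightarrow> nat \<Rightarrow> 'c list \<Rightarrow> bool" where
  "passes i N 0 w \<longleftrightarrow> True"
| "passes i N (Suc k) w \<longleftrightarrow> colour i (take N w) = i \<and> passes i N k (drop N w)"

lemma colour_append: "colour i (u @ w) = colour (colour i u) w"
  by (simp add: colour_def)

lemma passes_colour: "w \<in> words (k * N) \<Longrightarrow> passes i N k w \<Longrightarrow> colour i w = i"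
proof (induction k arbitrary: w)
  case (Suc k)
  then have "colour i (drop N w) = i"
    by (intro Suc.IH) (auto simp: words_def)
  then show ?case
    using Suc.prems colour_append[of i "take N w" "drop N w"] by simp
qed auto

lemma sum_passes:
  "(\<Sum>w\<in>words (k * N). of_bool (passes i N k w) * chain_prod A i w) = return_sum A N (i :: 'c::finite) ^ k"
proof (induction k)
  case (Suc k)
  have "(\<Sum>w\<in>words (Suc k * N). of_bool (passes i N (Suc k) w) * chain_prod A i w) =
      (\<Sum>u\<in>words N. \<Sum>w\<in>words (k * N). of_bool (colour i u = i) * chain_prod A i u *
        (of_bool (passes i N k w) * chain_prod A i w))"
    unfolding mult_Suc sum_words_add
    by (intro sum.cong refl) (auto simp: words_def chain_prod_append)
  also have "\<dots> = return_sum A N i ^ Suc k"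
    by (simp add: sum_product[symmetric] Suc.IH return_sum_def)
  finally show ?case .
qed simp

text \<open>A real-valued indicator, ready for sums and expectations. The window factor makes the
  comparison \<open>heavy_le\<close> with truncated weights possible.\<close>

definition heavy :: "real \<Rightarrow> real \<Rightarrow> ('c::finite) list \<Rightarrow> 'c environment \<Rightarrow> real" where
  "heavy \<delta> a w e = of_bool (a \<le> weight (\<lambda>z. z) w e) * weight (window \<delta>) w e"

lemma heavy_01: "heavy \<delta> a w e \<in> {0, 1}"
  using weight_window[of \<delta> w e] by (auto simp: heavy_def)

lemma heavy_bounds: "0 \<le> heavy \<delta> a w e" "heavy \<delta> a w e \<le> 1"
  using heavy_01[of \<delta> a w e] by auto

lemma heavy_cut: "length w \<le> n \<Longrightarrow> heavy \<delta> a w (cut n e) = heavy \<delta> a w e"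
  by (simp add: heavy_def weight_cut)

lemma heavy_le:
  assumes "0 < \<delta>"
  shows "heavy \<delta> a w e * a \<le> weight (trunc \<delta>) w e"
proof -
  have "0 \<le> weight (trunc \<delta>) w e"
    using assms by (intro weight_nonneg trunc_nonneg)
  then show ?thesis
    using weight_window[of \<delta> w e] by (auto simp: heavy_def weight_mult)
qed

lemma measurable_heavy [measurable]: "heavy \<delta> a w \<in> borel_measurable env_space"
proof -
  have [measurable]: "weight (window \<delta>) w \<in> borel_measurable env_space"
    "weight (\<lambda>z. z) w \<in> borel_measurable env_space"
    by (rule measurable_weight, measurable)+
  show ?thesis
    unfolding heavy_def by measurable
qed

section \<open>Truncation and the choice of the block\<close>

lemma powr_le_one_plus:
  fixes z x :: real
  assumes "z > 0" "0 \<le> x" "x \<le> 1"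
  shows "z powr x \<le> 1 + z"
proof (cases "z \<le> 1")
  case True
  then show ?thesis
    using powr_le1[of x z] assms by simp
next
  case False
  then have "z powr x \<le> z powr 1"
    using assms by (intro powr_mono) auto
  then show ?thesis
    using assms by simp
qed

context random_env
begin

lemma integrable_heavy [simp]: "integrable M (\<lambda>\<omega>. heavy \<delta> a w (shift v (env \<omega>)))"
  by (intro integrable_const_bound[of _ 1]) (simp_all add: heavy_bounds abs_of_nonneg)

lemma integrable_truncated_powr:
  assumes "0 < \<delta>" "\<delta> < 1"
  shows "integrable M (\<lambda>\<omega>. ratio (shift [i] (env \<omega>)) j powr x * window \<delta> (ratio (shift [i] (env \<omega>)) j))"
proof (rule integrable_const_bound[of _ "(1 / \<delta>) powr \<bar>x\<bar>"])
  have "z powr x * window \<delta> z \<le> (1 / \<delta>) powr \<bar>x\<bar>" for z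
  proof (cases "z \<in> {\<delta>..1 / \<delta>}")
    case True
    have "z powr x \<le> (1 / \<delta>) powr \<bar>x\<bar>"
    proof (cases "x \<ge> 0")
      case True
      then show ?thesis
        using \<open>z \<in> _\<close> assms by (simp add: powr_mono2)
    next
      case False
      have "1 / z \<le> 1 / \<delta>"
        using True assms by (intro divide_left_mono) auto
      then have "(1 / z) powr (- x) \<le> (1 / \<delta>) powr (- x)"
        using False True assms by (intro powr_mono2) auto
      moreover have "(1 / z) powr (- x) = z powr x"
        using True assms by (simp add: powr_minus powr_divide)
      ultimately show ?thesis
        using False by simp
    qed
    then show ?thesis
      using True by simp
  qed simp
  then show "AE \<omega> in M. norm (ratio (shift [i] (env \<omega>)) j powr x * window \<delta> (ratio (shift [i] (env \<omega>)) j))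
      \<le> (1 / \<delta>) powr \<bar>x\<bar>"
    by simp
qed simp

abbreviation powr_moment :: "real \<Rightarrow> 'c \<Rightarrow> 'c \<Rightarrow> real" where
  "powr_moment x \<equiv> moment (\<lambda>z. z powr x)"

abbreviation trunc_moment :: "real \<Rightarrow> real \<Rightarrow> 'c \<Rightarrow> 'c \<Rightarrow> real" where
  "trunc_moment \<delta> x \<equiv> moment (\<lambda>z. z powr x * window \<delta> z)"

context
  assumes int_ratio: "\<And>i j. integrable M (\<lambda>\<omega>. ratio (shift [i] (env \<omega>)) j)"
begin

lemma integrable_powr_ratio:
  assumes "0 \<le> x" "x \<le> 1"
  shows "integrable M (\<lambda>\<omega>. ratio (shift [i] (env \<omega>)) j powr x)"
proof (rule Bochner_Integration.integrable_bound)
  show "integrable M (\<lambda>\<omega>. 1 + ratio (shift [i] (env \<omega>)) j)"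
    using int_ratio by simp
  show "AE \<omega> in M. norm (ratio (shift [i] (env \<omega>)) j powr x) \<le> norm (1 + ratio (shift [i] (env \<omega>)) j)"
    using pos_ratios_env[of "[i]"]
    by (auto elim!: eventually_mono dest: pos_ratios_pos intro: order_trans[OF powr_le_one_plus[OF _ assms]])
qed simp

text \<open>Since \<open>z powr x \<le> 1 + z\<close>, the loss by truncation has a bound
  \<open>G\<close> free of \<open>x\<close>, and dominated convergence makes its expectation small;
  so one \<delta> serves all exponents. With slack 1/2, sums of at least 2 stay above 1.\<close>

lemma truncation_exists:
  "\<exists>\<delta>. 0 < \<delta> \<and> \<delta> < 1 \<and> (\<forall>x. 0 \<le> x \<longrightarrow> x \<le> 1 \<longrightarrow>
     return_sum (powr_moment x) n i \<le> return_sum (trunc_moment \<delta> x) n i + 1 / 2)"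
proof -
  let ?e = "\<lambda>\<omega>. shift [i] (env \<omega>)"
  define d where "d m = 1 / (real m + 2)" for m :: nat
  have d: "0 < d m" "d m < 1" for m
    by (auto simp: d_def)
  define G where "G m w \<omega> = (1 + weight (\<lambda>z. z) w (?e \<omega>)) * (1 - weight (window (d m)) w (?e \<omega>))" for m w \<omega>
  have int_w: "integrable M (\<lambda>\<omega>. weight (\<lambda>z. z) w (?e \<omega>))" for w
    using expectation_weight[of "\<lambda>z. z" "[i]" w] int_ratio by simp
  have [measurable]: "weight (window \<delta>) w \<in> borel_measurable env_space"
    "weight (\<lambda>z. z) w \<in> borel_measurable env_space" for w :: "'c list" and \<delta>
    by (rule measurable_weight, measurable)+
  have pos: "AE \<omega> in M. pos_ratios (?e \<omega>)"
    by (rule pos_ratios_env) simp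
  have G_bound: "AE \<omega> in M. norm (G m w \<omega>) \<le> 1 + weight (\<lambda>z. z) w (?e \<omega>)" for m w
    using pos
  proof eventually_elim
    fix \<omega> assume "pos_ratios (?e \<omega>)"
    then have "0 < weight (\<lambda>z. z) w (?e \<omega>)"
      by (rule weight_pos)
    then show "norm (G m w \<omega>) \<le> 1 + weight (\<lambda>z. z) w (?e \<omega>)"
      using weight_window[of "d m" w "?e \<omega>"] by (auto simp: G_def)
  qed
  have [measurable]: "G m w \<in> borel_measurable M" for m w
    unfolding G_def by measurable
  have G_int: "integrable M (G m w)" for m w
  proof (rule Bochner_Integration.integrable_bound)
    show "integrable M (\<lambda>\<omega>. 1 + weight (\<lambda>z. z) w (?e \<omega>))"
      using int_w by simp
    show "AE \<omega> in M. norm (G m w \<omega>) \<le> norm (1 + weight (\<lambda>z. z) w (?e \<omega>))"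
      using G_bound[of m w] by eventually_elim auto
  qed simp
  have window_lim: "eventually (\<lambda>m. window (d m) z = 1) sequentially" if "z > 0" for z
  proof -
    obtain m0 :: nat where m0: "1 / z + z < m0"
      using reals_Archimedean2 by blast
    have "window (d m) z = 1" if "m \<ge> m0" for m
    proof -
      have "1 / z < real m + 2" "z < real m + 2"
        using m0 that \<open>z > 0\<close> by (smt (verit) divide_pos_pos of_nat_mono)+
      then show ?thesis
        using \<open>z > 0\<close> by (auto simp: d_def indicator_def field_simps)
    qed
    then show ?thesis
      by (auto simp: eventually_sequentially)
  qed
  have weight_lim: "eventually (\<lambda>m. weight (window (d m)) w e = 1) sequentially" if "pos_ratios e" for w e
    using that
  proof (induction w arbitrary: e)
    case (Cons j w)
    show ?case
      using Cons.IH[OF pos_ratios_shift[OF Cons.prems, of "[j]"]] window_lim[OF pos_ratios_pos[OF Cons.prems, of j]]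
      by eventually_elim simp
  qed simp
  have "(\<lambda>m. expectation (G m w)) \<longlonglongrightarrow> expectation (\<lambda>\<omega>. 0)" for w
  proof (rule integral_dominated_convergence)
    show "integrable M (\<lambda>\<omega>. 1 + weight (\<lambda>z. z) w (?e \<omega>))"
      using int_w by simp
    show "AE \<omega> in M. (\<lambda>m. G m w \<omega>) \<longlonglongrightarrow> 0"
      using pos
    proof eventually_elim
      fix \<omega> assume "pos_ratios (?e \<omega>)"
      from weight_lim[OF this, of w] have "eventually (\<lambda>m. G m w \<omega> = 0) sequentially"
        by eventually_elim (simp add: G_def)
      then show "(\<lambda>m. G m w \<omega>) \<longlonglongrightarrow> 0"
        by (rule tendsto_eventually)
    qed
  qed (use G_bound in auto)
  then have "(\<lambda>m. \<Sum>w\<in>words n. expectation (G m w)) \<longlonglongrightarrow> (\<Sum>w\<in>(words n :: 'c list set). 0)"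
    by (intro tendsto_sum) simp
  then have "eventually (\<lambda>m. (\<Sum>w\<in>words n. expectation (G m w)) < 1 / 2) sequentially"
    by (rule order_tendstoD) simp
  then obtain m where m: "(\<Sum>w\<in>words n. expectation (G m w)) < 1 / 2"
    using eventually_happens'[OF sequentially_bot] by blast
  have "return_sum (powr_moment x) n i \<le> return_sum (trunc_moment (d m) x) n i + 1 / 2" if x: "0 \<le> x" "x \<le> 1" for x
  proof -
    have p: "integrable M (\<lambda>\<omega>. weight (\<lambda>z. z powr x) w (?e \<omega>))"
      "expectation (\<lambda>\<omega>. weight (\<lambda>z. z powr x) w (?e \<omega>)) = chain_prod (powr_moment x) i w" for w
      using expectation_weight[of "\<lambda>z. z powr x" "[i]" w] integrable_powr_ratio[OF x] by simp_all
    have t: "integrable M (\<lambda>\<omega>. weight (\<lambda>z. z powr x * window (d m) z) w (?e \<omega>))"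
      "expectation (\<lambda>\<omega>. weight (\<lambda>z. z powr x * window (d m) z) w (?e \<omega>)) = chain_prod (trunc_moment (d m) x) i w" for w
      using expectation_weight[of "\<lambda>z. z powr x * window (d m) z" "[i]" w] integrable_truncated_powr[OF d] by simp_all
    have "return_sum (powr_moment x) n i - return_sum (trunc_moment (d m) x) n i =
        (\<Sum>w\<in>words n. of_bool (colour i w = i) * (chain_prod (powr_moment x) i w - chain_prod (trunc_moment (d m) x) i w))"
      by (simp add: return_sum_def sum_subtractf right_diff_distrib)
    also have "\<dots> \<le> (\<Sum>w\<in>words n. expectation (G m w))"
    proof (intro sum_mono)
      fix w :: "'c list"
      have "expectation (\<lambda>\<omega>. of_bool (colour i w = i) *
            (weight (\<lambda>z. z powr x) w (?e \<omega>) - weight (\<lambda>z. z powr x * window (d m) z) w (?e \<omega>))) \<le> expectation (G m w)"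
      proof (rule integral_mono_AE)
        show "AE \<omega> in M. of_bool (colour i w = i) *
            (weight (\<lambda>z. z powr x) w (?e \<omega>) - weight (\<lambda>z. z powr x * window (d m) z) w (?e \<omega>)) \<le> G m w \<omega>"
          using pos
        proof eventually_elim
          fix \<omega> assume \<omega>: "pos_ratios (?e \<omega>)"
          have "weight (\<lambda>z. z) w (?e \<omega>) powr x \<le> 1 + weight (\<lambda>z. z) w (?e \<omega>)"
            using weight_pos[OF \<omega>] x by (rule powr_le_one_plus)
          then show "of_bool (colour i w = i) *
            (weight (\<lambda>z. z powr x) w (?e \<omega>) - weight (\<lambda>z. z powr x * window (d m) z) w (?e \<omega>)) \<le> G m w \<omega>"
            using weight_window[of "d m" w "?e \<omega>"] weight_pos[OF \<omega>, of w]
            by (auto simp: G_def weight_mult weight_powr[OF \<omega>])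
        qed
      qed (use p t G_int in auto)
      then show "of_bool (colour i w = i) * (chain_prod (powr_moment x) i w - chain_prod (trunc_moment (d m) x) i w)
          \<le> expectation (G m w)"
        using p t by simp
    qed
    finally show ?thesis
      using m by simp
  qed
  then show ?thesis
    using d by blast
qed

lemma DERIV_return_sum:
  assumes \<delta>: "0 < \<delta>" "\<delta> < 1"
  shows "\<exists>D. ((\<lambda>x. return_sum (trunc_moment \<delta> x) n i) has_real_derivative D) (at x)"
proof -
  have m: "\<exists>D. ((\<lambda>x. trunc_moment \<delta> x i j) has_real_derivative D) (at x)" for i j
    unfolding moment_def
    using DERIV_truncated_moment[OF prob_space_axioms _ \<delta>, of "\<lambda>\<omega>. ratio (shift [i] (env \<omega>)) j" x] by auto
  have c: "(\<lambda>x. chain_prod (trunc_moment \<delta> x) i w) differentiable (at x)" for i w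
  proof (induction w arbitrary: i)
    case (Cons j w)
    have "(\<lambda>x. trunc_moment \<delta> x i j) differentiable (at x)"
      using m real_differentiable_def by blast
    then show ?case
      using Cons[of j] by simp
  qed simp
  have "(\<lambda>x. return_sum (trunc_moment \<delta> x) n i) differentiable (at x)"
    unfolding return_sum_def by (intro differentiable_sum ballI differentiable_mult c) auto
  then show ?thesis
    by (simp add: real_differentiable_def)
qed

text \<open>\<open>chernoff_pointwise\<close> is applied to the weight of each word that passes
  \<open>i\<close> at the multiples of \<open>N\<close>. Summed over these words, the moments become
  powers of \<Lambda>, to which \<open>chernoff_parameters\<close> applies.\<close>

lemma supercritical_block:
  assumes N: "N \<ge> 1"
    and ge2: "\<And>x. 0 \<le> x \<Longrightarrow> x \<le> 1 \<Longrightarrow> return_sum (powr_moment x) N i \<ge> 2"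
  obtains \<delta> a n where "0 < \<delta>" "\<delta> < 1" "0 < a" "a \<le> 1" "n \<ge> 1"
    "1 < a * (\<Sum>w\<in>words n. of_bool (colour i w = i) * expectation (\<lambda>\<omega>. heavy \<delta> a w (shift [i] (env \<omega>))))"
proof -
  let ?e = "\<lambda>\<omega>. shift [i] (env \<omega>)"
  obtain \<delta> where \<delta>: "0 < \<delta>" "\<delta> < 1"
    and tr: "\<And>x. 0 \<le> x \<Longrightarrow> x \<le> 1 \<Longrightarrow> return_sum (powr_moment x) N i \<le> return_sum (trunc_moment \<delta> x) N i + 1 / 2"
    using truncation_exists[of N i] by blast
  define \<Lambda> where "\<Lambda> x = return_sum (trunc_moment \<delta> x) N i" for x
  have "\<forall>x. \<exists>D. (\<Lambda> has_real_derivative D) (at x)"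
    using DERIV_return_sum[OF \<delta>, of N i] unfolding \<Lambda>_def[abs_def] by blast
  from choice[OF this] obtain D where D: "\<And>x. (\<Lambda> has_real_derivative D x) (at x)"
    by blast
  have gt1: "\<Lambda> x > 1" if "0 \<le> x" "x \<le> 1" for x
    using ge2[OF that] tr[OF that] by (simp add: \<Lambda>_def)
  have nonneg: "\<Lambda> x \<ge> 0" for x
    unfolding \<Lambda>_def by (intro return_sum_nonneg moment_nonneg) auto
  obtain k :: nat and x h s t a where k: "k \<ge> 1" and x: "x \<ge> 0" "h > 0" and a: "0 < a" "a \<le> 1" "a \<le> exp s"
    and gt: "\<Lambda> x ^ k - exp (- (h * t)) * \<Lambda> (x + h) ^ k - exp (h * s) * \<Lambda> (x - h) ^ k > exp (t * x) / a"
    using chernoff_parameters[OF D gt1 nonneg] .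
  define n where "n = k * N"
  let ?\<phi> = "\<lambda>x z. z powr x * window \<delta> z"
  have w: "integrable M (\<lambda>\<omega>. weight (?\<phi> x) w (?e \<omega>))"
    "expectation (\<lambda>\<omega>. weight (?\<phi> x) w (?e \<omega>)) = chain_prod (trunc_moment \<delta> x) i w" for w x
    using expectation_weight[of "?\<phi> x" "[i]" w] integrable_truncated_powr[OF \<delta>] by simp_all
  have le: "chain_prod (trunc_moment \<delta> x) i w - exp (- (h * t)) * chain_prod (trunc_moment \<delta> (x + h)) i w
      - exp (h * s) * chain_prod (trunc_moment \<delta> (x - h)) i w
      \<le> exp (t * x) * expectation (\<lambda>\<omega>. heavy \<delta> a w (?e \<omega>))" for w
  proof -
    have "expectation (\<lambda>\<omega>. weight (?\<phi> x) w (?e \<omega>) - exp (- (h * t)) * weight (?\<phi> (x + h)) w (?e \<omega>)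
        - exp (h * s) * weight (?\<phi> (x - h)) w (?e \<omega>)) \<le> expectation (\<lambda>\<omega>. exp (t * x) * heavy \<delta> a w (?e \<omega>))"
    proof (rule integral_mono_AE)
      have "AE \<omega> in M. pos_ratios (?e \<omega>)"
        by (rule pos_ratios_env) simp
      then show "AE \<omega> in M. weight (?\<phi> x) w (?e \<omega>) - exp (- (h * t)) * weight (?\<phi> (x + h)) w (?e \<omega>)
          - exp (h * s) * weight (?\<phi> (x - h)) w (?e \<omega>) \<le> exp (t * x) * heavy \<delta> a w (?e \<omega>)"
      proof eventually_elim
        fix \<omega> assume \<omega>: "pos_ratios (?e \<omega>)"
        let ?z = "weight (\<lambda>z. z) w (?e \<omega>)" and ?I = "weight (window \<delta>) w (?e \<omega>)"
        have "(?z powr x - exp (- (h * t)) * ?z powr (x + h) - exp (h * s) * ?z powr (x - h)) * ?I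
            \<le> exp (t * x) * of_bool (exp s \<le> ?z) * ?I"
          using weight_window[of \<delta> w "?e \<omega>"]
          by (intro mult_right_mono chernoff_pointwise weight_pos \<omega> x) auto
        also have "\<dots> \<le> exp (t * x) * of_bool (a \<le> ?z) * ?I"
          using a weight_window[of \<delta> w "?e \<omega>"] by (intro mult_right_mono mult_left_mono) auto
        finally show "weight (?\<phi> x) w (?e \<omega>) - exp (- (h * t)) * weight (?\<phi> (x + h)) w (?e \<omega>)
          - exp (h * s) * weight (?\<phi> (x - h)) w (?e \<omega>) \<le> exp (t * x) * heavy \<delta> a w (?e \<omega>)"
          by (simp add: weight_mult weight_powr[OF \<omega>] heavy_def algebra_simps)
      qed
    qed (use w in auto)
    then show ?thesis
      using w by simp
  qed
  have "exp (t * x) / a < (\<Sum>w\<in>words n. of_bool (passes i N k w) * chain_prod (trunc_moment \<delta> x) i w)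
      - exp (- (h * t)) * (\<Sum>w\<in>words n. of_bool (passes i N k w) * chain_prod (trunc_moment \<delta> (x + h)) i w)
      - exp (h * s) * (\<Sum>w\<in>words n. of_bool (passes i N k w) * chain_prod (trunc_moment \<delta> (x - h)) i w)"
    using gt unfolding n_def sum_passes \<Lambda>_def .
  also have "\<dots> = (\<Sum>w\<in>words n. of_bool (passes i N k w) * (chain_prod (trunc_moment \<delta> x) i w
      - exp (- (h * t)) * chain_prod (trunc_moment \<delta> (x + h)) i w
      - exp (h * s) * chain_prod (trunc_moment \<delta> (x - h)) i w))"
    by (simp add: sum_subtractf sum_distrib_left right_diff_distrib mult.left_commute
        del: sum_of_bool_mult_eq)
  also have "\<dots> \<le> (\<Sum>w\<in>words n. of_bool (passes i N k w) * (exp (t * x) * expectation (\<lambda>\<omega>. heavy \<delta> a w (?e \<omega>))))"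
    by (intro sum_mono mult_left_mono le) auto
  \<comment> \<open>Passing words end in colour \<open>i\<close>; from here on only the end colour
    is recorded, as it determines the law of the subtree.\<close>
  also have "\<dots> \<le> (\<Sum>w\<in>words n. of_bool (colour i w = i) * (exp (t * x) * expectation (\<lambda>\<omega>. heavy \<delta> a w (?e \<omega>))))"
    using passes_colour unfolding n_def
    by (intro sum_mono mult_right_mono mult_nonneg_nonneg Bochner_Integration.integral_nonneg heavy_bounds) (auto simp: of_bool_def)
  also have "\<dots> = exp (t * x) * (\<Sum>w\<in>words n. of_bool (colour i w = i) * expectation (\<lambda>\<omega>. heavy \<delta> a w (?e \<omega>)))"
    by (simp add: sum_distrib_left mult.left_commute del: sum_of_bool_mult_eq)
  finally have "1 < a * (\<Sum>w\<in>words n. of_bool (colour i w = i) * expectation (\<lambda>\<omega>. heavy \<delta> a w (?e \<omega>)))"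
    using a by (simp add: field_simps)
  moreover have "n \<ge> 1"
    using k N by (simp add: n_def)
  ultimately show thesis
    using \<delta> a by (intro that) auto
qed

end

end

section \<open>The embedded branching process\<close>

text \<open>Where \<open>X\<close> is at least half its mean \<open>b\<close>, use
  \<open>X \<le> c / 2 * X\<^sup>2 + 1 / (2 * c)\<close>; elsewhere \<open>X \<le> b / 2\<close>.
  Then integrate.\<close>

lemma (in prob_space) Paley_Zygmund_half:
  fixes X :: "'a \<Rightarrow> real"
  assumes [measurable]: "X \<in> borel_measurable M" and "integrable M X" "integrable M (\<lambda>\<omega>. (X \<omega>)\<^sup>2)"
    and pos: "expectation X > 0" and le: "expectation (\<lambda>\<omega>. (X \<omega>)\<^sup>2) \<le> T" and "T > 0"
  shows "(expectation X)\<^sup>2 / (4 * T) \<le> prob {\<omega> \<in> space M. expectation X / 2 \<le> X \<omega>}"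
proof -
  define b where "b = expectation X"
  define A where "A = {\<omega> \<in> space M. b / 2 \<le> X \<omega>}"
  \<comment> \<open>With this choice the second moment takes at most \<open>b / 4\<close>, which
    leaves \<open>b / 4\<close> for the event \<open>A\<close>.\<close>
  define c where "c = b / (2 * T)"
  have A [measurable]: "A \<in> events"
    unfolding A_def by measurable
  have c: "c > 0"
    using pos \<open>T > 0\<close> by (simp add: c_def b_def)
  have "b \<le> expectation (\<lambda>\<omega>. b / 2 + (c / 2 * (X \<omega>)\<^sup>2 + 1 / (2 * c) * indicator A \<omega>))"
  proof -
    have "X \<omega> \<le> b / 2 + (c / 2 * (X \<omega>)\<^sup>2 + 1 / (2 * c) * indicator A \<omega>)" if "\<omega> \<in> space M" for \<omega>
    proof (cases "\<omega> \<in> A")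
      case True
      have "0 \<le> (c * X \<omega> - 1)\<^sup>2 / (2 * c)"
        using c by simp
      also have "\<dots> = c / 2 * (X \<omega>)\<^sup>2 + 1 / (2 * c) - X \<omega>"
        using c by (simp add: power2_eq_square field_simps)
      finally show ?thesis
        using True pos by (simp add: b_def)
    next
      case False
      then have "X \<omega> \<le> b / 2"
        using that by (simp add: A_def)
      moreover have "0 \<le> c / 2 * (X \<omega>)\<^sup>2"
        using c by simp
      ultimately show ?thesis
        using False by simp
    qed
    then show ?thesis
      using assms by (subst (1) b_def, intro integral_mono) (auto simp: integrable_real_indicator emeasure_eq_measure)
  qed
  also have "\<dots> = b / 2 + (c / 2 * expectation (\<lambda>\<omega>. (X \<omega>)\<^sup>2) + 1 / (2 * c) * prob A)"
    using assms by (simp add: prob_space emeasure_eq_measure)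
  also have "\<dots> \<le> b / 2 + (c / 2 * T + 1 / (2 * c) * prob A)"
    using le c by (intro add_mono mult_left_mono) auto
  finally have "b \<le> b / 2 + (c / 2 * T + 1 / (2 * c) * prob A)" .
  moreover have "c / 2 * T = b / 4" "1 / (2 * c) * prob A = T * prob A / b"
    using \<open>T > 0\<close> by (simp_all add: c_def)
  ultimately have "b / 4 \<le> T * prob A / b"
    by linarith
  then have "b * b / 4 \<le> T * prob A"
    using pos by (simp add: b_def[symmetric] pos_le_divide_eq)
  then show ?thesis
    unfolding b_def[symmetric] A_def[symmetric]
    using \<open>T > 0\<close> by (simp add: pos_divide_le_eq power2_eq_square mult_ac)
qed

text \<open>With \<open>F = 1\<close> this counts the children of the root in the embedded branching process.\<close>

definition spread :: "real \<Rightarrow> real \<Rightarrow> nat \<Rightarrow> 'c \<Rightarrow> ('c environment \<Rightarrow> real) \<Rightarrow> ('c::finite) environment \<Rightarrow> real" where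
  "spread \<delta> a n i F e = (\<Sum>w\<in>{w \<in> words n. colour i w = i}. heavy \<delta> a w e * F (shift w e))"

lemma spread_nonneg: "(\<And>e. 0 \<le> F e) \<Longrightarrow> 0 \<le> spread \<delta> a n i F e"
  unfolding spread_def by (intro sum_nonneg mult_nonneg_nonneg heavy_bounds) auto

lemma spread_mono: "(\<And>e. F e \<le> G e) \<Longrightarrow> spread \<delta> a n i F e \<le> spread \<delta> a n i G e"
  unfolding spread_def by (intro sum_mono mult_left_mono heavy_bounds) auto

lemma spread_le:
  fixes F :: "('c::finite) environment \<Rightarrow> real" and B :: real
  assumes "\<And>e. 0 \<le> F e" "\<And>e. F e \<le> B"
  shows "spread \<delta> a n i F e \<le> real (CARD('c)) ^ n * B"
proof -
  have "0 \<le> B"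
    using assms order_trans by blast
  have "spread \<delta> a n i F e \<le> (\<Sum>w\<in>{w \<in> words n. colour i w = i}. 1 * B)"
    unfolding spread_def using assms by (intro sum_mono mult_mono heavy_bounds) auto
  also have "\<dots> \<le> (\<Sum>w\<in>(words n :: 'c list set). 1 * B)"
    using \<open>0 \<le> B\<close> by (intro sum_mono2) auto
  finally show ?thesis
    by (simp add: card_words)
qed

lemma measurable_spread:
  assumes [measurable]: "F \<in> borel_measurable env_space"
  shows "spread \<delta> a n i F \<in> borel_measurable env_space"
  unfolding spread_def by measurable

lemma spread_power_nonneg: "(\<And>e. 0 \<le> F e) \<Longrightarrow> 0 \<le> (spread \<delta> a n i ^^ k) F e"
  by (induction k arbitrary: e) (auto intro: spread_nonneg)

lemma spread_power_mono: "(\<And>e. F e \<le> G e) \<Longrightarrow> (spread \<delta> a n i ^^ k) F e \<le> (spread \<delta> a n i ^^ k) G e"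
  by (induction k arbitrary: e) (auto intro: spread_mono)

lemma measurable_spread_power:
  "F \<in> borel_measurable env_space \<Longrightarrow> (spread \<delta> a n i ^^ k) F \<in> borel_measurable env_space"
  by (induction k) (auto intro: measurable_spread)

lemma spread_power_bounded:
  fixes F :: "('c::finite) environment \<Rightarrow> real"
  assumes "\<And>e. 0 \<le> F e" "\<And>e. F e \<le> 1"
  shows "\<exists>B. \<forall>e. (spread \<delta> a n i ^^ k) F e \<le> B"
proof (induction k)
  case 0
  then show ?case using assms by auto
next
  case (Suc k)
  then obtain B where "\<And>e. (spread \<delta> a n i ^^ k) F e \<le> B"
    by blast
  then have "(spread \<delta> a n i ^^ Suc k) F e \<le> real (CARD('c)) ^ n * B" for e
    using spread_power_nonneg[of F, OF assms(1)] by (simp add: spread_le[of "(spread \<delta> a n i ^^ k) F" B])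
  then show ?case by blast
qed

text \<open>The counted descendants are reached through \<open>k\<close> blocks of weight at least
  \<open>a\<close> each, with all ratios in the window.\<close>

lemma spread_power_le_trunc_sum:
  assumes \<delta>: "0 < \<delta>" and a: "0 \<le> a" and F: "\<And>e. 0 \<le> F e"
  shows "a ^ k * (spread \<delta> a n i ^^ k) F e \<le> trunc_sum \<delta> (k * n) F e"
proof (induction k arbitrary: e)
  case (Suc k)
  let ?S = "(spread \<delta> a n i ^^ k) F"
  have "a ^ Suc k * (spread \<delta> a n i ^^ Suc k) F e =
      (\<Sum>w\<in>{w \<in> words n. colour i w = i}. (heavy \<delta> a w e * a) * (a ^ k * ?S (shift w e)))"
    by (simp add: spread_def sum_distrib_left mult_ac)
  also have "\<dots> \<le> (\<Sum>w\<in>{w \<in> words n. colour i w = i}. weight (trunc \<delta>) w e * trunc_sum \<delta> (k * n) F (shift w e))"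
    using \<delta> a F
    by (intro sum_mono mult_mono heavy_le Suc.IH weight_nonneg trunc_nonneg mult_nonneg_nonneg
        spread_power_nonneg) auto
  also have "\<dots> \<le> (\<Sum>w\<in>words n. weight (trunc \<delta>) w e * trunc_sum \<delta> (k * n) F (shift w e))"
    using \<delta> F by (intro sum_mono2 mult_nonneg_nonneg weight_nonneg trunc_nonneg trunc_sum_nonneg) auto
  also have "\<dots> = trunc_sum \<delta> (Suc k * n) F e"
    by (simp add: trunc_sum_add trunc_sum_def[of _ n])
  finally show ?case .
qed simp

text \<open>Finite orders of the recurring property in the overview, so that measurability and
  probability bounds are inductions. The bound 2 is what \<open>esc_ge_of_good\<close> and
  \<open>weight_sum_ge_of_good\<close> require.\<close>

primrec good :: "real \<Rightarrow> real \<Rightarrow> nat \<Rightarrow> 'c \<Rightarrow> nat \<Rightarrow> nat \<Rightarrow> ('c::finite) environment \<Rightarrow> bool" where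
  "good \<delta> a n i k 0 = (\<lambda>e. True)"
| "good \<delta> a n i k (Suc l) = (\<lambda>e. 2 \<le> a ^ k * (spread \<delta> a n i ^^ k) (\<lambda>e. of_bool (good \<delta> a n i k l e)) e)"

lemma good_Suc_trunc_sum:
  assumes "0 < \<delta>" "0 \<le> a" "good \<delta> a n i k (Suc l) e"
  shows "2 \<le> trunc_sum \<delta> (k * n) (\<lambda>e. of_bool (good \<delta> a n i k l e)) e"
  using assms spread_power_le_trunc_sum[of \<delta> a "\<lambda>e. of_bool (good \<delta> a n i k l e)" k n i e] by simp

lemma good_Suc_imp:
  assumes "0 \<le> a"
  shows "good \<delta> a n i k (Suc l) e \<Longrightarrow> good \<delta> a n i k l e"
proof (induction l arbitrary: e)
  case (Suc l)
  have "(spread \<delta> a n i ^^ k) (\<lambda>e. of_bool (good \<delta> a n i k (Suc l) e)) e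
      \<le> (spread \<delta> a n i ^^ k) (\<lambda>e. of_bool (good \<delta> a n i k l e)) e"
    using Suc.IH by (intro spread_power_mono) (auto simp: of_bool_def)
  then have "a ^ k * (spread \<delta> a n i ^^ k) (\<lambda>e. of_bool (good \<delta> a n i k (Suc l) e)) e
      \<le> a ^ k * (spread \<delta> a n i ^^ k) (\<lambda>e. of_bool (good \<delta> a n i k l e)) e"
    using assms by (intro mult_left_mono) auto
  then show ?case
    using Suc.prems by simp
qed simp

lemma measurable_good [measurable]: "Measurable.pred env_space (good \<delta> a n i k l)"
proof (induction l)
  case (Suc l)
  have "(\<lambda>e. of_bool (good \<delta> a n i k l e) :: real) \<in> borel_measurable env_space"
    using Suc by measurable
  from measurable_spread_power[OF this] show ?case
    by simp
qed simp

section \<open>Moments and survival of the embedded process\<close>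

context random_env
begin

context
  fixes \<delta> a :: real and n :: nat and i :: 'c and m \<kappa> q :: real
  assumes m_def: "m = (\<Sum>w\<in>words n. of_bool (colour i w = i) * expectation (\<lambda>\<omega>. heavy \<delta> a w (shift [i] (env \<omega>))))"
    and a: "0 < a" "a \<le> 1" and am: "1 < a * m" and \<delta>: "0 < \<delta>" "\<delta> < 1"
    and \<kappa>_def: "\<kappa> = (real (CARD('c)) ^ n)\<^sup>2 / (m * (m - 1))" and q_def: "q = 1 / (4 * (\<kappa> + 1))"
begin

abbreviation E\<^sub>i :: "('c environment \<Rightarrow> real) \<Rightarrow> real" where
  "E\<^sub>i F \<equiv> expectation (\<lambda>\<omega>. F (shift [i] (env \<omega>)))"

lemma m_gt_1: "m > 1"
proof (rule ccontr)
  assume "\<not> m > 1"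
  then have "a * m \<le> a * 1"
    using a by (intro mult_left_mono) auto
  then show False
    using a am by linarith
qed

lemma m_eq: "m = (\<Sum>w\<in>{w \<in> words n. colour i w = i}. E\<^sub>i (heavy \<delta> a w))"
  unfolding m_def by (subst sum.inter_filter) (auto intro!: sum.cong simp del: sum_of_bool_mult_eq)

lemma last_Cons_colour: "last (i # w) = colour i w"
  by (simp add: colour_def)

text \<open>Expand the square. Distinct words lead to independent subtrees, but their
  \<open>heavy\<close> indicators share the first \<open>n\<close> generations, so the product of
  these is bounded by 1. Equal words give the term with factor \<open>m\<close>, because
  \<open>heavy\<close> is 0 or 1.\<close>

lemma expectation_spread:
  assumes F [measurable]: "F \<in> borel_measurable env_space"
    and F0: "\<And>e. 0 \<le> F e" and B: "\<And>e. F e \<le> B"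
  shows "E\<^sub>i (spread \<delta> a n i F) = m * E\<^sub>i F"
    and "E\<^sub>i (\<lambda>e. (spread \<delta> a n i F e)\<^sup>2) \<le> m * E\<^sub>i (\<lambda>e. (F e)\<^sup>2) + (CARD('c) ^ n)\<^sup>2 * (E\<^sub>i F)\<^sup>2"
proof -
  let ?W = "{w \<in> words n. colour i w = i}"
  have int: "integrable M (\<lambda>\<omega>. G (shift v (env \<omega>)))"
    if [measurable]: "G \<in> borel_measurable env_space" and "\<And>e. \<bar>G e\<bar> \<le> C" for G and C :: real and v
    using that(2) by (intro integrable_const_bound[of _ C]) auto
  have F2: "\<bar>F e\<bar> \<le> B" "\<bar>(F e)\<^sup>2\<bar> \<le> B\<^sup>2" for e
    using F0[of e] B[of e] by (auto intro!: power_mono)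
  have E_shift: "expectation (\<lambda>\<omega>. G (shift (i # w) (env \<omega>))) = E\<^sub>i G"
    if "G \<in> borel_measurable env_space" "w \<in> ?W" for G w
    using that by (intro expectation_shift) (auto simp: last_Cons_colour simp del: last.simps)
  have one: "integrable M (\<lambda>\<omega>. heavy \<delta> a w (shift [i] (env \<omega>)) * G (shift (i # w) (env \<omega>))) \<and>
      expectation (\<lambda>\<omega>. heavy \<delta> a w (shift [i] (env \<omega>)) * G (shift (i # w) (env \<omega>))) = E\<^sub>i (heavy \<delta> a w) * E\<^sub>i G"
    if G [measurable]: "G \<in> borel_measurable env_space" and C: "\<And>e. \<bar>G e\<bar> \<le> C" and w: "w \<in> ?W" for G and C :: real and w
    using expectation_blocks[of "heavy \<delta> a w" "\<lambda>_. G" "{w}" n "[i]"] w int[OF G C] E_shift[OF G w]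
    by (simp add: heavy_cut words_def)
  have eq: "spread \<delta> a n i F (shift [i] (env \<omega>)) =
      (\<Sum>w\<in>?W. heavy \<delta> a w (shift [i] (env \<omega>)) * F (shift (i # w) (env \<omega>)))" for \<omega>
    by (simp add: spread_def)
  show "E\<^sub>i (spread \<delta> a n i F) = m * E\<^sub>i F"
    unfolding eq m_eq sum_distrib_right using one[OF F F2(1)] by simp
  \<comment> \<open>The summand \<open>(E\<^sub>i F)\<^sup>2\<close> is granted to equal words too,
    so that the double sum contains the plain square of the number of words.\<close>
  have two: "integrable M (\<lambda>\<omega>. (heavy \<delta> a w (shift [i] (env \<omega>)) * F (shift (i # w) (env \<omega>))) *
        (heavy \<delta> a w' (shift [i] (env \<omega>)) * F (shift (i # w') (env \<omega>)))) \<and>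
      expectation (\<lambda>\<omega>. (heavy \<delta> a w (shift [i] (env \<omega>)) * F (shift (i # w) (env \<omega>))) *
        (heavy \<delta> a w' (shift [i] (env \<omega>)) * F (shift (i # w') (env \<omega>))))
      \<le> (if w = w' then E\<^sub>i (heavy \<delta> a w) * E\<^sub>i (\<lambda>e. (F e)\<^sup>2) else 0) + (E\<^sub>i F)\<^sup>2"
    if w: "w \<in> ?W" "w' \<in> ?W" for w w'
  proof (cases "w = w'")
    case True
    have sq: "heavy \<delta> a w e * x * (heavy \<delta> a w e * x) = heavy \<delta> a w e * x\<^sup>2" for x e
      using heavy_01[of \<delta> a w e] by (auto simp: power2_eq_square)
    have "integrable M (\<lambda>\<omega>. heavy \<delta> a w (shift [i] (env \<omega>)) * (F (shift (i # w) (env \<omega>)))\<^sup>2) \<and>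
      expectation (\<lambda>\<omega>. heavy \<delta> a w (shift [i] (env \<omega>)) * (F (shift (i # w) (env \<omega>)))\<^sup>2) =
      E\<^sub>i (heavy \<delta> a w) * E\<^sub>i (\<lambda>e. (F e)\<^sup>2)"
      using w F2(2) by (intro one) auto
    then show ?thesis
      unfolding True[symmetric] sq by simp
  next
    case False
    have h01: "0 \<le> heavy \<delta> a w e * heavy \<delta> a w' e" "heavy \<delta> a w e * heavy \<delta> a w' e \<le> 1" for e
      using heavy_01[of \<delta> a w e] heavy_01[of \<delta> a w' e] by auto
    have hint: "integrable M (\<lambda>\<omega>. heavy \<delta> a w (shift [i] (env \<omega>)) * heavy \<delta> a w' (shift [i] (env \<omega>)))"
      using h01 by (intro integrable_const_bound[of _ 1]) auto
    have prod: "(\<Prod>u\<in>{w, w'}. g u) = g w * g w'" for g :: "'c list \<Rightarrow> real"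
      using False by simp
    have *: "heavy \<delta> a w e * F x * (heavy \<delta> a w' e * F y) = (heavy \<delta> a w e * heavy \<delta> a w' e) * (F x * F y)" for e x y
      by simp
    have E2: "expectation (\<lambda>\<omega>. F (shift (i # w) (env \<omega>))) = E\<^sub>i F" "expectation (\<lambda>\<omega>. F (shift (i # w') (env \<omega>))) = E\<^sub>i F"
      using E_shift[OF F] w by auto
    have le1: "expectation (\<lambda>\<omega>. heavy \<delta> a w (shift [i] (env \<omega>)) * heavy \<delta> a w' (shift [i] (env \<omega>))) \<le> 1"
      using h01 hint by (intro integral_le_const) auto
    have "expectation (\<lambda>\<omega>. heavy \<delta> a w (shift [i] (env \<omega>)) * heavy \<delta> a w' (shift [i] (env \<omega>))) * (E\<^sub>i F * E\<^sub>i F) \<le> 1 * (E\<^sub>i F * E\<^sub>i F)"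
      by (intro mult_right_mono le1) simp
    then show ?thesis
      unfolding *
      using expectation_blocks[of "\<lambda>e. heavy \<delta> a w e * heavy \<delta> a w' e" "\<lambda>_. F" "{w, w'}" n "[i]", unfolded prod]
        w int[OF F F2(1)] hint E2 False
      by (simp add: heavy_cut words_def power2_eq_square)
  qed
  have "E\<^sub>i (\<lambda>e. (spread \<delta> a n i F e)\<^sup>2) =
      (\<Sum>w\<in>?W. \<Sum>w'\<in>?W. expectation (\<lambda>\<omega>. (heavy \<delta> a w (shift [i] (env \<omega>)) * F (shift (i # w) (env \<omega>))) *
        (heavy \<delta> a w' (shift [i] (env \<omega>)) * F (shift (i # w') (env \<omega>)))))"
  proof -
    have "E\<^sub>i (\<lambda>e. (spread \<delta> a n i F e)\<^sup>2) =
        (\<Sum>w\<in>?W. expectation (\<lambda>\<omega>. \<Sum>w'\<in>?W. (heavy \<delta> a w (shift [i] (env \<omega>)) * F (shift (i # w) (env \<omega>))) *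
          (heavy \<delta> a w' (shift [i] (env \<omega>)) * F (shift (i # w') (env \<omega>)))))"
      unfolding eq power2_eq_square sum_product
      by (rule Bochner_Integration.integral_sum, rule Bochner_Integration.integrable_sum, rule two[THEN conjunct1])
    then show ?thesis
      by (simp only:) (intro sum.cong refl Bochner_Integration.integral_sum two[THEN conjunct1])
  qed
  also have "\<dots> \<le> (\<Sum>w\<in>?W. \<Sum>w'\<in>?W. (if w = w' then E\<^sub>i (heavy \<delta> a w) * E\<^sub>i (\<lambda>e. (F e)\<^sup>2) else 0) + (E\<^sub>i F)\<^sup>2)"
    using two by (intro sum_mono) auto
  also have "\<dots> = m * E\<^sub>i (\<lambda>e. (F e)\<^sup>2) + (card ?W)\<^sup>2 * (E\<^sub>i F)\<^sup>2"
    unfolding m_eq by (simp add: sum.distrib sum_distrib_right power2_eq_square)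
  also have "\<dots> \<le> m * E\<^sub>i (\<lambda>e. (F e)\<^sup>2) + (CARD('c) ^ n)\<^sup>2 * (E\<^sub>i F)\<^sup>2"
  proof -
    have "card ?W \<le> CARD('c) ^ n"
      unfolding card_words[symmetric] by (intro card_mono) auto
    then have "real (card ?W) \<le> real (CARD('c) ^ n)"
      by (rule of_nat_mono)
    then show ?thesis
      by (intro add_left_mono mult_right_mono power_mono) auto
  qed
  finally show "E\<^sub>i (\<lambda>e. (spread \<delta> a n i F e)\<^sup>2) \<le> m * E\<^sub>i (\<lambda>e. (F e)\<^sup>2) + (CARD('c) ^ n)\<^sup>2 * (E\<^sub>i F)\<^sup>2"
    by simp
qed

lemma kappa_nonneg: "\<kappa> \<ge> 0"
  using m_gt_1 by (simp add: \<kappa>_def)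

text \<open>\<kappa> solves \<open>\<kappa> * m\<^sup>2 = \<kappa> * m + D\<close>, where
  \<open>D\<close> is the squared number of words of length \<open>n\<close>; so the bound
  reproduces itself with each generation. The linear term starts the induction, as
  \<open>F\<^sup>2 = F\<close>.\<close>

lemma expectation_spread_power:
  assumes F [measurable]: "F \<in> borel_measurable env_space" and F01: "\<And>e. F e \<in> {0, 1}"
  shows "E\<^sub>i ((spread \<delta> a n i ^^ k) F) = m ^ k * E\<^sub>i F \<and>
    E\<^sub>i (\<lambda>e. ((spread \<delta> a n i ^^ k) F e)\<^sup>2) \<le> \<kappa> * (m ^ k * E\<^sub>i F)\<^sup>2 + m ^ k * E\<^sub>i F"
proof (induction k)
  case 0
  have "(F e)\<^sup>2 = F e" for e
    using F01[of e] by auto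
  then show ?case
    using kappa_nonneg by simp
next
  case (Suc k)
  let ?S = "(spread \<delta> a n i ^^ k) F"
  have F0: "0 \<le> F e" "F e \<le> 1" for e
    using F01[of e] by auto
  obtain B where B: "\<And>e. ?S e \<le> B"
    using spread_power_bounded[where F = F and \<delta> = \<delta> and a = a and n = n and i = i and k = k] F0 by blast
  note S = expectation_spread[OF measurable_spread_power[OF F] spread_power_nonneg[OF F0(1)] B]
  define D where "D = (real (CARD('c)) ^ n)\<^sup>2"
  define b where "b = m ^ k * E\<^sub>i F"
  have D: "D = \<kappa> * (m * (m - 1))"
    using m_gt_1 by (simp add: \<kappa>_def D_def)
  have "E\<^sub>i (\<lambda>e. (spread \<delta> a n i ?S e)\<^sup>2) \<le> m * E\<^sub>i (\<lambda>e. (?S e)\<^sup>2) + D * b\<^sup>2"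
    using S(2) Suc.IH by (simp add: D_def b_def)
  also have "\<dots> \<le> m * (\<kappa> * b\<^sup>2 + b) + D * b\<^sup>2"
    using Suc.IH m_gt_1 by (intro add_right_mono mult_left_mono) (auto simp: b_def)
  also have "\<dots> = \<kappa> * (m * b)\<^sup>2 + m * b"
    by (simp add: D power2_eq_square algebra_simps)
  finally show ?case
    using S(1) Suc.IH by (simp add: b_def mult.assoc)
qed

lemma q: "0 < q" "q \<le> 1"
  using kappa_nonneg by (simp_all add: q_def divide_le_eq)

text \<open>If order \<open>l\<close> has probability \<open>g \<ge> q\<close>, the mean
  \<open>m ^ k * g\<close> is at least 1, so the second moment is at most
  \<open>\<kappa> + 1\<close> times its square and Paley-Zygmund returns the same \<open>q\<close>.
  The choice of \<open>k\<close> gives \<open>(a * m) ^ k * g / 2 \<ge> 2\<close>, so half the mean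
  reaches the threshold.\<close>

lemma prob_good:
  assumes k: "(a * m) ^ k \<ge> 4 / q"
  shows "E\<^sub>i (\<lambda>e. of_bool (good \<delta> a n i k l e)) \<ge> q"
proof (induction l)
  case 0
  then show ?case
    using q by (simp add: prob_space)
next
  case (Suc l)
  define F where "F e = (of_bool (good \<delta> a n i k l e) :: real)" for e
  define S where "S = (spread \<delta> a n i ^^ k) F"
  define g where "g = E\<^sub>i F"
  have F [measurable]: "F \<in> borel_measurable env_space"
    unfolding F_def by measurable
  have F01: "F e \<in> {0, 1}" "0 \<le> F e" "F e \<le> 1" for e
    by (auto simp: F_def)
  have gq: "g \<ge> q" "g > 0"
    using Suc q by (auto simp: g_def F_def)
  have S [measurable]: "S \<in> borel_measurable env_space"
    unfolding S_def using F by (rule measurable_spread_power)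
  obtain B where B: "\<And>e. S e \<le> B"
    using spread_power_bounded[where F = F and \<delta> = \<delta> and a = a and n = n and i = i and k = k] F01 unfolding S_def by blast
  have S0: "0 \<le> S e" for e
    unfolding S_def using F01 by (intro spread_power_nonneg)
  have ES: "E\<^sub>i S = m ^ k * g" "E\<^sub>i (\<lambda>e. (S e)\<^sup>2) \<le> \<kappa> * (m ^ k * g)\<^sup>2 + m ^ k * g"
    using expectation_spread_power[OF F F01(1), of k] by (auto simp: S_def g_def)
  have mg: "1 \<le> m ^ k * g"
  proof -
    have "1 \<le> 4 / q * q" using q by simp
    also have "\<dots> \<le> (a * m) ^ k * g"
      using k gq q am by (intro mult_mono) auto
    also have "\<dots> \<le> m ^ k * g"
      using a m_gt_1 gq by (intro mult_right_mono power_mono) (auto simp: mult_le_cancel_right1)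
    finally show ?thesis .
  qed
  have "\<kappa> * (m ^ k * g)\<^sup>2 + m ^ k * g \<le> (\<kappa> + 1) * (m ^ k * g)\<^sup>2"
    using mg self_le_power[of "m ^ k * g" 2] by (simp add: algebra_simps)
  with ES(2) have ES2: "E\<^sub>i (\<lambda>e. (S e)\<^sup>2) \<le> (\<kappa> + 1) * (m ^ k * g)\<^sup>2"
    by simp
  have "1 / (4 * C) = x\<^sup>2 / (4 * (C * x\<^sup>2))" if "x \<ge> 1" for x C :: real
    using that by simp
  from this[OF mg] have "q = (m ^ k * g)\<^sup>2 / (4 * ((\<kappa> + 1) * (m ^ k * g)\<^sup>2))"
    unfolding q_def .
  also have "\<dots> \<le> prob {\<omega> \<in> space M. m ^ k * g / 2 \<le> S (shift [i] (env \<omega>))}"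
  proof -
    have "integrable M (\<lambda>\<omega>. S (shift [i] (env \<omega>)))"
      using S0 B by (intro integrable_const_bound[of _ B]) auto
    moreover have "integrable M (\<lambda>\<omega>. (S (shift [i] (env \<omega>)))\<^sup>2)"
      using S0 B by (intro integrable_const_bound[of _ "B\<^sup>2"]) (auto intro!: power_mono)
    moreover have pos: "0 < m ^ k * g"
      using mg by linarith
    moreover have "0 < (\<kappa> + 1) * (m ^ k * g)\<^sup>2"
      using mult_pos_pos[OF _ zero_less_power[OF pos]] kappa_nonneg by simp
    ultimately show ?thesis
      using Paley_Zygmund_half[of "\<lambda>\<omega>. S (shift [i] (env \<omega>))" "(\<kappa> + 1) * (m ^ k * g)\<^sup>2"] ES2
      unfolding ES(1) by measurable
  qed
  also have "\<dots> \<le> prob {\<omega> \<in> space M. good \<delta> a n i k (Suc l) (shift [i] (env \<omega>))}"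
  proof (rule finite_measure_mono)
    have "2 \<le> a ^ k * S e" if "m ^ k * g / 2 \<le> S e" for e
    proof -
      have "2 = 4 / q * q / 2" using q by simp
      also have "\<dots> \<le> (a * m) ^ k * g / 2"
        using k gq q am by (intro divide_right_mono mult_mono) auto
      also have "\<dots> = a ^ k * (m ^ k * g / 2)"
        by (simp add: power_mult_distrib)
      also have "\<dots> \<le> a ^ k * S e"
        using that a by (intro mult_left_mono) auto
      finally show ?thesis .
    qed
    then show "{\<omega> \<in> space M. m ^ k * g / 2 \<le> S (shift [i] (env \<omega>))} \<subseteq>
        {\<omega> \<in> space M. good \<delta> a n i k (Suc l) (shift [i] (env \<omega>))}"
      by (auto simp: S_def F_def[abs_def])
  qed (simp del: good.simps)
  also have "\<dots> = E\<^sub>i (\<lambda>e. of_bool (good \<delta> a n i k (Suc l) e))"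
  proof -
    have "(\<lambda>\<omega>. of_bool (good \<delta> a n i k (Suc l) (shift [i] (env \<omega>))) :: real) =
        (\<lambda>\<omega>. indicator {\<omega>. good \<delta> a n i k (Suc l) (shift [i] (env \<omega>))} \<omega>)"
      by (simp add: indicator_def of_bool_def fun_eq_iff)
    then show ?thesis
      by (simp add: Int_def conj_commute del: good.simps)
  qed
  finally show ?case .
qed

text \<open>The events decrease in \<open>l\<close> by \<open>good_Suc_imp\<close>, so the uniform
  bound passes to their intersection.\<close>

lemma good_forever:
  assumes k: "(a * m) ^ k \<ge> 4 / q" and v: "v \<noteq> []" "last v = i"
  shows "expectation (\<lambda>\<omega>. of_bool (\<forall>l. good \<delta> a n i k l (shift v (env \<omega>)))) \<ge> q"
proof -
  have "expectation (\<lambda>\<omega>. of_bool (\<forall>l. good \<delta> a n i k l (shift v (env \<omega>)))) =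
      E\<^sub>i (\<lambda>e. of_bool (\<forall>l. good \<delta> a n i k l e))"
    using v by (intro expectation_shift) auto
  moreover have "(\<lambda>l. E\<^sub>i (\<lambda>e. of_bool (good \<delta> a n i k l e))) \<longlonglongrightarrow> E\<^sub>i (\<lambda>e. of_bool (\<forall>l. good \<delta> a n i k l e))"
  proof (rule integral_dominated_convergence[where w = "\<lambda>_. 1"])
    show "AE \<omega> in M. (\<lambda>l. of_bool (good \<delta> a n i k l (shift [i] (env \<omega>))) :: real) \<longlonglongrightarrow>
        of_bool (\<forall>l. good \<delta> a n i k l (shift [i] (env \<omega>)))"
    proof (intro AE_I2 tendsto_eventually)
      fix \<omega>
      let ?g = "\<lambda>l. good \<delta> a n i k l (shift [i] (env \<omega>))"
      have dec: "?g l'" if "?g l" "l' \<le> l" for l l'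
        using that(2,1) a by (induction rule: inc_induct) (auto intro: good_Suc_imp simp del: good.simps)
      show "eventually (\<lambda>l. of_bool (?g l) = (of_bool (\<forall>l. ?g l) :: real)) sequentially"
      proof (cases "\<forall>l. ?g l")
        case False
        then obtain l0 where "\<not> ?g l0" by blast
        then have "\<not> ?g l" if "l \<ge> l0" for l
          using dec that by blast
        then show ?thesis
          using False by (auto simp: eventually_sequentially intro!: exI[of _ l0])
      qed simp
    qed
  qed auto
  ultimately show ?thesis
    using LIMSEQ_le_const[of _ _ q] prob_good[OF k] by auto
qed

text \<open>Along generations of length tending to infinity in a fixed residue class, the number of
  independent candidates for a good vertex below \<open>u\<close> grows to infinity.\<close>

lemma AE_good_below:
  assumes k: "(a * m) ^ k \<ge> 4 / q" and L: "L \<ge> 1" and d: "CARD('c) \<ge> 2" and r: "r < L"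
  shows "AE \<omega> in M. \<exists>w. w \<noteq> [] \<and> length (u @ w) mod L = r \<and> (\<forall>l. good \<delta> a n i k l (shift (u @ w) (env \<omega>)))"
proof -
  define Gd where "Gd e \<longleftrightarrow> (\<forall>l. good \<delta> a n i k l e)" for e
  have [measurable]: "Measurable.pred env_space Gd"
    unfolding Gd_def by measurable
  define len where "len t = r + (length u + 1) * (L - 1) + t * L" for t
  define W where "W t = (\<lambda>w. w @ [i]) ` words (len t)" for t
  have cardW: "card (W t) = CARD('c) ^ len t" for t
    unfolding W_def by (subst card_image) (auto simp: inj_on_def card_words)
  have W_words: "W t \<subseteq> words (Suc (len t))" for t
    by (auto simp: W_def words_def)
  have mod_len: "length (u @ w) mod L = r" if "w \<in> W t" for w t
  proof -
    obtain L' where "L = Suc L'"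
      using L by (cases L) auto
    then have "length (u @ w) = r + (length u + 1 + t) * L"
      using that by (auto simp: W_def words_def len_def algebra_simps)
    then show ?thesis
      using r by (simp only: mod_mult_self1 mod_less)
  qed
  define N where "N t = {\<omega> \<in> space M. \<forall>w\<in>W t. \<not> Gd (shift (u @ w) (env \<omega>))}" for t
  have finW: "finite (W t)" for t
    by (simp add: W_def)
  have N [measurable]: "N t \<in> events" for t
    unfolding N_def using finW by measurable
  have prob_N: "prob (N t) \<le> (1 - q) ^ t" for t
  proof -
    have "prob (N t) = expectation (\<lambda>\<omega>. 1 * (\<Prod>w\<in>W t. of_bool (\<not> Gd (shift (u @ w) (env \<omega>)))))"
    proof -
      have "prob (N t) = expectation (indicator (N t))"
        by simp
      also have "\<dots> = expectation (\<lambda>\<omega>. 1 * (\<Prod>w\<in>W t. of_bool (\<not> Gd (shift (u @ w) (env \<omega>)))))"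
      proof (intro Bochner_Integration.integral_cong refl)
        fix \<omega> assume "\<omega> \<in> space M"
        then show "indicator (N t) \<omega> = 1 * (\<Prod>w\<in>W t. of_bool (\<not> Gd (shift (u @ w) (env \<omega>))) :: real)"
          using finW[of t] by (auto simp: N_def indicator_def of_bool_def prod_zero_iff)
      qed
      finally show ?thesis .
    qed
    also have "\<dots> = expectation (\<lambda>\<omega>. 1) * (\<Prod>w\<in>W t. expectation (\<lambda>\<omega>. of_bool (\<not> Gd (shift (u @ w) (env \<omega>)))))"
      by (rule expectation_blocks(1)[of "\<lambda>_. 1" "\<lambda>_ e. of_bool (\<not> Gd e)" "W t" "Suc (len t)" u])
         (auto simp: W_words intro!: integrable_const_bound[of _ 1])
    also have "\<dots> \<le> 1 * (\<Prod>w\<in>W t. 1 - q)"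
    proof (intro mult_mono prod_mono conjI prod_nonneg)
      fix w assume "w \<in> W t"
      then have v: "u @ w \<noteq> []" "last (u @ w) = i"
        by (auto simp: W_def)
      have "expectation (\<lambda>\<omega>. of_bool (\<not> Gd (shift (u @ w) (env \<omega>))) :: real) =
          expectation (\<lambda>\<omega>. 1 - of_bool (Gd (shift (u @ w) (env \<omega>))))"
        by (intro Bochner_Integration.integral_cong) auto
      also have "\<dots> = 1 - expectation (\<lambda>\<omega>. of_bool (Gd (shift (u @ w) (env \<omega>))))"
      proof -
        have "integrable M (\<lambda>\<omega>. of_bool (Gd (shift (u @ w) (env \<omega>))) :: real)"
          by (intro integrable_const_bound[of _ 1]) auto
        then show ?thesis
          by (subst Bochner_Integration.integral_diff) (simp_all add: prob_space)
      qed
      also have "\<dots> \<le> 1 - q"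
        using good_forever[OF k v] by (simp add: Gd_def)
      finally show "expectation (\<lambda>\<omega>. of_bool (\<not> Gd (shift (u @ w) (env \<omega>)))) \<le> 1 - q" .
    qed (auto simp: prob_space)
    also have "\<dots> = (1 - q) ^ (CARD('c) ^ len t)"
      by (simp add: cardW)
    \<comment> \<open>Two colours make the number of candidates grow with their depth.\<close>
    also have "\<dots> \<le> (1 - q) ^ t"
    proof (rule power_decreasing)
      have "t \<le> t * L"
        using L by simp
      also have "\<dots> \<le> len t"
        unfolding len_def by (rule le_add2)
      also have "\<dots> \<le> 2 ^ len t"
        by (simp add: less_imp_le less_exp)
      also have "\<dots> \<le> CARD('c) ^ len t"
        using d by (intro power_mono) auto
      finally show "t \<le> CARD('c) ^ len t" .
    qed (use q in auto)
    finally show ?thesis .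
  qed
  have "prob (\<Inter>t. N t) \<le> (1 - q) ^ t" for t
    using prob_N[of t] finite_measure_mono[of "\<Inter>t. N t" "N t"] N by (meson INT_lower UNIV_I order_trans)
  then have "prob (\<Inter>t. N t) \<le> 0"
    using q by (intro LIMSEQ_le_const[OF LIMSEQ_power_zero[of "1 - q"]]) auto
  then have "prob (\<Inter>t. N t) = 0"
    by (simp add: measure_le_0_iff)
  then have "AE \<omega> in M. \<omega> \<notin> (\<Inter>t. N t)"
    by (intro AE_not_in) (auto simp: null_sets_def emeasure_eq_measure)
  with AE_space show ?thesis
  proof eventually_elim
    fix \<omega> assume "\<omega> \<in> space M" "\<omega> \<notin> (\<Inter>t. N t)"
    then obtain t w where w: "w \<in> W t" "Gd (shift (u @ w) (env \<omega>))"
      by (auto simp: N_def)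
    then have "w \<noteq> []"
      by (auto simp: W_def)
    then show "\<exists>w. w \<noteq> [] \<and> length (u @ w) mod L = r \<and> (\<forall>l. good \<delta> a n i k l (shift (u @ w) (env \<omega>)))"
      using w mod_len by (auto simp: Gd_def)
  qed
qed

text \<open>Growth below a good vertex is known only at distances that are multiples of
  \<open>L\<close>. For transience one residue class is enough, because \<open>esc\<close> decreases
  with depth; divergence of \<open>chaos_Y\<close> along all \<open>n\<close> takes a good vertex in
  every residue class of depths.\<close>

lemma transient_and_explosion:
  assumes n: "n \<ge> 1" and d: "CARD('c) \<ge> 2"
  shows "AE \<omega> in M. transient_chain (walk_step (env \<omega>)) \<and>
    filterlim (chaos_Y (env \<omega>)) at_top sequentially"
proof -
  obtain k where k: "(a * m) ^ k > 4 / q"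
    using real_arch_pow[OF am] by blast
  have "k \<noteq> 0"
  proof
    assume "k = 0"
    then have "4 / q < 1" using k by simp
    then show False using q by (simp add: divide_less_eq)
  qed
  define L where "L = k * n"
  have L: "L \<ge> 1"
    using \<open>k \<noteq> 0\<close> n by (simp add: L_def)
  let ?good = "good \<delta> a n i k"
  have step: "2 \<le> trunc_sum \<delta> L (\<lambda>e. of_bool (?good l e)) e" if "?good (Suc l) e" for l e
    unfolding L_def using \<delta> a that by (intro good_Suc_trunc_sum) auto
  obtain c where c: "c > 0" "\<And>l e. pos_ratios e \<Longrightarrow> ?good l e \<Longrightarrow> c \<le> esc (l * L) e"
    using esc_ge_of_good[of \<delta> L ?good, OF \<delta>(1) _ L step] \<delta> by auto
  define P where "P u r \<omega> \<longleftrightarrow> (\<exists>w. w \<noteq> [] \<and> length (u @ w) mod L = r \<and>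
      (\<forall>l. ?good l (shift (u @ w) (env \<omega>))))" for u r \<omega>
  have "countable (lists (UNIV :: 'c set))"
    by (intro countable_lists countable_finite) auto
  then have "countable ((UNIV :: 'c list set) \<times> {..<L})"
    by (intro countable_SIGMA) auto
  moreover have "\<forall>x\<in>UNIV \<times> {..<L}. AE \<omega> in M. P (fst x) (snd x) \<omega>"
    unfolding P_def using k L d by (intro ballI AE_good_below) auto
  ultimately have "AE \<omega> in M. \<forall>x\<in>UNIV \<times> {..<L}. P (fst x) (snd x) \<omega>"
    by (simp only: AE_ball_countable)
  then show ?thesis
    using env_ok
  proof eventually_elim
    fix \<omega> assume P: "\<forall>x\<in>UNIV \<times> {..<L}. P (fst x) (snd x) \<omega>" and "env_ok (\<lambda>v. p v \<omega>)"
    then have ok: "env_ok (env \<omega>)"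
      by (simp add: env_def)
    have good: "\<exists>w. w \<noteq> [] \<and> length (u @ w) mod L = r \<and> (\<forall>l. ?good l (shift (u @ w) (env \<omega>)))" if "r < L" for u r
      using P that by (auto simp: P_def)
    have "transient_chain (walk_step (env \<omega>))"
    proof (rule transient_walk[OF ok])
      fix u
      obtain w where w: "w \<noteq> []" "\<And>l. ?good l (shift (u @ w) (env \<omega>))"
        using good[of 0 u] L by auto
      have pos: "pos_ratios (shift (u @ w) (env \<omega>))"
        using w by (intro pos_ratios_shift_env ok) auto
      have "c \<le> esc l (shift (u @ w) (env \<omega>))" for l
      proof -
        have "c \<le> esc (l * L) (shift (u @ w) (env \<omega>))"
          by (intro c pos w)
        also have "\<dots> \<le> esc l (shift (u @ w) (env \<omega>))"
          using L by (intro decseqD[OF decseq_esc[OF pos]]) simp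
        finally show ?thesis .
      qed
      then show "\<exists>w. w \<noteq> [] \<and> (\<exists>c>0. \<forall>n. c \<le> esc n (shift (u @ w) (env \<omega>)))"
        using w c by blast
    qed
    moreover have "filterlim (chaos_Y (env \<omega>)) at_top sequentially"
      unfolding filterlim_at_top
    proof
      fix B :: real
      have "\<exists>n0. \<forall>n\<ge>n0. n mod L = r \<longrightarrow> B \<le> chaos_Y (env \<omega>) n" if r: "r < L" for r
      proof -
        obtain v where v: "v \<noteq> []" "length v mod L = r" "\<And>l. ?good l (shift v (env \<omega>))"
          using good[OF r, of "[]"] by auto
        have pos: "pos_ratios (shift v (env \<omega>))"
          using v by (intro pos_ratios_shift_env ok)
        have pw: "path_weight (env \<omega>) v > 0"
          by (intro path_weight_pos ok)
        obtain l0 where l0: "B / path_weight (env \<omega>) v < 2 ^ l0"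
          using real_arch_pow[of 2] by auto
        have "B \<le> chaos_Y (env \<omega>) n'" if n': "n' \<ge> length v + l0 * L" "n' mod L = r" for n'
        proof -
          have "(n' - length v) mod L = 0"
            using n' v(2) by (metis add_leD1 mod_eq_dvd_iff_nat mod_0_imp_dvd dvd_imp_mod_0)
          then obtain l where l: "n' - length v = l * L"
            by (metis dvdE mod_0_imp_dvd mult.commute)
          have nl: "n' = length v + l * L"
            using l n' by linarith
          then have "l0 \<le> l"
            using n' L by simp
          have "B \<le> path_weight (env \<omega>) v * 2 ^ l0"
            using l0 pw by (simp add: divide_less_eq mult.commute)
          also have "\<dots> \<le> path_weight (env \<omega>) v * 2 ^ l"
            using pw \<open>l0 \<le> l\<close> by (intro mult_left_mono power_increasing) auto
          also have "\<dots> \<le> path_weight (env \<omega>) v * (\<Sum>w\<in>words (l * L). weight (\<lambda>z. z) w (shift v (env \<omega>)))"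
            using pw weight_sum_ge_of_good[of \<delta> ?good L "shift v (env \<omega>)" l, OF \<delta>(1) step pos v(3)]
            by (intro mult_left_mono) auto
          also have "\<dots> = (\<Sum>w\<in>words (l * L). path_weight (env \<omega>) (v @ w))"
            using v by (simp add: path_weight_append sum_distrib_left)
          also have "\<dots> = (\<Sum>w\<in>(@) v ` words (l * L). path_weight (env \<omega>) w)"
            by (subst sum.reindex) (auto simp: inj_on_def)
          also have "\<dots> \<le> chaos_Y (env \<omega>) n'"
            unfolding chaos_Y_words using path_weight_pos[OF ok]
            by (intro sum_mono2) (auto simp: less_imp_le nl words_def[symmetric] simp flip: length_append, auto simp: words_def)
          finally show ?thesis .
        qed
        then show ?thesis
          by blast
      qed
      then obtain n0 where n0: "\<And>r n. r < L \<Longrightarrow> n \<ge> n0 r \<Longrightarrow> n mod L = r \<Longrightarrow> B \<le> chaos_Y (env \<omega>) n"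
        by metis
      have "B \<le> chaos_Y (env \<omega>) n'" if "n' \<ge> Max (n0 ` {..<L})" for n'
      proof (rule n0[of "n' mod L"])
        have "n0 (n' mod L) \<le> Max (n0 ` {..<L})"
          using L by (intro Max_ge) auto
        then show "n0 (n' mod L) \<le> n'"
          using that by linarith
      qed (use L in auto)
      then show "eventually (\<lambda>n. B \<le> chaos_Y (env \<omega>) n) sequentially"
        unfolding eventually_sequentially by blast
    qed
    ultimately show "transient_chain (walk_step (env \<omega>)) \<and> filterlim (chaos_Y (env \<omega>)) at_top sequentially" ..
  qed
qed

end

end

section \<open>The phase transition\<close>

lemma prob_space_AE_pos_integral:
  fixes X :: "'a \<Rightarrow> real"
  assumes "prob_space M" "integrable M X" "AE \<omega> in M. X \<omega> > 0"
  shows "integral\<^sup>L M X > 0"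
proof -
  interpret prob_space M by fact
  have nonneg: "AE \<omega> in M. X \<omega> \<ge> 0"
    using assms(3) by eventually_elim simp
  have "integral\<^sup>L M X \<noteq> 0"
  proof
    assume "integral\<^sup>L M X = 0"
    then have "AE \<omega> in M. X \<omega> = 0"
      using integral_nonneg_eq_0_iff_AE[OF assms(2) nonneg] by simp
    with assms(3) have "AE \<omega> in M. False"
      by eventually_elim simp
    then show False
      by simp
  qed
  then show ?thesis
    using integral_nonneg_AE[OF nonneg] by simp
qed

text \<open>A lower bound free of \<open>x\<close>; its expectations give one constant below all
  entries of all moment matrices.\<close>

lemma min_one_le_powr:
  fixes z x :: real
  assumes "z > 0" "0 \<le> x" "x \<le> 1"
  shows "min 1 z \<le> z powr x"
proof (cases "z \<ge> 1")
  case True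
  then show ?thesis
    using ge_one_powr_ge_zero[of z x] assms by simp
next
  case False
  then have "z powr 1 \<le> z powr x"
    using assms by (intro powr_mono') auto
  then show ?thesis
    using assms by simp
qed

theorem theorem1p3:
  fixes M :: "'w measure" and p :: "'c::finite list \<Rightarrow> 'w \<Rightarrow> real ^ ('c option)"
    and \<alpha> :: 'c and Q :: "'b measure" and \<eta> :: "'b \<Rightarrow> real ^ 'c ^ 'c" and lam :: real
  assumes M: "prob_space M"
    and indep: "prob_space.indep_vars M (\<lambda>_. borel) p UNIV"
    and sum_p: "\<And>v. AE \<omega> in M. (\<Sum>s\<in>UNIV. p v \<omega> $ s) = 1"
    and pos_p: "\<And>v. v \<noteq> [] \<Longrightarrow> AE \<omega> in M. \<forall>s. p v \<omega> $ s > 0"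
    and root_p: "AE \<omega> in M. p [] \<omega> $ None = 0 \<and> (\<forall>j. p [] \<omega> $ Some j > 0)"
    and law_p: "\<And>v w. v \<noteq> [] \<Longrightarrow> w \<noteq> [] \<Longrightarrow> colour \<alpha> v = colour \<alpha> w \<Longrightarrow>
                  distr M borel (p v) = distr M borel (p w)"
    and inv_p: "\<And>v. v \<noteq> [] \<Longrightarrow> integrable M (\<lambda>\<omega>. 1 / p v \<omega> $ None)"
    and Q: "prob_space Q"
    and meas_eta: "\<eta> \<in> borel_measurable Q"
    and law_eta: "\<And>v. v \<noteq> [] \<Longrightarrow>
                  distr Q borel (\<lambda>\<omega>. \<eta> \<omega> $ colour \<alpha> v) =
                  distr M borel (\<lambda>\<omega>. \<chi> j. p v \<omega> $ Some j / p v \<omega> $ None)"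
    and int_eta: "\<And>i j. integrable Q (\<lambda>\<omega>. \<eta> \<omega> $ i $ j)"
    and log_eta: "\<And>i j. integrable Q (\<lambda>\<omega>. \<eta> \<omega> $ i $ j * max 0 (ln (\<eta> \<omega> $ i $ j)))"
    and atom_eta: "\<And>i j. measure Q {\<omega> \<in> space Q. \<eta> \<omega> $ i $ j = 0} = 0"
    and regular: "regular_family (moment_matrix Q \<eta>)"
    and lam: "lam = (INF x\<in>{0..1}. largest_eigenvalue (moment_matrix Q \<eta> x))"
  shows "(lam < 1 \<longrightarrow>
            (AE \<omega> in M. ergodic_chain (walk_step (\<lambda>v. p v \<omega>))) \<and>
            (AE \<omega> in M. convergent (chaos_Z (\<lambda>v. p v \<omega>)))) \<and>
         (lam > 1 \<longrightarrow>
            (AE \<omega> in M. transient_chain (walk_step (\<lambda>v. p v \<omega>))) \<and>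
            (AE \<omega> in M. filterlim (chaos_Y (\<lambda>v. p v \<omega>)) at_top sequentially))"
proof -
  interpret prob_space M by (fact M)
  have "countable (lists (UNIV :: 'c set))"
    by (intro countable_lists countable_finite) auto
  then have count: "countable (UNIV :: 'c list set)"
    by simp
  \<comment> \<open>Countability of the tree turns the conditions for single vertices into one
    almost sure event.\<close>
  have "AE \<omega> in M. \<forall>v\<in>UNIV. (\<Sum>s\<in>UNIV. p v \<omega> $ s) = 1"
    unfolding AE_ball_countable[OF count] using sum_p by simp
  moreover have "AE \<omega> in M. \<forall>v\<in>UNIV - {[]}. \<forall>s. p v \<omega> $ s > 0"
    using pos_p countable_subset[OF _ count] by (subst AE_ball_countable) auto
  ultimately have ok: "AE \<omega> in M. env_ok (\<lambda>v. p v \<omega>)"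
    using root_p by eventually_elim (auto simp: env_ok_def)
  interpret R: random_env M p
  proof
    show "indep_vars (\<lambda>_. borel) p UNIV"
      by (fact indep)
    show "distr M borel (p v) = distr M borel (p w)" if "v \<noteq> []" "w \<noteq> []" "last v = last w" for v w
      using that by (intro law_p) (simp_all add: colour_def)
    show "AE \<omega> in M. env_ok (\<lambda>v. p v \<omega>)"
      by (fact ok)
  qed
  have env: "R.env \<omega> = (\<lambda>v. p v \<omega>)" for \<omega>
    by (rule R.env_def)
  have [measurable]: "(\<lambda>\<omega>. \<eta> \<omega> $ i) \<in> Q \<rightarrow>\<^sub>M borel" for i
    using meas_eta by (rule measurable_compose) (intro borel_measurable_continuous_onI continuous_intros)
  have [measurable]: "(\<lambda>\<omega>. \<chi> j. p [i] \<omega> $ Some j / p [i] \<omega> $ None) \<in> M \<rightarrow>\<^sub>M borel" for i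
  proof (rule borel_measurable_euclidean_space[THEN iffD2], rule ballI)
    fix b :: "real ^ 'c" assume "b \<in> Basis"
    then obtain j where "b = axis j 1"
      by (auto simp: Basis_vec_def)
    then show "(\<lambda>\<omega>. (\<chi> j. p [i] \<omega> $ Some j / p [i] \<omega> $ None) \<bullet> b) \<in> borel_measurable M"
      by (simp add: inner_axis)
  qed
  have law: "distr Q borel (\<lambda>\<omega>. \<eta> \<omega> $ i) = distr M borel (\<lambda>\<omega>. \<chi> j. p [i] \<omega> $ Some j / p [i] \<omega> $ None)" for i
    using law_eta[of "[i]"] by simp
  \<comment> \<open>Entries of \<eta> are compared with the ratios at the vertex \<open>[i]\<close>,
    through the law of the whole row.\<close>
  have transfer: "(\<integral>\<omega>. \<phi> (\<eta> \<omega> $ i $ j) \<partial>Q) = R.moment \<phi> i j"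
    "integrable Q (\<lambda>\<omega>. \<phi> (\<eta> \<omega> $ i $ j)) \<longleftrightarrow> integrable M (\<lambda>\<omega>. \<phi> (ratio (shift [i] (R.env \<omega>)) j))"
    if [measurable]: "\<phi> \<in> borel_measurable borel" for \<phi> :: "real \<Rightarrow> real" and i j
  proof -
    have "(\<integral>\<omega>. \<phi> (\<eta> \<omega> $ i $ j) \<partial>Q) = (\<integral>x. \<phi> (x $ j) \<partial>distr Q borel (\<lambda>\<omega>. \<eta> \<omega> $ i))"
      by (rule integral_distr[symmetric]) measurable
    also have "\<dots> = R.moment \<phi> i j"
      unfolding law by (subst integral_distr) (simp_all add: R.moment_def ratio_def shift_def env)
    finally show "(\<integral>\<omega>. \<phi> (\<eta> \<omega> $ i $ j) \<partial>Q) = R.moment \<phi> i j" .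
    have "integrable Q (\<lambda>\<omega>. \<phi> (\<eta> \<omega> $ i $ j)) \<longleftrightarrow> integrable (distr Q borel (\<lambda>\<omega>. \<eta> \<omega> $ i)) (\<lambda>x. \<phi> (x $ j))"
      by (rule integrable_distr_eq[symmetric]) measurable
    also have "\<dots> \<longleftrightarrow> integrable M (\<lambda>\<omega>. \<phi> (ratio (shift [i] (R.env \<omega>)) j))"
      unfolding law by (subst integrable_distr_eq) (simp_all add: ratio_def shift_def env)
    finally show "integrable Q (\<lambda>\<omega>. \<phi> (\<eta> \<omega> $ i $ j)) \<longleftrightarrow> integrable M (\<lambda>\<omega>. \<phi> (ratio (shift [i] (R.env \<omega>)) j))" .
  qed
  have int_ratio: "integrable M (\<lambda>\<omega>. ratio (shift [i] (R.env \<omega>)) j)" for i j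
    using transfer(2)[of "\<lambda>z. z"] int_eta by simp
  have mm: "moment_matrix Q \<eta> x $ i $ j = R.moment (\<lambda>z. z powr x) i j" for x i j
    using transfer(1)[of "\<lambda>z. z powr x" i j] by (simp add: moment_matrix_def)
  have pos: "AE \<omega> in M. 0 < ratio (shift [i] (R.env \<omega>)) j" for i j
    using R.pos_ratios_env[of "[i]"] by (auto elim!: eventually_mono dest: pos_ratios_pos)
  have int_min: "integrable M (\<lambda>\<omega>. min 1 (ratio (shift [i] (R.env \<omega>)) j))" for i j
    using int_ratio by (intro integrable_min) auto
  \<comment> \<open>Positive since the ratios are almost surely positive, and below every entry of
    the moment matrices for all \<open>x\<close> in the unit interval.\<close>
  define c where "c = Min (range (\<lambda>(i, j). R.moment (min 1) i j))"
  have "c \<in> range (\<lambda>(i, j). R.moment (min 1) i j)"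
    unfolding c_def by (intro Min_in) auto
  moreover have "R.moment (min 1) i j > 0" for i j
    unfolding R.moment_def
    by (intro prob_space_AE_pos_integral M int_min) (use pos[of i j] in \<open>auto elim!: eventually_mono\<close>)
  ultimately have c: "c > 0"
    by auto
  have c_le: "c \<le> R.moment (\<lambda>z. z powr x) i j" if x: "0 \<le> x" "x \<le> 1" for x i j
  proof -
    have "c \<le> R.moment (min 1) i j"
      unfolding c_def by (intro Min_le) (auto intro: image_eqI[where x = "(i, j)"])
    also have "\<dots> \<le> R.moment (\<lambda>z. z powr x) i j"
      unfolding R.moment_def
      by (intro integral_mono_AE int_min R.integrable_powr_ratio int_ratio x)
        (use pos[of i j] in \<open>auto elim!: eventually_mono intro: min_one_le_powr[OF _ x, simplified]\<close>)
    finally show ?thesis .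
  qed
  have mm_pos: "moment_matrix Q \<eta> x $ i $ j > 0" if "x \<in> {0..1}" for x i j
    using c c_le[of x i j] that by (simp add: mm)
  let ?\<rho> = "\<lambda>x. largest_eigenvalue (moment_matrix Q \<eta> x)"
  show ?thesis
  proof (intro conjI impI)
    assume "lam < 1"
    then obtain x where x: "x \<in> {0..1}" "?\<rho> x < 1"
      unfolding lam using cInf_lessD[of "?\<rho> ` {0..1}" 1] by auto
    obtain v r where v: "moment_matrix Q \<eta> x *v v = r *s v" "r > 0" "\<And>i. v $ i > 0"
      using positive_eigenvector_exists[of "moment_matrix Q \<eta> x"] mm_pos[OF x(1)] by blast
    have "v \<noteq> 0"
      using v(3)[of undefined] by auto
    then have "mat_eigenvalue (moment_matrix Q \<eta> x) r"
      using v(1) unfolding mat_eigenvalue_def by blast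
    then have "r < 1"
      using largest_eigenvalue_positive_matrix(3)[OF mm_pos[OF x(1)]] x(2) by fastforce
    have eig: "(\<Sum>j\<in>UNIV. R.moment (\<lambda>z. z powr x) i j * v $ j) = r * v $ i" for i
      using arg_cong[OF v(1), of "\<lambda>v. v $ i"] by (simp add: matrix_vector_mult_def mm)
    have "AE \<omega> in M. summable (chaos_Y (R.env \<omega>))"
      by (rule R.AE_summable_chaos_Y[OF _ _ _ eig v(3) v(2) \<open>r < 1\<close>])
         (use x int_ratio in \<open>auto intro!: R.integrable_powr_ratio\<close>)
    then show "AE \<omega> in M. ergodic_chain (walk_step (\<lambda>v. p v \<omega>))"
      using R.env_ok by eventually_elim (simp add: env ergodic_walk)
    show "AE \<omega> in M. convergent (chaos_Z (\<lambda>v. p v \<omega>))"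
      using \<open>AE \<omega> in M. summable (chaos_Y (R.env \<omega>))\<close>
      by eventually_elim (simp add: env chaos_Z_def[abs_def] summable_iff_convergent')
  next
    assume "lam > 1"
    have lam_le: "lam \<le> ?\<rho> x" if "x \<in> {0..1}" for x
      unfolding lam using largest_eigenvalue_positive_matrix(2)[OF mm_pos] that
      by (intro cINF_lower bdd_belowI2[of _ 0]) (auto simp: less_imp_le)
    \<comment> \<open>At exponent 0 the entries are at most 1, so the largest eigenvalue, which
      exceeds 1, is at most the number of colours.\<close>
    have "CARD('c) \<ge> 2"
    proof -
      have "\<bar>moment_matrix Q \<eta> 0 $ i $ j\<bar> \<le> 1" for i j
      proof -
        have "R.moment (\<lambda>z. z powr 0) i j \<le> expectation (\<lambda>\<omega>. 1)"
          unfolding R.moment_def by (intro integral_mono R.integrable_powr_ratio int_ratio) auto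
        then show ?thesis
          using mm_pos[of 0 i j] by (simp add: mm prob_space)
      qed
      moreover obtain v where "v \<noteq> 0" "moment_matrix Q \<eta> 0 *v v = ?\<rho> 0 *s v"
        using largest_eigenvalue_positive_matrix(1)[OF mm_pos[of 0]] by (auto simp: mat_eigenvalue_def)
      ultimately have "\<bar>?\<rho> 0\<bar> \<le> 1 * real (CARD('c))"
        by (intro eigenvalue_le_row_sum)
      then have "1 < real (CARD('c))"
        using lam_le[of 0] \<open>lam > 1\<close> by simp
      then show ?thesis
        by simp
    qed
    \<comment> \<open>\<open>n0\<close> serves all \<open>x\<close>, since \<open>lam\<close> lies
      below every largest eigenvalue; \<open>N\<close> adds the two connecting steps of
      \<open>return_sum_lower\<close>.\<close>
    obtain n0 where n0: "2 / c\<^sup>2 < lam ^ n0"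
      using real_arch_pow[OF \<open>lam > 1\<close>] by blast
    define N where "N = Suc (n0 + 1)"
    have ge2: "2 \<le> return_sum (R.moment (\<lambda>z. z powr x)) N i" if x: "0 \<le> x" "x \<le> 1" for x i
    proof -
      obtain v where v: "v \<noteq> 0" "moment_matrix Q \<eta> x *v v = ?\<rho> x *s v"
        using largest_eigenvalue_positive_matrix(1)[OF mm_pos[of x]] x by (auto simp: mat_eigenvalue_def)
      obtain i1 where i1: "\<And>j. \<bar>v $ j\<bar> \<le> \<bar>v $ i1\<bar>"
        using vec_abs_max_attained[of v] by blast
      then have "v $ i1 \<noteq> 0"
        using v(1) by (auto simp: vec_eq_iff)
      have eig: "(\<Sum>j\<in>UNIV. R.moment (\<lambda>z. z powr x) i j * v $ j) = ?\<rho> x * v $ i" for i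
        using arg_cong[OF v(2), of "\<lambda>v. v $ i"] by (simp add: matrix_vector_mult_def mm)
      have "2 \<le> c\<^sup>2 * lam ^ n0"
        using n0 c by (simp add: field_simps)
      also have "\<dots> \<le> c\<^sup>2 * ?\<rho> x ^ n0"
        using lam_le[of x] x \<open>lam > 1\<close> by (intro mult_left_mono power_mono) auto
      also have "\<dots> \<le> return_sum (R.moment (\<lambda>z. z powr x)) N i"
        unfolding N_def
        using c_le[OF x] c eig _ \<open>v $ i1 \<noteq> 0\<close> i1
        by (rule return_sum_lower) (use lam_le[of x] x \<open>lam > 1\<close> in auto)
      finally show ?thesis .
    qed
    \<comment> \<open>Any colour will do, because \<open>ge2\<close> holds for every
      \<open>i\<close>.\<close>
    define i where "i = (undefined :: 'c)"
    obtain \<delta> a n where "0 < \<delta>" "\<delta> < 1" "0 < a" "a \<le> 1" "n \<ge> 1"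
      "1 < a * (\<Sum>w\<in>words n. of_bool (colour i w = i) * expectation (\<lambda>\<omega>. heavy \<delta> a w (shift [i] (R.env \<omega>))))"
      by (rule R.supercritical_block[OF int_ratio _ ge2]) (auto simp: N_def)
    then have "AE \<omega> in M. transient_chain (walk_step (R.env \<omega>)) \<and> filterlim (chaos_Y (R.env \<omega>)) at_top sequentially"
      using \<open>CARD('c) \<ge> 2\<close> by (intro R.transient_and_explosion[OF refl _ _ _ _ _ refl refl]) auto
    then show "AE \<omega> in M. transient_chain (walk_step (\<lambda>v. p v \<omega>))"
      "AE \<omega> in M. filterlim (chaos_Y (\<lambda>v. p v \<omega>)) at_top sequentially"
      by (auto simp: env elim: eventually_mono)
  qed
qed

end
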